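(* Let $\mathcal{E}_1$ be the class of all finite simplicial complexes $\Delta$ with $\operatorname{elocr}(\Delta)\le 1$. Then $\mathcal{E}_1$ contains all thickened graphs, and $\mathcal{E}_1$ is closed under the 1-sum and cone operations; that is, if $\Delta,\Gamma\in\mathcal{E}_1$ then every 1-sum $\Delta\oplus\Gamma$ is in $\mathcal{E}_1$ and the cone $\hat\Delta$ is in $\mathcal{E}_1$.
   Context: A simplicial complex $\Delta$ on a finite vertex set $V(\Delta)$ is a family of subsets of $V(\Delta)$ (called faces) that is closed under taking subsets and contains all singletons. Given an equivalence relation on the vertices of a complex, the quotient complex has the equivalence classes as vertices and the images of faces as faces. A complex is chordal if it is the clique complex (faces are the vertex sets of cliques) of a chordal graph, i.e. a graph with no induced cycle of length at least 4. Thickened graphs: Let $D$ be a finite directed graph, possibly with loops and multiple edges, i.e. finite sets $V(D),E(D)$ with functions $h,t:E(D)\to V(D)$ (head and tail). For each $e\in E(D)$ let $\Delta_e$ be a chordal complex with two distinguished vertices $H(e),T(e)\in V(\Delta_e)$ such that $\{H(e),T(e)\}$ is not a face of $\Delta_e$. Form the disjoint union $\Gamma=\left(\bigsqcup_{e\in E(D)}\Delta_e\right)\sqcup V(D)$, where $V(D)$ is viewed as a zero-dimensional complex. The thickening of $D$ by this data is the quotient of $\Gamma$ obtained by identifying $h(e)$ with $H(e)$ and $t(e)$ with $T(e)$ for every $e\in E(D)$. A thickened graph is any complex obtained in this way. 1-sum: for complexes $\Delta,\Gamma$ on disjoint vertex sets and vertices $a\in V(\Delta)$, $b\in V(\Gamma)$,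 the 1-sum $\Delta\oplus\Gamma$ is the quotient of $\Delta\sqcup\Gamma$ identifying $a$ and $b$. Cone: with a new vertex $*\notin V(\Delta)$, $\hat\Delta=\{S\subseteq V(\Delta)\cup\{*\}:S\in\Delta\text{ or }S\setminus\{*\}\in\Delta\}$. For a complex $\Delta$, let $I(\Delta)\subseteq\mathbb{R}[x_i:i\in V(\Delta)]$ be the ideal generated by the monomials $\prod_{i\in S}x_i$ with $S\subseteq V(\Delta)$, $S\notin\Delta$, and let $R_d(\Delta)$ be the degree $d$ homogeneous part of $\mathbb{R}[x_i:i\in V(\Delta)]/I(\Delta)$. Elements of $R_d(\Delta)$ are regarded as functions on $\bigcup_{F\in\Delta}\operatorname{span}\{e_i:i\in F\}\subseteq\mathbb{R}^{V(\Delta)}$. Let $\mathcal{P}(\Delta)\subseteq R_2(\Delta)$ be the convex cone of quadratic forms that are nonnegative on this union, and $\Sigma(\Delta)\subseteq\mathcal{P}(\Delta)$ the cone of sums of squares of elements of $R_1(\Delta)$. A nonzero element $x$ of a convex cone $C$ spans an extreme ray if there are no linearly independent $y,z\in C$ with $x=y+z$. The rank of a sum-of-squares form is the least $k$ such that it is a sum of $k$ squares of linear forms. For $q\in\mathcal{P}(\Delta)$ the local rank is $\operatorname{locr}(q)=\max_{F\in\Delta}\operatorname{rank}(q|_{\operatorname{span}\{e_i:i\in F\}})$. The extreme local rank $\operatorname{elocr}(\Delta)$ is the maximum of $\operatorname{locr}(q)$ over those $q\in\mathcal{P}(\Delta)\setminus\Sigma(\Delta)$ which span an extreme ray of $\mathcal{P}(\Delta)$;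 it is defined to be $0$ if $\Delta$ is chordal. *)

theory Defs
  imports
    Complex_Main
    "HOL-Library.Poly_Mapping"
    "HOL-Algebra.QuotRing"
    "Graph_Theory.Digraph"
begin

section \<open>Simplicial complexes\<close>

text \<open>
  A complex is represented by its set of faces. Since all singletons of vertices are faces, the
  vertex set is the union of all faces. The empty set is required to be a face (otherwise a
  downward closed family has no faces at all).
\<close>

definition vertices :: "'v set set \<Rightarrow> 'v set" where
  "vertices \<Delta> = \<Union>\<Delta>"

definition simplicial_complex :: "'v set set \<Rightarrow> bool" where
  "simplicial_complex \<Delta> \<longleftrightarrow>
     finite (vertices \<Delta>) \<and> {} \<in> \<Delta> \<and> (\<forall>F\<in>\<Delta>. \<forall>G. G \<subseteq> F \<longrightarrow> G \<in> \<Delta>)"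

definition quotient_complex :: "'v set set \<Rightarrow> ('v \<times> 'v) set \<Rightarrow> 'v set set set" where
  "quotient_complex \<Delta> r = (\<lambda>F. (\<lambda>v. r `` {v}) ` F) ` \<Delta>"

text \<open>The equivalence relation on \<open>V\<close> generated by \<open>S \<subseteq> V \<times> V\<close>.\<close>

definition generated_equiv :: "'v set \<Rightarrow> ('v \<times> 'v) set \<Rightarrow> ('v \<times> 'v) set" where
  "generated_equiv V S = (S \<union> S\<inverse>)\<^sup>* \<inter> V \<times> V"

definition one_sum :: "'v set set \<Rightarrow> 'v set set \<Rightarrow> 'v \<Rightarrow> 'v \<Rightarrow> 'v set set set" where
  "one_sum \<Delta> \<Gamma> a b =
     quotient_complex (\<Delta> \<union> \<Gamma>) (generated_equiv (vertices (\<Delta> \<union> \<Gamma>)) {(a, b)})"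

definition cone :: "'v \<Rightarrow> 'v set set \<Rightarrow> 'v set set" where
  "cone v \<Delta> = {S. S \<subseteq> vertices \<Delta> \<union> {v} \<and> (S \<in> \<Delta> \<or> S - {v} \<in> \<Delta>)}"


section \<open>Chordal complexes and thickened graphs\<close>

text \<open>
  The locale predicate \<^const>\<open>graph\<close> describes finite simple graphs, encoded as symmetric
  loop-free digraphs without parallel arcs; \<^term>\<open>arcs_ends G\<close> is the adjacency relation.
\<close>

definition induced_cycle :: "('v, 'e) pre_digraph \<Rightarrow> 'v list \<Rightarrow> bool" where
  "induced_cycle G xs \<longleftrightarrow>
     length xs \<ge> 3 \<and> distinct xs \<and> set xs \<subseteq> verts G \<and>
     (\<forall>i<length xs. \<forall>j<length xs.
        (xs ! i, xs ! j) \<in> arcs_ends G \<longleftrightarrow>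
          j = Suc i mod length xs \<or> i = Suc j mod length xs)"

definition chordal_graph :: "('v, 'e) pre_digraph \<Rightarrow> bool" where
  "chordal_graph G \<longleftrightarrow> graph G \<and> \<not> (\<exists>xs. length xs \<ge> 4 \<and> induced_cycle G xs)"

definition clique_complex :: "('v, 'e) pre_digraph \<Rightarrow> 'v set set" where
  "clique_complex G =
     {K. K \<subseteq> verts G \<and> (\<forall>u\<in>K. \<forall>v\<in>K. u \<noteq> v \<longrightarrow> (u, v) \<in> arcs_ends G)}"

text \<open>
  Every simple graph on vertices of type \<^typ>\<open>'v\<close> can be given arcs of type \<^typ>\<open>'v \<times> 'v\<close>.
\<close>

definition chordal_complex :: "'v set set \<Rightarrow> bool" where
  "chordal_complex \<Delta> \<longleftrightarrow>
     (\<exists>G :: ('v, 'v \<times> 'v) pre_digraph. chordal_graph G \<and> \<Delta> = clique_complex G)"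

definition thickening_data ::
  "('n, 'e) pre_digraph \<Rightarrow> ('e \<Rightarrow> 'v set set) \<Rightarrow> ('e \<Rightarrow> 'v) \<Rightarrow> ('e \<Rightarrow> 'v) \<Rightarrow> bool" where
  "thickening_data D C H T \<longleftrightarrow>
     fin_digraph D \<and>
     (\<forall>e\<in>arcs D. chordal_complex (C e) \<and>
        H e \<in> vertices (C e) \<and> T e \<in> vertices (C e) \<and> {H e, T e} \<notin> C e)"

text \<open>
  The disjoint union of the complexes \<open>C e\<close> and the zero-dimensional complex on the vertices
  of \<open>D\<close>: the vertex \<open>v\<close> of \<open>C e\<close> becomes \<open>Inl (e, v)\<close>, the vertex \<open>n\<close> of \<open>D\<close> becomes \<open>Inr n\<close>.
\<close>

definition thickening_union ::
  "('n, 'e) pre_digraph \<Rightarrow> ('e \<Rightarrow> 'v set set) \<Rightarrow> ('e \<times> 'v + 'n) set set" where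
  "thickening_union D C =
     (\<Union>e\<in>arcs D. (\<lambda>F. (\<lambda>v. Inl (e, v)) ` F) ` C e) \<union> {{}} \<union> {{Inr n} | n. n \<in> verts D}"

definition thickening ::
  "('n, 'e) pre_digraph \<Rightarrow> ('e \<Rightarrow> 'v set set) \<Rightarrow> ('e \<Rightarrow> 'v) \<Rightarrow> ('e \<Rightarrow> 'v)
     \<Rightarrow> ('e \<times> 'v + 'n) set set set" where
  "thickening D C H T =
     quotient_complex (thickening_union D C)
       (generated_equiv (vertices (thickening_union D C))
          ({(Inr (head D e), Inl (e, H e)) | e. e \<in> arcs D} \<union>
           {(Inr (tail D e), Inl (e, T e)) | e. e \<in> arcs D}))"

definition thickened_graphs :: "('e \<times> 'v + 'n) set set set set" where
  "thickened_graphs = {thickening D C H T | D C H T. thickening_data D C H T}"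


section \<open>Stanley-Reisner rings\<close>

text \<open>Real polynomials in variables \<open>x\<^sub>i\<close> indexed by \<open>i :: 'v\<close>; monomials are exponent vectors.\<close>

type_synonym 'v rpoly = "('v \<Rightarrow>\<^sub>0 nat) \<Rightarrow>\<^sub>0 real"

definition const_poly :: "real \<Rightarrow> 'v rpoly" where
  "const_poly c = Poly_Mapping.single 0 c"

definition var_poly :: "'v \<Rightarrow> 'v rpoly" where
  "var_poly i = Poly_Mapping.single (Poly_Mapping.single i 1) 1"

definition eval_poly :: "'v rpoly \<Rightarrow> ('v \<Rightarrow> real) \<Rightarrow> real" where
  "eval_poly p x =
     (\<Sum>m\<in>Poly_Mapping.keys p. Poly_Mapping.lookup p m *
        (\<Prod>i\<in>Poly_Mapping.keys m. x i ^ Poly_Mapping.lookup m i))"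

definition homogeneous :: "nat \<Rightarrow> 'v rpoly \<Rightarrow> bool" where
  "homogeneous d p \<longleftrightarrow>
     (\<forall>m\<in>Poly_Mapping.keys p. (\<Sum>i\<in>Poly_Mapping.keys m. Poly_Mapping.lookup m i) = d)"

text \<open>The polynomial ring \<open>\<real>[x\<^sub>i : i \<in> V]\<close>.\<close>

definition poly_ring :: "'v set \<Rightarrow> 'v rpoly ring" where
  "poly_ring V =
     \<lparr>carrier = {p. \<forall>m\<in>Poly_Mapping.keys p. Poly_Mapping.keys m \<subseteq> V},
      mult = (*), one = 1, zero = 0, add = (+)\<rparr>"

definition SR_ideal :: "'v set set \<Rightarrow> 'v rpoly set" where
  "SR_ideal \<Delta> =
     genideal (poly_ring (vertices \<Delta>)) {(\<Prod>i\<in>S. var_poly i) | S. S \<subseteq> vertices \<Delta> \<and> S \<notin> \<Delta>}"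

definition SR_ring :: "'v set set \<Rightarrow> 'v rpoly set ring" where
  "SR_ring \<Delta> = poly_ring (vertices \<Delta>) Quot SR_ideal \<Delta>"

text \<open>The residue class of \<open>p\<close> in the Stanley-Reisner ring.\<close>

definition SR_class :: "'v set set \<Rightarrow> 'v rpoly \<Rightarrow> 'v rpoly set" where
  "SR_class \<Delta> p = SR_ideal \<Delta> +>\<^bsub>poly_ring (vertices \<Delta>)\<^esub> p"

definition SR_degree :: "'v set set \<Rightarrow> nat \<Rightarrow> 'v rpoly set set" where
  "SR_degree \<Delta> d = SR_class \<Delta> ` {p \<in> carrier (poly_ring (vertices \<Delta>)). homogeneous d p}"

text \<open>The span of the standard basis vectors \<open>e\<^sub>i\<close>, \<open>i \<in> F\<close>, in \<open>\<real>\<^sup>V\<close>.\<close>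

definition coord_subspace :: "'v set \<Rightarrow> ('v \<Rightarrow> real) set" where
  "coord_subspace F = {x. \<forall>i. i \<notin> F \<longrightarrow> x i = 0}"

definition realization :: "'v set set \<Rightarrow> ('v \<Rightarrow> real) set" where
  "realization \<Delta> = (\<Union>F\<in>\<Delta>. coord_subspace F)"

text \<open>
  Residue classes as functions on \<open>realization \<Delta>\<close>: all polynomials in a class take the same value
  at such a point, because the generators of \<open>SR_ideal \<Delta>\<close> vanish there.
\<close>

definition SR_eval :: "'v rpoly set \<Rightarrow> ('v \<Rightarrow> real) \<Rightarrow> real" where
  "SR_eval q x = the_elem ((\<lambda>p. eval_poly p x) ` q)"


section \<open>Nonnegative forms, sums of squares and extreme local rank\<close>

definition nonneg_forms :: "'v set set \<Rightarrow> 'v rpoly set set" where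
  "nonneg_forms \<Delta> = {q \<in> SR_degree \<Delta> 2. \<forall>x\<in>realization \<Delta>. 0 \<le> SR_eval q x}"

definition sos_forms :: "'v set set \<Rightarrow> 'v rpoly set set" where
  "sos_forms \<Delta> =
     {(\<Oplus>\<^bsub>SR_ring \<Delta>\<^esub> j\<in>{..<k}. l j \<otimes>\<^bsub>SR_ring \<Delta>\<^esub> l j) | (k :: nat) l.
        \<forall>j<k. l j \<in> SR_degree \<Delta> 1}"

definition lin_indep2 :: "'v set set \<Rightarrow> 'v rpoly set \<Rightarrow> 'v rpoly set \<Rightarrow> bool" where
  "lin_indep2 \<Delta> y z \<longleftrightarrow>
     (\<forall>a b. (SR_class \<Delta> (const_poly a) \<otimes>\<^bsub>SR_ring \<Delta>\<^esub> y) \<oplus>\<^bsub>SR_ring \<Delta>\<^esub>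
              (SR_class \<Delta> (const_poly b) \<otimes>\<^bsub>SR_ring \<Delta>\<^esub> z) = \<zero>\<^bsub>SR_ring \<Delta>\<^esub>
        \<longrightarrow> a = 0 \<and> b = 0)"

definition spans_extreme_ray :: "'v set set \<Rightarrow> 'v rpoly set set \<Rightarrow> 'v rpoly set \<Rightarrow> bool" where
  "spans_extreme_ray \<Delta> K q \<longleftrightarrow>
     q \<in> K \<and> q \<noteq> \<zero>\<^bsub>SR_ring \<Delta>\<^esub> \<and>
     \<not> (\<exists>y\<in>K. \<exists>z\<in>K. lin_indep2 \<Delta> y z \<and> q = y \<oplus>\<^bsub>SR_ring \<Delta>\<^esub> z)"

text \<open>
  The rank of the quadratic form \<open>f\<close> on the span of \<open>e\<^sub>i\<close>, \<open>i \<in> F\<close>. The minimum exists whenever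
  \<open>f\<close> is nonnegative on this span, since \<open>f\<close> is then a sum of squares there.
\<close>

definition form_rank :: "'v set \<Rightarrow> (('v \<Rightarrow> real) \<Rightarrow> real) \<Rightarrow> nat" where
  "form_rank F f =
     (LEAST k. \<exists>l :: nat \<Rightarrow> 'v rpoly.
        (\<forall>j<k. l j \<in> carrier (poly_ring F) \<and> homogeneous 1 (l j)) \<and>
        (\<forall>x\<in>coord_subspace F. f x = (\<Sum>j<k. (eval_poly (l j) x)\<^sup>2)))"

definition locr :: "'v set set \<Rightarrow> 'v rpoly set \<Rightarrow> nat" where
  "locr \<Delta> q = Max ((\<lambda>F. form_rank F (SR_eval q)) ` \<Delta>)"

text \<open>
  On \<^typ>\<open>nat\<close>, \<^const>\<open>Sup\<close> is the maximum of a nonempty finite set. The set below is finite because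
  local ranks are bounded by the number of vertices.
\<close>

definition elocr :: "'v set set \<Rightarrow> nat" where
  "elocr \<Delta> =
     (if chordal_complex \<Delta> then 0
      else Sup {locr \<Delta> q | q.
             q \<in> nonneg_forms \<Delta> - sos_forms \<Delta> \<and> spans_extreme_ray \<Delta> (nonneg_forms \<Delta>) q})"

definition E1 :: "'v set set set" where
  "E1 = {\<Delta>. simplicial_complex \<Delta> \<and> elocr \<Delta> \<le> 1}"

end

theory Submission
  imports Defs
begin

text \<open>
  A quadratic form in \<open>R\<^sub>2(\<Delta>)\<close> is a symmetric matrix of which only the entries at faces \<open>{i, j}\<close> matter.
  Writing \<open>M = Y + Z\<close> with \<open>Y\<close> and \<open>Z\<close> nonnegative on all faces forces \<open>Y\<close> to be a multiple of \<open>M\<close> when \<open>M\<close>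
  spans an extreme ray, so an extreme \<open>M\<close> has local rank one as soon as a square (or a form that is
  locally a square) can be split off. For a cone with apex \<open>v\<close> one completes the square in \<open>x\<^sub>v\<close>.
  A decomposition of the restriction of \<open>M\<close> to one summand of a 1-sum extends to the whole complex by
  multiples of \<open>M\<close> on the other summand, so the restrictions of an extreme \<open>M\<close> are zero or extreme.

  For a thickened graph one pulls \<open>M\<close> back to a chordal complex \<open>\<Delta>\<^sub>e\<close> and completes it to a positive
  semidefinite matrix \<open>Q\<close>. There is a square \<open>w w\<^sup>T\<close> below \<open>Q\<close> whose diagonal entries at \<open>H(e)\<close> and \<open>T(e)\<close> are
  \<open>c\<close> times those of \<open>Q\<close> with a common \<open>c \<in> [0, 1]\<close>. As \<open>{H(e), T(e)}\<close> is not a face, this square can be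
  glued with \<open>c M\<close> on the rest of the complex.

  The chordal completion is obtained by splitting a chordal graph along a clique separator and
  amalgamating the two completions, one vertex at a time; the row of the new vertex is extended by the
  Hahn--Banach theorem for the seminorm given by the matrix.
\<close>

section \<open>Positive semidefinite matrices\<close>

text \<open>A square that splits off M comes from a row or from a combination of rows, so it
  involves all vertices at once, whereas M is controlled only on faces; this is why every chordal
  piece is completed before anything is subtracted. A thickened graph as a whole has no such
  completion. The square then exists on one piece only, and on the remaining complex the only
  matrices known to be nonnegative together with their complement in M are the multiples c M with c
  \<in> [0, 1]. The piece meets the rest at most in the images of H(e) and T(e), and no off-diagonal
  entry is shared because {H(e), T(e)} is not a face. So the gluing imposes one condition: both
  diagonal entries are scaled by the same c. The value c = 0 does no harm as long as the square is
  nonzero on the piece.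

  The definition of \<open>elocr\<close> leaves out sums of squares and treats chordal complexes
  separately. For the bound 1 both exceptions disappear: an extreme matrix with a positive
  semidefinite completion has rank one on every face. Hence \<open>elocr\<close> at most 1 is the
  same as rank one for all extreme matrices, a condition without exceptions.\<close>

definition bform :: "'v set \<Rightarrow> ('v \<Rightarrow> 'v \<Rightarrow> real) \<Rightarrow> ('v \<Rightarrow> real) \<Rightarrow> ('v \<Rightarrow> real) \<Rightarrow> real" where
  "bform F M x y = (\<Sum>i\<in>F. \<Sum>j\<in>F. M i j * x i * y j)"

definition sym_mat :: "('v \<Rightarrow> 'v \<Rightarrow> real) \<Rightarrow> bool" where
  "sym_mat M \<longleftrightarrow> (\<forall>i j. M i j = M j i)"

text \<open>Symmetry is kept apart in \<open>sym_mat\<close>, since only the quadratic form enters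
  here.\<close>

definition psd :: "'v set \<Rightarrow> ('v \<Rightarrow> 'v \<Rightarrow> real) \<Rightarrow> bool" where
  "psd F M \<longleftrightarrow> (\<forall>x. 0 \<le> bform F M x x)"

definition unit_vec :: "'v \<Rightarrow> 'v \<Rightarrow> real" where
  "unit_vec u i = (if i = u then 1 else 0)"

lemma bform_add_left: "bform F M (\<lambda>i. x i + z i) y = bform F M x y + bform F M z y"
  by (simp add: bform_def algebra_simps sum.distrib)

lemma bform_add_right: "bform F M y (\<lambda>i. x i + z i) = bform F M y x + bform F M y z"
  by (simp add: bform_def algebra_simps sum.distrib)

lemma bform_scale_left: "bform F M (\<lambda>i. c * x i) y = c * bform F M x y"
  by (simp add: bform_def sum_distrib_left mult_ac)

lemma bform_scale_right: "bform F M y (\<lambda>i. c * x i) = c * bform F M y x"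
  by (simp add: bform_def sum_distrib_left mult_ac)

lemmas bform_lin = bform_add_left bform_add_right bform_scale_left bform_scale_right

lemma bform_commute: "sym_mat M \<Longrightarrow> bform F M x y = bform F M y x"
  unfolding bform_def sym_mat_def by (subst sum.swap) (simp add: mult_ac)

lemma bform_cong:
  "(\<And>i j. i \<in> F \<Longrightarrow> j \<in> F \<Longrightarrow> M i j = N i j) \<Longrightarrow> (\<And>i. i \<in> F \<Longrightarrow> x i = x' i) \<Longrightarrow>
    (\<And>i. i \<in> F \<Longrightarrow> y i = y' i) \<Longrightarrow> bform F M x y = bform F N x' y'"
  unfolding bform_def by (intro sum.cong refl) auto

lemma bform_mat_add: "bform F (\<lambda>i j. M i j + N i j) x y = bform F M x y + bform F N x y"
  by (simp add: bform_def algebra_simps sum.distrib)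

lemma bform_mat_scale: "bform F (\<lambda>i j. c * M i j) x y = c * bform F M x y"
  by (simp add: bform_def sum_distrib_left mult_ac)

lemma bform_outer: "bform F (\<lambda>i j. w i * w j) x x = (\<Sum>i\<in>F. w i * x i)\<^sup>2"
  by (simp add: bform_def power2_eq_square sum_product mult_ac)

lemma bform_unit_left: "finite F \<Longrightarrow> u \<in> F \<Longrightarrow> bform F M (unit_vec u) y = (\<Sum>j\<in>F. M u j * y j)"
  unfolding bform_def unit_vec_def
  by (subst sum.swap) (auto intro!: sum.cong simp: if_distrib sum.delta if_distribR cong: if_cong)

lemma bform_unit_unit: "finite F \<Longrightarrow> u \<in> F \<Longrightarrow> v \<in> F \<Longrightarrow> bform F M (unit_vec u) (unit_vec v) = M u v"
  by (simp add: bform_unit_left) (simp add: unit_vec_def if_distrib sum.delta cong: if_cong)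

lemma bform_restrict:
  assumes "finite F" "G \<subseteq> F" "\<And>i. i \<in> F - G \<Longrightarrow> x i = 0"
  shows "bform F M x x = bform G M x x"
proof -
  have "bform F M x x = (\<Sum>i\<in>G. \<Sum>j\<in>F. M i j * x i * x j)"
    unfolding bform_def using assms by (intro sum.mono_neutral_right) auto
  also have "\<dots> = bform G M x x"
    unfolding bform_def using assms by (intro sum.cong refl sum.mono_neutral_right) auto
  finally show ?thesis .
qed

lemma psd_mono:
  assumes "finite F" "psd F M" "G \<subseteq> F"
  shows "psd G M"
  unfolding psd_def
proof
  fix x :: "_ \<Rightarrow> real"
  let ?x = "\<lambda>i. if i \<in> G then x i else 0"
  have "bform G M x x = bform G M ?x ?x" by (rule bform_cong) auto
  also have "\<dots> = bform F M ?x ?x" using assms by (intro bform_restrict[symmetric]) auto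
  finally show "0 \<le> bform G M x x" using assms(2) unfolding psd_def by metis
qed

lemma psd_cong:
  "(\<And>i j. i \<in> F \<Longrightarrow> j \<in> F \<Longrightarrow> M i j = N i j) \<Longrightarrow> psd F M \<longleftrightarrow> psd F N"
  unfolding psd_def using bform_cong[of F M N] by metis

lemma psd_reindex:
  assumes "inj_on f F"
  shows "psd (f ` F) M \<longleftrightarrow> psd F (\<lambda>i j. M (f i) (f j))"
proof -
  have *: "bform (f ` F) M x x = bform F (\<lambda>i j. M (f i) (f j)) (x \<circ> f) (x \<circ> f)" for x
    unfolding bform_def by (simp add: sum.reindex[OF assms])
  have **: "bform F (\<lambda>i j. M (f i) (f j)) y y = bform (f ` F) M (y \<circ> the_inv_into F f) (y \<circ> the_inv_into F f)" for y
    unfolding * by (rule bform_cong) (auto simp: the_inv_into_f_f[OF assms])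
  show ?thesis unfolding psd_def using * ** by metis
qed

lemma psd_add: "psd F M \<Longrightarrow> psd F N \<Longrightarrow> psd F (\<lambda>i j. M i j + N i j)"
  unfolding psd_def bform_mat_add by (meson add_nonneg_nonneg)

lemma psd_scale: "0 \<le> c \<Longrightarrow> psd F M \<Longrightarrow> psd F (\<lambda>i j. c * M i j)"
  unfolding psd_def bform_mat_scale by simp

lemma psd_outer: "psd F (\<lambda>i j. w i * w j)"
  unfolding psd_def bform_outer by simp

lemma psd_diag: "finite F \<Longrightarrow> psd F M \<Longrightarrow> u \<in> F \<Longrightarrow> 0 \<le> M u u"
  unfolding psd_def using bform_unit_unit[of F u u M] by metis

lemma quadratic_discriminant:
  fixes a b c :: real
  assumes "\<And>t. 0 \<le> a + 2 * t * b + t\<^sup>2 * c"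
  shows "b\<^sup>2 \<le> a * c"
proof (cases "c = 0")
  case True
  have "b = 0"
  proof (rule ccontr)
    assume "b \<noteq> 0"
    \<comment> \<open>At this point the expression, linear in t for c = 0, takes the value
      -1.\<close>
    then show False using assms[of "- (a + 1) / (2 * b)"] True by (simp add: field_simps)
  qed
  then show ?thesis using True by simp
next
  case False
  have "c > 0"
  proof (rule ccontr)
    assume "\<not> c > 0"
    then have c: "c < 0" using False by simp
    \<comment> \<open>For c < 0 the quadratic term has to win: this t is at least 1 and makes t (-c)
      larger than |a| + 2 |b|, so the value at t is negative.\<close>
    define t where "t = (\<bar>a\<bar> + 2 * \<bar>b\<bar> + 1) / (- c) + 1"
    have t1: "t \<ge> 1" unfolding t_def using c by (simp add: divide_nonneg_neg)
    have "t * (- c) = \<bar>a\<bar> + 2 * \<bar>b\<bar> + 1 - c" unfolding t_def using c by (simp add: field_simps)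
    then have "t * (t * (- c)) \<ge> t * (\<bar>a\<bar> + 2 * \<bar>b\<bar> + 1)" using c t1 by (intro mult_left_mono) auto
    moreover have "t * (\<bar>a\<bar> + 1) \<ge> \<bar>a\<bar> + 1" using t1 mult_right_mono[of 1 t "\<bar>a\<bar> + 1"] by simp
    moreover have "t * \<bar>b\<bar> \<ge> t * b" using t1 by (intro mult_left_mono) auto
    ultimately show False using assms[of t] by (simp add: power2_eq_square algebra_simps)
  qed
  \<comment> \<open>The parabola attains its minimum at t = -b / c.\<close>
  then show ?thesis using assms[of "- b / c"] by (simp add: field_simps power2_eq_square)
qed

lemma psd_Cauchy_Schwarz:
  assumes "sym_mat M" "psd F M"
  shows "(bform F M x y)\<^sup>2 \<le> bform F M x x * bform F M y y"
proof (rule quadratic_discriminant)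
  fix t
  have "bform F M (\<lambda>i. x i + t * y i) (\<lambda>i. x i + t * y i) =
      bform F M x x + 2 * t * bform F M x y + t\<^sup>2 * bform F M y y"
    by (simp add: bform_lin bform_commute[OF assms(1), of F y x] algebra_simps power2_eq_square)
  then show "0 \<le> bform F M x x + 2 * t * bform F M x y + t\<^sup>2 * bform F M y y"
    using assms(2) unfolding psd_def by metis
qed

lemma psd_entry_bound:
  assumes "sym_mat M" "psd F M" "finite F" "u \<in> F" "v \<in> F"
  shows "(M u v)\<^sup>2 \<le> M u u * M v v"
  using psd_Cauchy_Schwarz[OF assms(1,2), of "unit_vec u" "unit_vec v"] assms(3-)
  by (simp add: bform_unit_unit)

text \<open>For \<open>bform F M f f = 0\<close>, division by zero makes this the trivial statement.\<close>

lemma psd_deflate: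
  assumes "sym_mat M" "psd F M" "finite F"
  shows "psd F (\<lambda>i j. M i j - (\<Sum>k\<in>F. M i k * f k) * (\<Sum>k\<in>F. M j k * f k) / bform F M f f)"
  unfolding psd_def
proof
  fix x
  define d where "d = bform F M f f"
  define w where "w i = (\<Sum>k\<in>F. M i k * f k)" for i
  \<comment> \<open>With w = M f the subtracted square has the value (x M f)^2 / d at x, so the
    claim is the Cauchy-Schwarz inequality for x and f.\<close>
  have w: "(\<Sum>i\<in>F. w i * x i) = bform F M x f"
    unfolding w_def bform_def by (simp add: sum_distrib_left sum_distrib_right mult_ac)
  have "bform F (\<lambda>i j. M i j - w i * w j / d) x x
      = bform F M x x + bform F (\<lambda>i j. (- 1 / d) * (w i * w j)) x x"
    unfolding bform_mat_add[symmetric] by simp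
  also have "\<dots> = bform F M x x - (bform F M x f)\<^sup>2 / d"
    unfolding bform_mat_scale bform_outer w by simp
  also have "\<dots> \<ge> 0"
  proof (cases "d > 0")
    case True
    then show ?thesis using psd_Cauchy_Schwarz[OF assms(1,2), of x f] unfolding d_def
      by (simp add: field_simps)
  next
    case False
    then have "d = 0" using assms(2) unfolding d_def psd_def by (meson antisym_conv1 linorder_not_less not_less_iff_gr_or_eq)
    then show ?thesis using assms(2) unfolding psd_def by simp
  qed
  finally show "0 \<le> bform F (\<lambda>i j. M i j - (\<Sum>k\<in>F. M i k * f k) * (\<Sum>k\<in>F. M j k * f k) / bform F M f f) x x"
    unfolding w_def d_def .
qed

text \<open>This is the Schur complement at u, the case f = e_u of
  \<open>psd_deflate\<close>.\<close>

lemma psd_deflate_unit: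
  assumes "sym_mat M" "psd F M" "finite F" "u \<in> F"
  shows "psd F (\<lambda>i j. M i j - M u i * M u j / M u u)"
proof -
  have "(\<Sum>k\<in>F. M i k * unit_vec u k) = M u i" for i
    using assms unfolding unit_vec_def sym_mat_def by (simp add: if_distrib sum.delta cong: if_cong)
  then show ?thesis
    using psd_deflate[OF assms(1-3), of "unit_vec u"] bform_unit_unit[OF assms(3,4,4), of M] by simp
qed

lemma bform_insert:
  assumes "finite F" "v \<notin> F" "sym_mat M"
  shows "bform (insert v F) M x x =
    M v v * (x v)\<^sup>2 + 2 * x v * (\<Sum>i\<in>F. M v i * x i) + bform F M x x"
proof -
  have "(\<Sum>i\<in>F. M i v * x i * x v) = x v * (\<Sum>i\<in>F. M v i * x i)"
    "(\<Sum>j\<in>F. M v j * x v * x j) = x v * (\<Sum>i\<in>F. M v i * x i)"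
    using assms(3) unfolding sym_mat_def by (simp_all add: sum_distrib_left mult_ac)
  then show ?thesis using assms(1,2)
    unfolding bform_def by (simp add: sum.distrib algebra_simps power2_eq_square)
qed

text \<open>Completing the square in the coordinate v gives the Schur complement criterion. It is
  multiplied out so that it also covers \<open>M v v = 0\<close>, where it forces the row of v to
  vanish on F. In this form it bounds a linear functional by a seminorm, which is what an extension
  theorem needs.\<close>

lemma psd_insert:
  assumes "finite F" "v \<notin> F" "sym_mat M"
  shows "psd (insert v F) M \<longleftrightarrow>
    0 \<le> M v v \<and> psd F M \<and> (\<forall>x. (\<Sum>i\<in>F. M v i * x i)\<^sup>2 \<le> M v v * bform F M x x)"
proof
  assume L: "psd (insert v F) M"
  have "(\<Sum>i\<in>F. M v i * x i)\<^sup>2 \<le> M v v * bform F M x x" for x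
  proof -
    let ?x = "\<lambda>i. if i = v then 0 else x i"
    have 1: "bform (insert v F) M ?x ?x = bform F M ?x ?x"
      using assms by (intro bform_restrict) auto
    have 2: "bform F M ?x ?x = bform F M x x" using assms(2) by (intro bform_cong) auto
    have 3: "bform (insert v F) M (unit_vec v) ?x = (\<Sum>i\<in>F. M v i * x i)"
      using assms(1,2) by (simp add: bform_unit_left) (intro sum.cong, auto)
    show ?thesis
      using psd_Cauchy_Schwarz[OF assms(3) L, of "unit_vec v" ?x] 1 2 3 assms(1)
      by (simp add: bform_unit_unit)
  qed
  then show "0 \<le> M v v \<and> psd F M \<and> (\<forall>x. (\<Sum>i\<in>F. M v i * x i)\<^sup>2 \<le> M v v * bform F M x x)"
    using psd_diag[of "insert v F" M v] psd_mono[of "insert v F" M F] L assms(1) by auto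
next
  assume R: "0 \<le> M v v \<and> psd F M \<and> (\<forall>x. (\<Sum>i\<in>F. M v i * x i)\<^sup>2 \<le> M v v * bform F M x x)"
  show "psd (insert v F) M"
    unfolding psd_def
  proof
    fix x
    define s where "s = (\<Sum>i\<in>F. M v i * x i)"
    have s: "s\<^sup>2 \<le> M v v * bform F M x x" using R s_def by auto
    show "0 \<le> bform (insert v F) M x x"
    proof (cases "M v v = 0")
      case True
      then have "s = 0" using s by simp
      then show ?thesis using True R unfolding bform_insert[OF assms] s_def[symmetric] psd_def by simp
    next
      case False
      then have c: "M v v > 0" using R by auto
      have "0 \<le> (M v v * x v + s)\<^sup>2 + (M v v * bform F M x x - s\<^sup>2)" using s by simp
      also have "\<dots> = M v v * bform (insert v F) M x x"
        unfolding bform_insert[OF assms] s_def[symmetric] by (simp add: algebra_simps power2_eq_square)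
      finally show ?thesis using c by (simp add: zero_le_mult_iff)
    qed
  qed
qed

text \<open>Each vertex costs one square: after deflation at v the row of v is zero, and the
  remaining block is handled by induction. The number of squares later bounds the rank of a form on
  a face.\<close>

lemma psd_sum_of_outer:
  assumes "finite F" "sym_mat M" "psd F M"
  shows "\<exists>w :: nat \<Rightarrow> 'v \<Rightarrow> real. \<forall>i\<in>F. \<forall>j\<in>F. M i j = (\<Sum>k<card F. w k i * w k j)"
  using assms
proof (induction F arbitrary: M rule: finite_induct)
  case empty
  then show ?case by simp
next
  case (insert v F)
  define N where "N i j = M i j - M v i * M v j / M v v" for i j
  have symN: "sym_mat N" using insert.prems unfolding N_def sym_mat_def by (simp add: mult_ac)
  have psdN: "psd (insert v F) N" unfolding N_def using insert by (intro psd_deflate_unit) auto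
  \<comment> \<open>If \<open>M v v = 0\<close>, the quotient in N is zero by convention, and the
    row of v vanishes already in M because of the 2 by 2 minors.\<close>
  have Nv: "N v j = 0" if "j \<in> insert v F" for j
  proof (cases "M v v = 0")
    case True
    then have "M v j = 0"
      using psd_entry_bound[OF insert.prems, of v j] insert.hyps that by simp
    then show ?thesis unfolding N_def by simp
  next
    case False
    then show ?thesis unfolding N_def by simp
  qed
  obtain w where w: "\<forall>i\<in>F. \<forall>j\<in>F. N i j = (\<Sum>k<card F. w k i * w k j)"
    using insert.IH[OF symN] psd_mono[OF _ psdN, of F] insert.hyps by auto
  \<comment> \<open>The new vector has index \<open>card F\<close> and is the normalized row of v;
    division by zero makes it zero when \<open>M v v = 0\<close>.\<close>
  define w' where "w' k i = (if k < card F then (if i = v then 0 else w k i) else M v i / sqrt (M v v))" for k i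
  have v0: "M v v \<ge> 0" using psd_diag[of "insert v F" M v] insert by auto
  have "M i j = (\<Sum>k<card (insert v F). w' k i * w' k j)" if ij: "i \<in> insert v F" "j \<in> insert v F" for i j
  proof -
    have "(\<Sum>k<card F. w' k i * w' k j) = N i j"
    proof (cases "i = v \<or> j = v")
      case True
      then have "N i j = 0" using Nv ij symN unfolding sym_mat_def by metis
      then show ?thesis using True unfolding w'_def by auto
    next
      case False
      then show ?thesis using w ij unfolding w'_def by auto
    qed
    moreover have "w' (card F) i * w' (card F) j = M v i * M v j / M v v"
      unfolding w'_def using v0 by simp
    ultimately show ?thesis using insert.hyps unfolding N_def by simp
  qed
  then show ?case by blast
qed

section \<open>Extension and amalgamation of positive semidefinite matrices\<close>

lemma psd_triangle:
  assumes "sym_mat M" "psd F M"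
  shows "sqrt (bform F M (\<lambda>i. x i + y i) (\<lambda>i. x i + y i))
    \<le> sqrt (bform F M x x) + sqrt (bform F M y y)"
proof (rule real_le_lsqrt)
  have nn: "0 \<le> bform F M z z" for z using assms(2) psd_def by auto
  show "0 \<le> sqrt (bform F M x x) + sqrt (bform F M y y)" using nn by simp
  have "\<bar>bform F M x y\<bar> \<le> sqrt (bform F M x x * bform F M y y)"
    by (rule real_le_rsqrt) (simp add: psd_Cauchy_Schwarz[OF assms])
  then show "bform F M (\<lambda>i. x i + y i) (\<lambda>i. x i + y i)
      \<le> (sqrt (bform F M x x) + sqrt (bform F M y y))\<^sup>2"
    using nn[of x] nn[of y] bform_commute[OF assms(1), of F y x]
    by (simp add: bform_lin power2_sum real_sqrt_mult)
qed

text \<open>The extension step of the Hahn--Banach theorem for the seminorm of \<open>G\<close>.\<close>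

lemma functional_extension_step:
  assumes "finite A" "u \<notin> A" "sym_mat G" "psd (insert u A) G"
    and le: "\<And>x. (\<Sum>i\<in>A. \<beta> i * x i)\<^sup>2 \<le> bform A G x x"
  shows "\<exists>\<tau>. \<forall>x. ((\<Sum>i\<in>A. \<beta> i * x i) + \<tau> * x u)\<^sup>2 \<le> bform (insert u A) G x x"
proof -
  define p where "p x = sqrt (bform (insert u A) G x x)" for x
  define b where "b x = (\<Sum>i\<in>A. \<beta> i * x i)" for x
  \<comment> \<open>Both sides of the bound are homogeneous, so vectors with coordinate 0 or 1 at u
    suffice.\<close>
  define lift where "lift y = (\<lambda>i. if i = u then 1 else y i :: real)" for y
  have nn: "0 \<le> bform (insert u A) G x x" for x using assms(4) psd_def by auto
  have p0: "\<bar>b x\<bar> \<le> p x" if "x u = 0" for x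
  proof -
    have "bform (insert u A) G x x = bform A G x x"
      using bform_insert[OF assms(1-3), of x] that by simp
    then show ?thesis using le[of x] unfolding p_def b_def by (intro real_le_rsqrt) simp
  qed
  have blift: "b (lift y) = b y" for y
    unfolding b_def lift_def using assms(2) by (intro sum.cong) auto
  \<comment> \<open>The difference of two lifts has coordinate 0 at u. The bound already known for A
    applies to it, and the triangle inequality separates the two lifts.\<close>
  have key: "- p (lift y) - b y \<le> p (lift z) - b z" for y z
  proof -
    define d where "d = (\<lambda>i. lift z i + (- 1) * lift y i)"
    have "b d = b z - b y"
      using blift unfolding d_def b_def by (simp add: algebra_simps sum_subtractf)
    moreover have "b d \<le> p d" using p0[of d] unfolding d_def lift_def by simp
    moreover have "p d \<le> p (lift z) + p (\<lambda>i. (- 1) * lift y i)"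
      unfolding p_def d_def by (rule psd_triangle[OF assms(3,4)])
    moreover have "p (\<lambda>i. (- 1) * lift y i) = p (lift y)"
      unfolding p_def bform_scale_left bform_scale_right by simp
    ultimately show ?thesis by simp
  qed
  \<comment> \<open>By \<open>key\<close> every lower bound for the new coefficient lies below every
    upper bound, so the supremum of the lower bounds meets both constraints.\<close>
  define \<tau> where "\<tau> = (SUP y. - p (lift y) - b y)"
  have lo: "- p (lift y) - b y \<le> \<tau>" for y
    unfolding \<tau>_def using key by (intro cSUP_upper bdd_aboveI2) auto
  have hi: "\<tau> \<le> p (lift z) - b z" for z
    unfolding \<tau>_def using key by (intro cSUP_least) auto
  have "(b x + \<tau> * x u)\<^sup>2 \<le> bform (insert u A) G x x" for x
  proof (cases "x u = 0")
    case True
    then have "\<bar>b x\<bar> \<le> p x" by (rule p0)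
    then have "(b x)\<^sup>2 \<le> (p x)\<^sup>2" by (metis abs_ge_zero power2_abs power_mono)
    then show ?thesis using True nn unfolding p_def by simp
  next
    case False
    define y where "y i = x i / x u" for i
    have bx: "b x = x u * b y" unfolding b_def y_def using False by (simp add: sum_distrib_left)
    have x: "x i = x u * lift y i" for i unfolding lift_def y_def using False by auto
    have "bform (insert u A) G x x = bform (insert u A) G (\<lambda>i. x u * lift y i) (\<lambda>i. x u * lift y i)"
      by (intro bform_cong refl x)
    also have "\<dots> = (x u)\<^sup>2 * (p (lift y))\<^sup>2"
      unfolding bform_scale_left bform_scale_right p_def using nn by (simp add: power2_eq_square)
    also have "\<dots> \<ge> (x u)\<^sup>2 * (b y + \<tau>)\<^sup>2"
    proof (intro mult_left_mono)
      have "\<bar>b y + \<tau>\<bar> \<le> p (lift y)" using lo[of y] hi[of y] by simp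
      then show "(b y + \<tau>)\<^sup>2 \<le> (p (lift y))\<^sup>2" by (metis abs_ge_zero power2_abs power_mono)
    qed simp
    finally show ?thesis unfolding bx by (simp add: algebra_simps power2_eq_square)
  qed
  then show ?thesis unfolding b_def by blast
qed

lemma functional_extension:
  assumes "finite C" "A \<inter> C = {}" "finite A" "sym_mat G" "psd (A \<union> C) G"
    and le: "\<And>x. (\<Sum>i\<in>A. \<beta> i * x i)\<^sup>2 \<le> bform A G x x"
  shows "\<exists>\<beta>'. (\<forall>i\<in>A. \<beta>' i = \<beta> i) \<and> (\<forall>x. (\<Sum>i\<in>A \<union> C. \<beta>' i * x i)\<^sup>2 \<le> bform (A \<union> C) G x x)"
  using assms(1,2,5)
proof (induction C rule: finite_induct)
  case empty
  then show ?case using le by (intro exI[of _ \<beta>]) auto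
next
  case (insert u C)
  have "psd (A \<union> C) G" by (rule psd_mono[OF _ insert.prems(2)]) (use insert.hyps assms(3) in auto)
  moreover have "A \<inter> C = {}" using insert.prems(1) by blast
  ultimately obtain \<beta>' where b: "\<forall>i\<in>A. \<beta>' i = \<beta> i"
    "\<And>x. (\<Sum>i\<in>A \<union> C. \<beta>' i * x i)\<^sup>2 \<le> bform (A \<union> C) G x x"
    using insert.IH by blast
  have u: "u \<notin> A \<union> C" using insert.hyps insert.prems(1) by blast
  obtain \<tau> where t: "\<And>x. ((\<Sum>i\<in>A \<union> C. \<beta>' i * x i) + \<tau> * x u)\<^sup>2 \<le> bform (insert u (A \<union> C)) G x x"
    using functional_extension_step[OF _ u assms(4) _ b(2)] insert.hyps(1) insert.prems(2) assms(3)
    by (metis Un_insert_right finite_UnI)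
  define \<beta>'' where "\<beta>'' = \<beta>'(u := \<tau>)"
  have "(\<Sum>i\<in>insert u (A \<union> C). \<beta>'' i * x i) = (\<Sum>i\<in>A \<union> C. \<beta>' i * x i) + \<tau> * x u" for x
  proof -
    have "(\<Sum>i\<in>A \<union> C. \<beta>'' i * x i) = (\<Sum>i\<in>A \<union> C. \<beta>' i * x i)"
      using u unfolding \<beta>''_def by (intro sum.cong) auto
    then show ?thesis using u insert.hyps assms(3) unfolding \<beta>''_def by simp
  qed
  then have "\<forall>x. (\<Sum>i\<in>A \<union> insert u C. \<beta>'' i * x i)\<^sup>2 \<le> bform (A \<union> insert u C) G x x"
    using t by simp
  moreover have "\<forall>i\<in>A. \<beta>'' i = \<beta> i" using b(1) u unfolding \<beta>''_def by auto
  ultimately show ?case by blast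
qed

lemma psd_extend_vertex:
  assumes "finite B" "v \<notin> B" "A \<subseteq> B" "sym_mat R" "psd B R" "sym_mat P" "psd (insert v A) P"
    and agr: "\<And>i j. i \<in> A \<Longrightarrow> j \<in> A \<Longrightarrow> P i j = R i j"
  shows "\<exists>Q. sym_mat Q \<and> psd (insert v B) Q \<and> (\<forall>i\<in>B. \<forall>j\<in>B. Q i j = R i j) \<and>
    (\<forall>i\<in>insert v A. \<forall>j\<in>insert v A. Q i j = P i j)"
proof -
  have finA: "finite A" and vA: "v \<notin> A" using assms finite_subset by auto
  note ins = psd_insert[OF finA vA assms(6)]
  define c where "c = P v v"
  have c: "0 \<le> c" using ins assms(7) c_def by simp
  \<comment> \<open>Scaling R by the diagonal entry of the new vertex absorbs the factor in
    \<open>psd_insert\<close>; the row of v becomes a functional bounded by the seminorm of G, also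
    for c = 0.\<close>
  define G where "G i j = c * R i j" for i j
  have BG: "bform S G x x = c * bform S R x x" for S x unfolding G_def by (rule bform_mat_scale)
  have "(\<Sum>i\<in>A. P v i * x i)\<^sup>2 \<le> bform A G x x" for x
  proof -
    have "bform A P x x = bform A R x x" using agr by (intro bform_cong) auto
    then show ?thesis using ins assms(7) BG[of A x] unfolding c_def by metis
  qed
  moreover have "psd (A \<union> (B - A)) G"
    using assms(3,5) psd_scale[OF c assms(5)] unfolding G_def by (simp add: Un_absorb1)
  moreover have "sym_mat G" using assms(4) unfolding sym_mat_def G_def by simp
  ultimately obtain \<beta> where \<beta>: "\<forall>i\<in>A. \<beta> i = P v i"
    "\<And>x. (\<Sum>i\<in>A \<union> (B - A). \<beta> i * x i)\<^sup>2 \<le> bform (A \<union> (B - A)) G x x"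
    using functional_extension[of "B - A" A G "P v"] assms(1) finA by auto
  have AB: "A \<union> (B - A) = B" using assms(3) by auto
  define Q where "Q i j = (if i = v then if j = v then c else \<beta> j else if j = v then \<beta> i else R i j)" for i j
  have symQ: "sym_mat Q" using assms(4) unfolding sym_mat_def Q_def by simp
  have QR: "Q i j = R i j" if "i \<in> B" "j \<in> B" for i j using that assms(2) unfolding Q_def by auto
  have "psd (insert v B) Q"
    unfolding psd_insert[OF assms(1,2) symQ]
  proof (intro conjI allI)
    show "0 \<le> Q v v" using c unfolding Q_def by simp
    show "psd B Q" using assms(5) psd_cong[of B Q R] QR by simp
    fix x
    have "(\<Sum>i\<in>B. Q v i * x i) = (\<Sum>i\<in>B. \<beta> i * x i)"
      using assms(2) unfolding Q_def by (intro sum.cong) auto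
    moreover have "bform B Q x x = bform B R x x" using QR by (intro bform_cong) auto
    moreover have "Q v v = c" unfolding Q_def by simp
    ultimately show "(\<Sum>i\<in>B. Q v i * x i)\<^sup>2 \<le> Q v v * bform B Q x x"
      using \<beta>(2)[of x] unfolding AB BG by simp
  qed
  moreover have "Q i j = P i j" if "i \<in> insert v A" "j \<in> insert v A" for i j
    using that \<beta>(1) agr assms(3,6) vA unfolding Q_def c_def sym_mat_def by auto
  ultimately show ?thesis using symQ QR by blast
qed

lemma psd_amalgamate:
  assumes "finite A" "finite B" "sym_mat P" "sym_mat R" "psd A P" "psd B R"
    and agr: "\<And>i j. i \<in> A \<inter> B \<Longrightarrow> j \<in> A \<inter> B \<Longrightarrow> P i j = R i j"
  shows "\<exists>Q. sym_mat Q \<and> psd (A \<union> B) Q \<and> (\<forall>i\<in>A. \<forall>j\<in>A. Q i j = P i j) \<and>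
    (\<forall>i\<in>B. \<forall>j\<in>B. Q i j = R i j)"
proof -
  \<comment> \<open>C holds the vertices of A - B attached so far. The row of the next vertex is
    prescribed by P on \<open>C \<union> (A \<inter> B)\<close>, and the extension only has to
    invent its entries towards B - A.\<close>
  have "finite C \<Longrightarrow> C \<inter> B = {} \<Longrightarrow> C \<subseteq> A \<Longrightarrow>
    \<exists>Q. sym_mat Q \<and> psd (C \<union> B) Q \<and>
      (\<forall>i\<in>C \<union> (A \<inter> B). \<forall>j\<in>C \<union> (A \<inter> B). Q i j = P i j) \<and> (\<forall>i\<in>B. \<forall>j\<in>B. Q i j = R i j)" for C
  proof (induction C rule: finite_induct)
    case empty
    then show ?case using assms(4,6) agr by (intro exI[of _ R]) auto
  next
    case (insert v C)
    then obtain Q where Q: "sym_mat Q" "psd (C \<union> B) Q"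
      "\<forall>i\<in>C \<union> (A \<inter> B). \<forall>j\<in>C \<union> (A \<inter> B). Q i j = P i j" "\<forall>i\<in>B. \<forall>j\<in>B. Q i j = R i j" by auto
    have "psd (insert v (C \<union> (A \<inter> B))) P"
      using insert.prems assms by (intro psd_mono[OF assms(1) assms(5)]) auto
    then have "\<exists>Q'. sym_mat Q' \<and> psd (insert v (C \<union> B)) Q' \<and>
      (\<forall>i\<in>C \<union> B. \<forall>j\<in>C \<union> B. Q' i j = Q i j) \<and>
      (\<forall>i\<in>insert v (C \<union> (A \<inter> B)). \<forall>j\<in>insert v (C \<union> (A \<inter> B)). Q' i j = P i j)"
      using insert Q assms by (intro psd_extend_vertex) auto
    then obtain Q' where Q': "sym_mat Q'" "psd (insert v (C \<union> B)) Q'"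
      "\<forall>i\<in>C \<union> B. \<forall>j\<in>C \<union> B. Q' i j = Q i j"
      "\<forall>i\<in>insert v (C \<union> (A \<inter> B)). \<forall>j\<in>insert v (C \<union> (A \<inter> B)). Q' i j = P i j" by auto
    show ?case using Q' Q(4) by (intro exI[of _ Q']) auto
  qed
  from this[of "A - B"] assms(1) have "\<exists>Q. sym_mat Q \<and> psd (A - B \<union> B) Q \<and>
      (\<forall>i\<in>A - B \<union> (A \<inter> B). \<forall>j\<in>A - B \<union> (A \<inter> B). Q i j = P i j) \<and> (\<forall>i\<in>B. \<forall>j\<in>B. Q i j = R i j)"
    by blast
  then obtain Q where Q: "sym_mat Q" "psd (A - B \<union> B) Q"
      "\<forall>i\<in>A - B \<union> (A \<inter> B). \<forall>j\<in>A - B \<union> (A \<inter> B). Q i j = P i j" "\<forall>i\<in>B. \<forall>j\<in>B. Q i j = R i j"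
    by blast
  moreover have "A - B \<union> (A \<inter> B) = A" "A - B \<union> B = A \<union> B" by auto
  ultimately show ?thesis by metis
qed

section \<open>Completion over chordal graphs\<close>

text \<open>A relation with an explicit vertex set makes an induced subgraph a mere change of V, as
  the induction on separators requires.\<close>

definition chordal_on :: "'v set \<Rightarrow> ('v \<Rightarrow> 'v \<Rightarrow> bool) \<Rightarrow> bool" where
  "chordal_on V E \<longleftrightarrow>
     \<not> (\<exists>xs. length xs \<ge> 4 \<and> distinct xs \<and> set xs \<subseteq> V \<and>
         (\<forall>i<length xs. \<forall>j<length xs.
            E (xs ! i) (xs ! j) \<longleftrightarrow> j = Suc i mod length xs \<or> i = Suc j mod length xs))"

lemma chordal_on_subset: "chordal_on V E \<Longrightarrow> U \<subseteq> V \<Longrightarrow> chordal_on U E"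
  unfolding chordal_on_def by (meson subset_trans)

text \<open>A chord, or a repetition of a vertex, permits cutting out the segment in between.
  Competing walks are confined to the vertices of \<open>ws\<close>, so minimality among walks
  inside a given set is enough.\<close>

lemma shortest_walk_chordless:
  assumes "ws \<noteq> []" "successively E ws"
    and short: "\<And>vs. vs \<noteq> [] \<Longrightarrow> successively E vs \<Longrightarrow> hd vs = hd ws \<Longrightarrow> last vs = last ws \<Longrightarrow>
      set vs \<subseteq> set ws \<Longrightarrow> length ws \<le> length vs"
  shows "distinct ws" "\<And>i j. i < j \<Longrightarrow> j < length ws \<Longrightarrow> E (ws ! i) (ws ! j) \<Longrightarrow> j = Suc i"
proof -
  have succ: "successively E (take i ws)" "successively E (drop i ws)" for i
    using assms(2) successively_append_iff[of E "take i ws" "drop i ws"] by auto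
  have nth: "E (ws ! i) (ws ! Suc i)" if "Suc i < length ws" for i
    using assms(2) that by (simp add: successively_nth)
  show "j = Suc i" if ij: "i < j" "j < length ws" "E (ws ! i) (ws ! j)" for i j
  proof (rule ccontr)
    assume "j \<noteq> Suc i"
    let ?vs = "take (Suc i) ws @ drop j ws"
    have l: "last (take (Suc i) ws) = ws ! i" "hd (drop j ws) = ws ! j"
      using ij by (simp_all add: take_Suc_conv_app_nth hd_drop_conv_nth)
    have "successively E ?vs"
      unfolding successively_append_iff using succ l ij(3) by simp
    moreover have "hd ?vs = hd ws" "last ?vs = last ws" using ij assms(1) by auto
    moreover have "set ?vs \<subseteq> set ws" using set_take_subset set_drop_subset by fastforce
    moreover have "?vs \<noteq> []" using ij by simp
    ultimately have "length ws \<le> length ?vs" using short by blast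
    then show False using ij \<open>j \<noteq> Suc i\<close> by simp
  qed
  show "distinct ws"
  proof (rule ccontr)
    assume "\<not> distinct ws"
    then obtain i j where ij: "i < j" "j < length ws" "ws ! i = ws ! j"
      unfolding distinct_conv_nth by (metis linorder_neqE_nat)
    let ?vs = "take i ws @ drop j ws"
    \<comment> \<open>For i = 0 nothing is kept in front, and the head survives because
      \<open>ws ! j\<close> equals \<open>ws ! 0\<close>.\<close>
    have "successively E ?vs \<and> hd ?vs = hd ws"
    proof (cases i)
      case 0
      then show ?thesis using ij succ assms(1) by (simp add: hd_drop_conv_nth hd_conv_nth)
    next
      case (Suc k)
      have "last (take i ws) = ws ! k" "hd (drop j ws) = ws ! i"
        using ij Suc by (simp_all add: take_Suc_conv_app_nth hd_drop_conv_nth)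
      then show ?thesis
        unfolding successively_append_iff using succ nth[of k] ij Suc assms(1) by auto
    qed
    moreover have "last ?vs = last ws" using ij assms(1) by auto
    moreover have "set ?vs \<subseteq> set ws" using set_take_subset set_drop_subset by fastforce
    moreover have "?vs \<noteq> []" using ij by simp
    ultimately have "length ws \<le> length ?vs" using short by blast
    then show False using ij by simp
  qed
qed

text \<open>A shortest walk from s to s' through C is an induced path. As x sees its two ends and
  nothing of C, x closes it to an induced cycle, and the cycle has length at least 4 because s and
  s' are distinct and not adjacent.\<close>

lemma chordal_on_no_detour:
  assumes ch: "chordal_on V E" and symE: "\<And>u v. E u v \<Longrightarrow> E v u" and irr: "\<And>u. \<not> E u u"
    and x: "x \<in> V" "E x s" "E x s'" "s \<in> V" "s' \<in> V" "s \<noteq> s'" "\<not> E s s'"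
    and C: "C \<subseteq> V" "x \<notin> C" "\<And>c. c \<in> C \<Longrightarrow> \<not> E x c"
    and ws: "ws \<noteq> []" "successively E ws" "hd ws = s" "last ws = s'" "set ws \<subseteq> C \<union> {s, s'}"
  shows False
proof -
  define Pr where "Pr vs \<longleftrightarrow> vs \<noteq> [] \<and> successively E vs \<and> hd vs = s \<and> last vs = s' \<and> set vs \<subseteq> C \<union> {s, s'}" for vs
  have "Pr ws" unfolding Pr_def using ws by auto
  then obtain vs where vs: "Pr vs" "\<And>us. Pr us \<Longrightarrow> length vs \<le> length us"
    using ex_has_least_nat[of Pr ws length] by auto
  have vs': "vs \<noteq> []" "successively E vs" "hd vs = s" "last vs = s'" "set vs \<subseteq> C \<union> {s, s'}"
    using vs(1) unfolding Pr_def by auto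
  have "length vs \<le> length us"
    if "us \<noteq> []" "successively E us" "hd us = hd vs" "last us = last vs" "set us \<subseteq> set vs" for us
    using vs(2)[of us] that vs' unfolding Pr_def by auto
  from shortest_walk_chordless[OF vs'(1,2) this]
  have dist: "distinct vs" and cl: "\<And>i j. i < j \<Longrightarrow> j < length vs \<Longrightarrow> E (vs ! i) (vs ! j) \<Longrightarrow> j = Suc i"
    by blast+
  define n where "n = length vs"
  have ends: "vs ! 0 = s" "vs ! (n - 1) = s'"
    using vs' unfolding n_def by (auto simp: hd_conv_nth last_conv_nth)
  have nth: "E (vs ! i) (vs ! Suc i)" if "Suc i < n" for i
    using vs'(2) that unfolding n_def by (simp add: successively_nth)
  have n3: "n \<ge> 3"
  proof (rule ccontr)
    assume "\<not> n \<ge> 3"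
    then consider "n = 1" | "n = 2" using vs'(1) n_def by (cases n) force+
    then show False
    proof cases
      case 1 then show False using ends x by simp
    next
      case 2 then show False using ends nth[of 0] x by simp
    qed
  qed
  have inner: "vs ! k \<in> C" if "0 < k" "k < n - 1" for k
  proof -
    have "vs ! k \<noteq> vs ! 0" "vs ! k \<noteq> vs ! (n - 1)"
      using that vs'(1) nth_eq_iff_index_eq[OF dist, of k 0] nth_eq_iff_index_eq[OF dist, of k "n - 1"]
      unfolding n_def by auto
    moreover have "vs ! k \<in> set vs" using that unfolding n_def by simp
    ultimately show ?thesis using ends vs'(5) by auto
  qed
  have Ex: "E x (vs ! k) \<longleftrightarrow> k = 0 \<or> k = n - 1" if "k < n" for k
  proof (cases "k = 0 \<or> k = n - 1")
    case True
    then show ?thesis using ends x by auto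
  next
    case False
    then show ?thesis using inner[of k] C(3) that by auto
  qed
  have Ev: "E (vs ! i) (vs ! j) \<longleftrightarrow> j = Suc i \<or> i = Suc j" if "i < n" "j < n" for i j
    using cl[of i j] cl[of j i] nth[of i] nth[of j] symE irr that unfolding n_def
    by (metis linorder_neqE_nat)
  \<comment> \<open>The cycle has n + 1 vertices: x at index 0 and \<open>vs ! k\<close> at index k
    + 1, so the successor wraps around exactly at index n.\<close>
  have Sm: "Suc i mod Suc n = (if i = n then 0 else Suc i)" if "i < Suc n" for i
    using that by auto
  let ?xs = "x # vs"
  have "x \<notin> set vs" using vs'(5) C(2) x irr by auto
  then have "distinct ?xs" using dist by simp
  moreover have "set ?xs \<subseteq> V" using vs'(5) x C by auto
  moreover have "length ?xs \<ge> 4" using n3 n_def by simp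
  moreover have "E (?xs ! i) (?xs ! j) \<longleftrightarrow> j = Suc i mod length ?xs \<or> i = Suc j mod length ?xs"
    if "i < length ?xs" "j < length ?xs" for i j
  proof -
    have len: "length ?xs = Suc n" using n_def by simp
    have ij: "i < Suc n" "j < Suc n" using that n_def by auto
    show ?thesis unfolding len Sm[OF ij(1)] Sm[OF ij(2)]
    proof (cases i; cases j)
      assume "i = 0" "j = 0"
      then show "E (?xs ! i) (?xs ! j) \<longleftrightarrow> j = (if i = n then 0 else Suc i) \<or> i = (if j = n then 0 else Suc j)"
        using irr n3 by auto
    next
      fix k assume "i = 0" "j = Suc k"
      then show "E (?xs ! i) (?xs ! j) \<longleftrightarrow> j = (if i = n then 0 else Suc i) \<or> i = (if j = n then 0 else Suc j)"
        using Ex[of k] ij n3 by auto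
    next
      fix k assume "i = Suc k" "j = 0"
      then show "E (?xs ! i) (?xs ! j) \<longleftrightarrow> j = (if i = n then 0 else Suc i) \<or> i = (if j = n then 0 else Suc j)"
        using Ex[of k] symE[of x "vs ! k"] symE[of "vs ! k" x] ij n3 by auto
    next
      fix k l assume "i = Suc k" "j = Suc l"
      then show "E (?xs ! i) (?xs ! j) \<longleftrightarrow> j = (if i = n then 0 else Suc i) \<or> i = (if j = n then 0 else Suc j)"
        using Ev[of k l] ij by auto
    qed
  qed
  ultimately show False using ch unfolding chordal_on_def by blast
qed

lemma walk_within:
  assumes "(c, d) \<in> r\<^sup>*" "c \<in> C" "\<And>a b. a \<in> C \<Longrightarrow> (a, b) \<in> r \<Longrightarrow> b \<in> C \<and> E a b"
  shows "\<exists>ws. ws \<noteq> [] \<and> successively E ws \<and> hd ws = c \<and> last ws = d \<and> set ws \<subseteq> C"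
  using assms(1)
proof (induction rule: rtrancl_induct)
  case base
  then show ?case using assms(2) by (intro exI[of _ "[c]"]) auto
next
  case (step b d)
  then obtain ws where ws: "ws \<noteq> []" "successively E ws" "hd ws = c" "last ws = b" "set ws \<subseteq> C" by auto
  then have "b \<in> C" using last_in_set by blast
  then show ?case using ws assms(3)[of b d] step.hyps(2)
    by (intro exI[of _ "ws @ [d]"]) (auto simp: successively_append_iff)
qed

text \<open>Over a complete graph M is its own completion. Otherwise take nonadjacent x and y, the
  component C of y among the vertices other than x that are not adjacent to x, and the boundary S of
  C. All of S is adjacent to x, so a missing edge in S would produce a long induced cycle through x
  and C (Dirac's argument). Hence S is a clique, and the completions on \<open>C \<union> S\<close>
  and V - C both equal M on it.\<close>

theorem chordal_psd_completion:
  assumes "finite V" "chordal_on V E" and symE: "\<And>u v. E u v \<Longrightarrow> E v u" and irr: "\<And>u. \<not> E u u"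
    and "sym_mat M"
    and "\<And>K. K \<subseteq> V \<Longrightarrow> (\<And>u v. u \<in> K \<Longrightarrow> v \<in> K \<Longrightarrow> u \<noteq> v \<Longrightarrow> E u v) \<Longrightarrow> psd K M"
  shows "\<exists>Q. sym_mat Q \<and> psd V Q \<and> (\<forall>i\<in>V. \<forall>j\<in>V. i = j \<or> E i j \<longrightarrow> Q i j = M i j)"
  using assms(1,2,6)
proof (induction V rule: finite_psubset_induct)
  case (psubset V)
  show ?case
  proof (cases "\<forall>u\<in>V. \<forall>v\<in>V. u \<noteq> v \<longrightarrow> E u v")
    case True
    then have "psd V M" by (intro psubset.prems(2)) auto
    then show ?thesis using assms(5) by blast
  next
    case False
    then obtain x y where xy: "x \<in> V" "y \<in> V" "x \<noteq> y" "\<not> E x y" by auto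
    define W where "W = {z \<in> V. z \<noteq> x \<and> \<not> E x z}"
    define r where "r = {(a, b). a \<in> W \<and> b \<in> W \<and> E a b}"
    define C where "C = {z. (y, z) \<in> r\<^sup>*}"
    define S where "S = {s \<in> V - C. \<exists>c\<in>C. E c s}"
    have yC: "y \<in> C" unfolding C_def by simp
    have CW: "C \<subseteq> W"
    proof
      fix z assume "z \<in> C"
      then have "(y, z) \<in> r\<^sup>*" unfolding C_def by simp
      then show "z \<in> W" by (cases rule: rtranclE) (use xy in \<open>auto simp: W_def r_def\<close>)
    qed
    have Cstep: "b \<in> C" if "a \<in> C" "b \<in> W" "E a b" for a b
      using that CW unfolding C_def r_def by (auto intro: rtrancl_into_rtrancl)
    have "sym r" unfolding r_def sym_def using symE by auto
    then have "sym (r\<^sup>*)" by (rule sym_rtrancl)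
    then have conn: "(c, d) \<in> r\<^sup>*" if "c \<in> C" "d \<in> C" for c d
      using that unfolding C_def by (auto dest: symD intro: rtrancl_trans)
    have SN: "E x s" if "s \<in> S" for s
    proof (rule ccontr)
      assume nE: "\<not> E x s"
      from that obtain c where c: "c \<in> C" "E c s" "s \<in> V" "s \<notin> C" unfolding S_def by auto
      have "s \<noteq> x" using c symE[OF c(2)] CW unfolding W_def by auto
      then show False using Cstep[OF c(1) _ c(2)] c nE unfolding W_def by auto
    qed
    have Scl: "E s s'" if ss: "s \<in> S" "s' \<in> S" "s \<noteq> s'" for s s'
    proof (rule ccontr)
      assume nE: "\<not> E s s'"
      from ss obtain c c' where c: "c \<in> C" "E c s" "c' \<in> C" "E c' s'" and sV: "s \<in> V" "s' \<in> V" unfolding S_def by auto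
      obtain ws where ws: "ws \<noteq> []" "successively E ws" "hd ws = c" "last ws = c'" "set ws \<subseteq> C"
        using walk_within[OF conn[OF c(1,3)] c(1), of E] Cstep unfolding r_def by auto
      have 1: "s # ws @ [s'] \<noteq> []" "hd (s # ws @ [s']) = s" "last (s # ws @ [s']) = s'"
        "set (s # ws @ [s']) \<subseteq> C \<union> {s, s'}"
        using ws(5) by auto
      have 2: "successively E (s # ws @ [s'])"
        using ws symE[OF c(2)] c(4) by (auto simp: successively_append_iff successively_Cons)
      have "C \<subseteq> V" "x \<notin> C" "\<And>c. c \<in> C \<Longrightarrow> \<not> E x c" using CW unfolding W_def by auto
      from chordal_on_no_detour[OF psubset.prems(1) symE irr xy(1) SN[OF ss(1)] SN[OF ss(2)] sV ss(3) nE this 1(1) 2 1(2-4)]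
      show False .
    qed
    define A where "A = C \<union> S"
    define B where "B = V - C"
    have CV: "C \<subseteq> V" using CW unfolding W_def by auto
    have SV: "S \<subseteq> V" unfolding S_def by auto
    have "x \<notin> C" using CW unfolding W_def by auto
    moreover have "x \<notin> S" using SN irr by auto
    \<comment> \<open>The part A misses x and B misses y, so both are smaller than V.\<close>
    ultimately have A: "A \<subset> V" using CV SV xy(1) unfolding A_def by auto
    have B: "B \<subset> V" using yC CV xy(2) unfolding B_def by auto
    have "\<exists>P. sym_mat P \<and> psd A P \<and> (\<forall>i\<in>A. \<forall>j\<in>A. i = j \<or> E i j \<longrightarrow> P i j = M i j)"
      using A psubset.prems(2) by (intro psubset.IH[OF A] chordal_on_subset[OF psubset.prems(1)]) auto
    then obtain P where P: "sym_mat P" "psd A P" "\<And>i j. i \<in> A \<Longrightarrow> j \<in> A \<Longrightarrow> i = j \<or> E i j \<Longrightarrow> P i j = M i j"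
      by blast
    have "\<exists>P. sym_mat P \<and> psd B P \<and> (\<forall>i\<in>B. \<forall>j\<in>B. i = j \<or> E i j \<longrightarrow> P i j = M i j)"
      using B psubset.prems(2) by (intro psubset.IH[OF B] chordal_on_subset[OF psubset.prems(1)]) auto
    then obtain R where R: "sym_mat R" "psd B R" "\<And>i j. i \<in> B \<Longrightarrow> j \<in> B \<Longrightarrow> i = j \<or> E i j \<Longrightarrow> R i j = M i j"
      by blast
    have AB: "A \<inter> B = S" "A \<union> B = V" using CV SV unfolding A_def B_def S_def by auto
    have fin: "finite A" "finite B" using A B psubset.hyps finite_subset by auto
    have agr: "P i j = R i j" if ij: "i \<in> A \<inter> B" "j \<in> A \<inter> B" for i j
    proof -
      have "i = j \<or> E i j" using ij AB Scl by auto
      then show ?thesis using P(3)[of i j] R(3)[of i j] ij by auto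
    qed
    obtain Q where Q: "sym_mat Q" "psd (A \<union> B) Q" "\<forall>i\<in>A. \<forall>j\<in>A. Q i j = P i j"
      "\<forall>i\<in>B. \<forall>j\<in>B. Q i j = R i j"
      using psd_amalgamate[OF fin P(1) R(1) P(2) R(2) agr] by blast
    have "Q i j = M i j" if ij: "i \<in> V" "j \<in> V" "i = j \<or> E i j" for i j
    proof -
      \<comment> \<open>No edge leaves C except into S, so every edge lies within A or within
        B.\<close>
      have "(i \<in> A \<and> j \<in> A) \<or> (i \<in> B \<and> j \<in> B)"
        using ij symE[of i j] unfolding A_def B_def S_def by auto
      then show ?thesis using P(3)[OF _ _ ij(3)] R(3)[OF _ _ ij(3)] Q(3,4) by metis
    qed
    then show ?thesis using Q(1,2) unfolding AB by blast
  qed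
qed

section \<open>Extreme rays at the level of matrices\<close>

text \<open>For symmetric matrices this is equality of the residue classes in degree 2; the diagonal
  is included, since {i, i} = {i}.\<close>

definition agree :: "'v set set \<Rightarrow> ('v \<Rightarrow> 'v \<Rightarrow> real) \<Rightarrow> ('v \<Rightarrow> 'v \<Rightarrow> real) \<Rightarrow> bool" where
  "agree \<Delta> M N \<longleftrightarrow> (\<forall>i j. {i, j} \<in> \<Delta> \<longrightarrow> M i j = N i j)"

definition nonneg_mat :: "'v set set \<Rightarrow> ('v \<Rightarrow> 'v \<Rightarrow> real) \<Rightarrow> bool" where
  "nonneg_mat \<Delta> M \<longleftrightarrow> sym_mat M \<and> (\<forall>F\<in>\<Delta>. psd F M)"

text \<open>Linear independence of the summands is replaced by proportionality of one summand to M.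
  Since M is nonzero this describes the same rays, and it yields the factor t at once.\<close>

definition extremal :: "'v set set \<Rightarrow> ('v \<Rightarrow> 'v \<Rightarrow> real) \<Rightarrow> bool" where
  "extremal \<Delta> M \<longleftrightarrow> nonneg_mat \<Delta> M \<and> \<not> agree \<Delta> M (\<lambda>i j. 0) \<and>
     (\<forall>Y Z. nonneg_mat \<Delta> Y \<longrightarrow> nonneg_mat \<Delta> Z \<longrightarrow> agree \<Delta> M (\<lambda>i j. Y i j + Z i j) \<longrightarrow>
        (\<exists>t. agree \<Delta> Y (\<lambda>i j. t * M i j)))"

text \<open>The rank is at most one: zero is included, while negative multiples of squares are
  not.\<close>

definition rank_one :: "'v set \<Rightarrow> ('v \<Rightarrow> 'v \<Rightarrow> real) \<Rightarrow> bool" where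
  "rank_one F M \<longleftrightarrow> (\<exists>w. \<forall>i\<in>F. \<forall>j\<in>F. M i j = w i * w j)"

definition locally_rank_one :: "'v set set \<Rightarrow> bool" where
  "locally_rank_one \<Delta> \<longleftrightarrow> (\<forall>M. extremal \<Delta> M \<longrightarrow> (\<forall>F\<in>\<Delta>. rank_one F M))"

lemma agreeD: "agree \<Delta> M N \<Longrightarrow> {i, j} \<in> \<Delta> \<Longrightarrow> M i j = N i j"
  unfolding agree_def by blast

lemma extremalD:
  assumes "extremal \<Delta> M"
  shows "nonneg_mat \<Delta> M" "sym_mat M" "\<And>F. F \<in> \<Delta> \<Longrightarrow> psd F M" "\<not> agree \<Delta> M (\<lambda>i j. 0)"
    "\<And>Y Z. nonneg_mat \<Delta> Y \<Longrightarrow> nonneg_mat \<Delta> Z \<Longrightarrow> agree \<Delta> M (\<lambda>i j. Y i j + Z i j) \<Longrightarrow>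
        \<exists>t. agree \<Delta> Y (\<lambda>i j. t * M i j)"
  using assms unfolding extremal_def nonneg_mat_def by blast+

lemma simplicial_complexD:
  assumes "simplicial_complex \<Delta>"
  shows "finite (vertices \<Delta>)" "{} \<in> \<Delta>" "\<And>F G. F \<in> \<Delta> \<Longrightarrow> G \<subseteq> F \<Longrightarrow> G \<in> \<Delta>"
    "\<And>F. F \<in> \<Delta> \<Longrightarrow> F \<subseteq> vertices \<Delta>" "\<And>F. F \<in> \<Delta> \<Longrightarrow> finite F" "finite \<Delta>"
    "\<And>v. v \<in> vertices \<Delta> \<Longrightarrow> {v} \<in> \<Delta>" "\<And>i j. {i, j} \<in> \<Delta> \<Longrightarrow> {i} \<in> \<Delta>" "\<And>i j. {i, j} \<in> \<Delta> \<Longrightarrow> {j} \<in> \<Delta>"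
    "\<And>F i j. F \<in> \<Delta> \<Longrightarrow> i \<in> F \<Longrightarrow> j \<in> F \<Longrightarrow> {i, j} \<in> \<Delta>"
proof -
  show 1: "finite (vertices \<Delta>)" "{} \<in> \<Delta>" and 2: "\<And>F G. F \<in> \<Delta> \<Longrightarrow> G \<subseteq> F \<Longrightarrow> G \<in> \<Delta>"
    using assms unfolding simplicial_complex_def by blast+
  show 3: "\<And>F. F \<in> \<Delta> \<Longrightarrow> F \<subseteq> vertices \<Delta>" unfolding vertices_def by blast
  show "\<And>F. F \<in> \<Delta> \<Longrightarrow> finite F" using 1(1) 3 finite_subset by blast
  show "finite \<Delta>" using 3 1(1) by (meson PowI finite_Pow_iff finite_subset subsetI)
  show "{v} \<in> \<Delta>" if v: "v \<in> vertices \<Delta>" for v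
  proof -
    obtain F where F: "F \<in> \<Delta>" "v \<in> F" using v unfolding vertices_def by blast
    then show ?thesis using 2[of F "{v}"] by blast
  qed
  show "{i} \<in> \<Delta>" "{j} \<in> \<Delta>" if "{i, j} \<in> \<Delta>" for i j using 2[OF that] by blast+
  show "{i, j} \<in> \<Delta>" if "F \<in> \<Delta>" "i \<in> F" "j \<in> F" for F i j using 2[OF that(1), of "{i, j}"] that by blast
qed

lemma nonneg_mat_diag:
  assumes "simplicial_complex \<Delta>" "nonneg_mat \<Delta> M"
  shows "{u} \<in> \<Delta> \<Longrightarrow> 0 \<le> M u u"
    "{u, v} \<in> \<Delta> \<Longrightarrow> (M u v)\<^sup>2 \<le> M u u * M v v"
  using assms(2) psd_diag[of "{u}" M u] psd_entry_bound[of M "{u, v}" u v]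
  unfolding nonneg_mat_def by auto

text \<open>By the 2 by 2 minors a nonzero entry on an edge forces a nonzero diagonal entry. Such a
  vertex is where a square can be split off.\<close>

lemma nonneg_mat_pos_diag:
  assumes "simplicial_complex \<Delta>" "nonneg_mat \<Delta> M" "\<not> agree \<Delta> M (\<lambda>i j. 0)"
  obtains u where "{u} \<in> \<Delta>" "0 < M u u"
proof -
  obtain i j where ij: "{i, j} \<in> \<Delta>" "M i j \<noteq> 0" using assms(3) unfolding agree_def by blast
  have "0 < (M i j)\<^sup>2" using ij(2) by simp
  then have "M i i \<noteq> 0" using nonneg_mat_diag(2)[OF assms(1,2) ij(1)] by auto
  moreover have i: "{i} \<in> \<Delta>" using ij(1) by (rule simplicial_complexD(8)[OF assms(1)])
  ultimately have "0 < M i i" using nonneg_mat_diag(1)[OF assms(1,2) i] by simp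
  then show ?thesis using that i by blast
qed

lemma rank_one_outer:
  assumes "0 \<le> c" "\<And>i j. i \<in> F \<Longrightarrow> j \<in> F \<Longrightarrow> M i j = c * (w i * w j)"
  shows "rank_one F M"
  unfolding rank_one_def
proof (intro exI ballI)
  fix i j assume "i \<in> F" "j \<in> F"
  then show "M i j = sqrt c * w i * (sqrt c * w j)" using assms by (simp add: mult_ac)
qed

lemma rank_one_image:
  assumes "inj_on f F" "rank_one F (\<lambda>i j. M (f i) (f j))"
  shows "rank_one (f ` F) M"
proof -
  obtain w where w: "\<forall>i\<in>F. \<forall>j\<in>F. M (f i) (f j) = w i * w j"
    using assms(2) unfolding rank_one_def by blast
  show ?thesis unfolding rank_one_def
    by (intro exI[of _ "w \<circ> the_inv_into F f"]) (use w the_inv_into_f_f[OF assms(1)] in auto)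
qed

lemma rank_one_zero: "(\<And>i j. i \<in> F \<Longrightarrow> j \<in> F \<Longrightarrow> M i j = 0) \<Longrightarrow> rank_one F M"
  by (rule rank_one_outer[of 0 F M "\<lambda>_. 0"]) auto

text \<open>Split off the square that eliminates a vertex of positive weight.\<close>

lemma extremal_completion_rank_one:
  assumes sc: "simplicial_complex \<Delta>" and ext: "extremal \<Delta> M"
    and Q: "sym_mat Q" "psd (vertices \<Delta>) Q" "agree \<Delta> M Q" and F: "F \<in> \<Delta>"
  shows "rank_one F M"
proof -
  note scD = simplicial_complexD[OF sc] and extD = extremalD[OF ext]
  obtain u where u: "{u} \<in> \<Delta>" "0 < M u u" using nonneg_mat_pos_diag[OF sc extD(1,4)] .
  have uV: "u \<in> vertices \<Delta>" using scD(4)[OF u(1)] by simp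
  have Quu: "Q u u = M u u" using agreeD[OF Q(3), of u u] u(1) by simp
  define Y where "Y i j = (1 / Q u u) * (Q u i * Q u j)" for i j
  define Z where "Z i j = Q i j - Q u i * Q u j / Q u u" for i j
  have "psd G Y" for G
    unfolding Y_def using u(2) Quu by (intro psd_scale psd_outer) simp
  then have Y: "nonneg_mat \<Delta> Y"
    unfolding nonneg_mat_def sym_mat_def by (auto simp: Y_def)
  have "psd (vertices \<Delta>) Z" unfolding Z_def by (rule psd_deflate_unit[OF Q(1,2) scD(1) uV])
  then have "psd G Z" if "G \<in> \<Delta>" for G using psd_mono[OF scD(1) _ scD(4)[OF that]] by blast
  then have Z: "nonneg_mat \<Delta> Z"
    using Q(1) unfolding nonneg_mat_def sym_mat_def by (auto simp: Z_def)
  have "agree \<Delta> M (\<lambda>i j. Y i j + Z i j)"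
    using Q(3) unfolding agree_def Y_def Z_def by simp
  then obtain t where t: "agree \<Delta> Y (\<lambda>i j. t * M i j)" using extD(5)[OF Y Z] by blast
  \<comment> \<open>Y and Q have the same entry at u, which fixes the factor: t = 1 and M is the
    square itself on faces.\<close>
  have "Q u u = t * Q u u" using agreeD[OF t, of u u] u Quu unfolding Y_def by simp
  then have "t = 1" using u(2) Quu by simp
  then have "M i j = (1 / Q u u) * (Q u i * Q u j)" if "i \<in> F" "j \<in> F" for i j
    using agreeD[OF t, of i j] scD(10)[OF F that] unfolding Y_def by simp
  then show ?thesis using u(2) Quu by (intro rank_one_outer[of "1 / Q u u" F M "Q u"]) auto
qed

section \<open>Chordal complexes\<close>

lemma chordal_complex_completion:
  assumes "chordal_complex \<Delta>" "nonneg_mat \<Delta> M"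
  shows "\<exists>Q. sym_mat Q \<and> psd (vertices \<Delta>) Q \<and> agree \<Delta> M Q"
proof -
  obtain G :: "('a, 'a \<times> 'a) pre_digraph" where G: "chordal_graph G" "\<Delta> = clique_complex G"
    using assms(1) unfolding chordal_complex_def by blast
  interpret graph G using G(1) unfolding chordal_graph_def by blast
  define E where "E u v \<longleftrightarrow> (u, v) \<in> arcs_ends G" for u v
  have symE: "E v u" if "E u v" for u v
    using that arcs_ends_symmetric[OF sym_arcs] unfolding E_def by blast
  have irr: "\<not> E u u" for u unfolding E_def using adj_not_same by blast
  have V: "vertices \<Delta> = verts G" unfolding G(2) vertices_def clique_complex_def by blast
  have "chordal_on (verts G) E"
    unfolding chordal_on_def
  proof
    assume "\<exists>xs. length xs \<ge> 4 \<and> distinct xs \<and> set xs \<subseteq> verts G \<and>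
         (\<forall>i<length xs. \<forall>j<length xs.
            E (xs ! i) (xs ! j) \<longleftrightarrow> j = Suc i mod length xs \<or> i = Suc j mod length xs)"
    then obtain xs where "length xs \<ge> 4" "distinct xs" "set xs \<subseteq> verts G"
      "\<forall>i<length xs. \<forall>j<length xs.
            E (xs ! i) (xs ! j) \<longleftrightarrow> j = Suc i mod length xs \<or> i = Suc j mod length xs"
      by blast
    then have "length xs \<ge> 4 \<and> induced_cycle G xs" unfolding induced_cycle_def E_def by simp
    then show False using G(1) unfolding chordal_graph_def by blast
  qed
  moreover have "psd K M" if "K \<subseteq> verts G" "\<And>u v. u \<in> K \<Longrightarrow> v \<in> K \<Longrightarrow> u \<noteq> v \<Longrightarrow> E u v" for K
    using assms(2) that unfolding nonneg_mat_def G(2) clique_complex_def E_def by blast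
  moreover have "sym_mat M" using assms(2) unfolding nonneg_mat_def by blast
  ultimately obtain Q where Q: "sym_mat Q" "psd (verts G) Q"
    "\<forall>i\<in>verts G. \<forall>j\<in>verts G. i = j \<or> E i j \<longrightarrow> Q i j = M i j"
    using chordal_psd_completion[where E = E, OF finite_verts _ symE irr] by blast
  have "agree \<Delta> M Q"
    unfolding agree_def
  proof (intro allI impI)
    fix i j assume "{i, j} \<in> \<Delta>"
    then have "i \<in> verts G" "j \<in> verts G" "i = j \<or> E i j"
      unfolding G(2) clique_complex_def E_def by auto
    then show "M i j = Q i j" using Q(3) by metis
  qed
  then show ?thesis using Q V by metis
qed

lemma clique_complex_simplicial: "fin_digraph G \<Longrightarrow> simplicial_complex (clique_complex G)"
proof -
  assume "fin_digraph G"
  then interpret fin_digraph G .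
  have "vertices (clique_complex G) = verts G" unfolding vertices_def clique_complex_def by blast
  moreover have "H \<in> clique_complex G" if "F \<in> clique_complex G" "H \<subseteq> F" for F H
    using that unfolding clique_complex_def by blast
  moreover have "{} \<in> clique_complex G" unfolding clique_complex_def by blast
  ultimately show ?thesis unfolding simplicial_complex_def by simp
qed

lemma chordal_complex_simplicial:
  assumes "chordal_complex \<Delta>" shows "simplicial_complex \<Delta>"
proof -
  obtain G :: "('a, 'a \<times> 'a) pre_digraph" where G: "chordal_graph G" "\<Delta> = clique_complex G"
    using assms unfolding chordal_complex_def by blast
  interpret graph G using G(1) unfolding chordal_graph_def by blast
  show ?thesis unfolding G(2) by (rule clique_complex_simplicial) unfold_locales
qed

text \<open>The convention that \<open>elocr\<close> is 0 for chordal complexes is thereby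
  consistent with the uniform condition on extreme matrices.\<close>

lemma chordal_complex_locally_rank_one: "chordal_complex \<Delta> \<Longrightarrow> locally_rank_one \<Delta>"
  unfolding locally_rank_one_def
proof (intro allI impI ballI)
  fix M F assume ch: "chordal_complex \<Delta>" and ext: "extremal \<Delta> M" and F: "F \<in> \<Delta>"
  obtain Q where "sym_mat Q" "psd (vertices \<Delta>) Q" "agree \<Delta> M Q"
    using chordal_complex_completion[OF ch extremalD(1)[OF ext]] by blast
  then show "rank_one F M"
    by (rule extremal_completion_rank_one[OF chordal_complex_simplicial[OF ch] ext _ _ _ F])
qed

section \<open>Gluing decompositions and 1-sums\<close>

text \<open>
  \<open>Y\<close> is extended by \<open>c M\<close> to the rest of \<open>X\<^sub>2\<close>, and \<open>Z\<close> by \<open>(1 - c) M\<close>.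
\<close>

lemma extremal_glue:
  assumes sc: "simplicial_complex X1" "simplicial_complex X2" and ext: "extremal (X1 \<union> X2) M"
    and Y: "nonneg_mat X1 Y" and Z: "nonneg_mat X1 Z" and sum: "agree X1 M (\<lambda>i j. Y i j + Z i j)"
    and c: "0 \<le> c" "c \<le> 1" and cap: "\<And>i j. {i, j} \<in> X1 \<Longrightarrow> {i, j} \<in> X2 \<Longrightarrow> Y i j = c * M i j"
  shows "\<exists>t. agree X1 Y (\<lambda>i j. t * M i j)"
proof -
  note extD = extremalD[OF ext]
  have capZ: "Z i j = (1 - c) * M i j" if "{i, j} \<in> X1" "{i, j} \<in> X2" for i j
    using cap[OF that] agreeD[OF sum that(1)] by (simp add: algebra_simps)
  \<comment> \<open>On pairs lying in both complexes the two branches agree by assumption, so on a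
    face of X2 the glued matrix is just d M.\<close>
  define glue where "glue N d i j = (if {i, j} \<in> X1 then N i j else d * M i j)" for N :: "'a \<Rightarrow> 'a \<Rightarrow> real" and d i j
  have glue: "nonneg_mat (X1 \<union> X2) (glue N d)"
    if N: "nonneg_mat X1 N" "0 \<le> d" "\<And>i j. {i, j} \<in> X1 \<Longrightarrow> {i, j} \<in> X2 \<Longrightarrow> N i j = d * M i j" for N d
    unfolding nonneg_mat_def
  proof (intro conjI ballI)
    show "sym_mat (glue N d)"
      using N(1) extD(2) unfolding nonneg_mat_def sym_mat_def glue_def by (simp add: insert_commute)
    fix F assume "F \<in> X1 \<union> X2"
    then consider "F \<in> X1" | "F \<in> X2" by blast
    then show "psd F (glue N d)"
    proof cases
      case 1
      then have "psd F N" using N(1) unfolding nonneg_mat_def by blast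
      then show ?thesis
        using simplicial_complexD(10)[OF sc(1) 1] psd_cong[of F "glue N d" N] unfolding glue_def by simp
    next
      case 2
      then have "psd F (\<lambda>i j. d * M i j)" using extD(3)[of F] N(2) by (intro psd_scale) auto
      then show ?thesis
        using simplicial_complexD(10)[OF sc(2) 2] psd_cong[of F "glue N d" "\<lambda>i j. d * M i j"] N(3)
        unfolding glue_def by auto
    qed
  qed
  have "agree (X1 \<union> X2) M (\<lambda>i j. glue Y c i j + glue Z (1 - c) i j)"
    using sum unfolding agree_def glue_def by (auto simp: algebra_simps)
  then obtain t where t: "agree (X1 \<union> X2) (glue Y c) (\<lambda>i j. t * M i j)"
    using extD(5)[OF glue[OF Y c(1) cap] glue[OF Z _ capZ]] c(2) by auto
  then have "agree X1 Y (\<lambda>i j. t * M i j)" unfolding agree_def glue_def by auto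
  then show ?thesis by blast
qed

lemma vertex_mem_iff: "simplicial_complex \<Delta> \<Longrightarrow> {v} \<in> \<Delta> \<longleftrightarrow> v \<in> vertices \<Delta>"
  using simplicial_complexD(7)[of \<Delta> v] unfolding vertices_def by auto

text \<open>Only one number is shared by the two summands, the entry at c. Any decomposition of the
  restriction prescribes a ratio in [0, 1] there, so it extends to the whole complex.\<close>

lemma extremal_one_sum_restrict:
  assumes sc: "simplicial_complex X1" "simplicial_complex X2" and ext: "extremal (X1 \<union> X2) M"
    and cap: "vertices X1 \<inter> vertices X2 = {c}"
  shows "agree X1 M (\<lambda>i j. 0) \<or> extremal X1 M"
proof (rule disjCI)
  assume "\<not> extremal X1 M"
  note extD = extremalD[OF ext]
  have c1: "{c} \<in> X1" using cap vertex_mem_iff[OF sc(1), of c] by blast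
  show "agree X1 M (\<lambda>i j. 0)"
  proof (rule ccontr)
    assume "\<not> agree X1 M (\<lambda>i j. 0)"
    moreover have M: "nonneg_mat X1 M" using extD(2,3) unfolding nonneg_mat_def by blast
    moreover have "\<exists>t. agree X1 Y (\<lambda>i j. t * M i j)"
      if Y: "nonneg_mat X1 Y" and Z: "nonneg_mat X1 Z" and sum: "agree X1 M (\<lambda>i j. Y i j + Z i j)" for Y Z
    proof -
      have Yc: "0 \<le> Y c c" and Zc: "0 \<le> Z c c"
        using nonneg_mat_diag(1)[OF sc(1) Y c1] nonneg_mat_diag(1)[OF sc(1) Z c1] .
      have Mc: "M c c = Y c c + Z c c" using agreeD[OF sum, of c c] c1 by simp
      \<comment> \<open>If \<open>M c c = 0\<close>, then \<open>Y c c\<close> and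
        \<open>Z c c\<close> vanish too, and the value d = 0 given by division by zero is
        right.\<close>
      define d where "d = Y c c / M c c"
      have d: "0 \<le> d" "d \<le> 1" "Y c c = d * M c c"
        using Yc Zc Mc unfolding d_def by (auto simp: divide_le_eq_1)
      have "Y i j = d * M i j" if "{i, j} \<in> X1" "{i, j} \<in> X2" for i j
      proof -
        have "i \<in> vertices X1 \<inter> vertices X2" "j \<in> vertices X1 \<inter> vertices X2"
          using that unfolding vertices_def by auto
        then show ?thesis using cap d(3) by auto
      qed
      then show ?thesis by (rule extremal_glue[OF sc ext Y Z sum d(1,2)])
    qed
    ultimately have "extremal X1 M" unfolding extremal_def by blast
    then show False using \<open>\<not> extremal X1 M\<close> by blast
  qed
qed

lemma image_pairE:
  assumes "{x, y} \<in> (`) f ` \<Delta>" "simplicial_complex \<Delta>"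
  obtains i j where "x = f i" "y = f j" "{i, j} \<in> \<Delta>"
proof -
  obtain F where F: "F \<in> \<Delta>" "{x, y} = f ` F" using assms(1) by blast
  then have "x \<in> f ` F" "y \<in> f ` F" by blast+
  then obtain i j where "i \<in> F" "j \<in> F" "x = f i" "y = f j" by blast
  then show ?thesis using that simplicial_complexD(10)[OF assms(2) F(1)] by blast
qed

lemma vertices_image: "vertices ((`) f ` \<Delta>) = f ` vertices \<Delta>"
  unfolding vertices_def by blast

lemma image_simplicial:
  assumes "simplicial_complex \<Delta>" shows "simplicial_complex ((`) f ` \<Delta>)"
proof -
  have "G \<in> (`) f ` \<Delta>" if F: "F \<in> \<Delta>" and G: "G \<subseteq> f ` F" for F G
  proof -
    obtain H where "H \<subseteq> F" "G = f ` H" using G subset_imageE by metis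
    then show ?thesis using simplicial_complexD(3)[OF assms F] by blast
  qed
  then show ?thesis unfolding simplicial_complex_def vertices_image
    using simplicial_complexD(1,2)[OF assms] by auto
qed

text \<open>Extremality is invariant under relabelling of vertices: decompositions of the pulled
  back matrix are pushed forward along the inverse of f. This moves between a complex and its copy
  inside a quotient, whose vertices are equivalence classes.\<close>

lemma extremal_image_rank_one:
  assumes sc: "simplicial_complex \<Delta>" and lr: "locally_rank_one \<Delta>" and inj: "inj_on f (vertices \<Delta>)"
    and ext: "extremal ((`) f ` \<Delta>) M" and F: "F \<in> \<Delta>"
  shows "rank_one (f ` F) M"
proof -
  note scD = simplicial_complexD[OF sc] and extD = extremalD[OF ext]
  define g where "g = the_inv_into (vertices \<Delta>) f"
  have g: "g (f i) = i" if "i \<in> vertices \<Delta>" for i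
    unfolding g_def using inj that by (rule the_inv_into_f_f)
  have vert: "i \<in> vertices \<Delta>" "j \<in> vertices \<Delta>" if "{i, j} \<in> \<Delta>" for i j
    using scD(4)[OF that] by auto
  have injF: "inj_on f G" if "G \<in> \<Delta>" for G using inj scD(4)[OF that] by (rule inj_on_subset)
  define N where "N i j = M (f i) (f j)" for i j
  have N: "nonneg_mat \<Delta> N"
    unfolding nonneg_mat_def
  proof (intro conjI ballI)
    show "sym_mat N" using extD(2) unfolding sym_mat_def N_def by blast
    fix G assume G: "G \<in> \<Delta>"
    then have "psd (f ` G) M" by (intro extD(3)) blast
    then show "psd G N" using psd_reindex[OF injF[OF G]] unfolding N_def by blast
  qed
  have push: "nonneg_mat ((`) f ` \<Delta>) (\<lambda>x y. Y (g x) (g y))" if Y: "nonneg_mat \<Delta> Y" for Y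
  proof -
    have "psd (f ` G) (\<lambda>x y. Y (g x) (g y))" if G: "G \<in> \<Delta>" for G
    proof -
      have "psd G (\<lambda>i j. Y (g (f i)) (g (f j))) \<longleftrightarrow> psd G Y"
        using g scD(4)[OF G] by (intro psd_cong) (simp add: subset_eq)
      then show ?thesis using Y G psd_reindex[OF injF[OF G]] unfolding nonneg_mat_def by auto
    qed
    then show ?thesis using Y unfolding nonneg_mat_def sym_mat_def by auto
  qed
  have "extremal \<Delta> N"
    unfolding extremal_def
  proof (intro conjI allI impI N notI)
    assume Nz: "agree \<Delta> N (\<lambda>i j. 0)"
    have "agree ((`) f ` \<Delta>) M (\<lambda>i j. 0)"
      unfolding agree_def
    proof (intro allI impI)
      fix x y assume "{x, y} \<in> (`) f ` \<Delta>"
      then show "M x y = 0" using sc by (rule image_pairE) (use agreeD[OF Nz] N_def in auto)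
    qed
    then show False using extD(4) by blast
  next
    fix Y Z assume Y: "nonneg_mat \<Delta> Y" and Z: "nonneg_mat \<Delta> Z" and sum: "agree \<Delta> N (\<lambda>i j. Y i j + Z i j)"
    have "agree ((`) f ` \<Delta>) M (\<lambda>x y. Y (g x) (g y) + Z (g x) (g y))"
      unfolding agree_def
    proof (intro allI impI)
      fix x y assume "{x, y} \<in> (`) f ` \<Delta>"
      then show "M x y = Y (g x) (g y) + Z (g x) (g y)" using sc
      proof (rule image_pairE)
        fix i j assume ij: "x = f i" "y = f j" "{i, j} \<in> \<Delta>"
        then show ?thesis using agreeD[OF sum ij(3)] g vert[OF ij(3)] unfolding N_def by simp
      qed
    qed
    then obtain t where t: "agree ((`) f ` \<Delta>) (\<lambda>x y. Y (g x) (g y)) (\<lambda>i j. t * M i j)"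
      using extD(5)[OF push[OF Y] push[OF Z]] by blast
    have "agree \<Delta> Y (\<lambda>i j. t * N i j)"
      unfolding agree_def
    proof (intro allI impI)
      fix i j assume ij: "{i, j} \<in> \<Delta>"
      then have "{f i, f j} \<in> (`) f ` \<Delta>" by (intro image_eqI[OF _ ij]) simp
      then show "Y i j = t * N i j" using agreeD[OF t] g vert[OF ij] unfolding N_def by metis
    qed
    then show "\<exists>t. agree \<Delta> Y (\<lambda>i j. t * N i j)" by blast
  qed
  then have "rank_one F N" using lr F unfolding locally_rank_one_def by blast
  then show ?thesis unfolding N_def by (rule rank_one_image[OF injF[OF F]])
qed

lemma locally_rank_one_one_sum:
  assumes sc: "simplicial_complex \<Delta>" "simplicial_complex \<Gamma>"
    and lr: "locally_rank_one \<Delta>" "locally_rank_one \<Gamma>"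
    and inj: "inj_on f (vertices \<Delta>)" "inj_on f (vertices \<Gamma>)"
    and cap: "f ` vertices \<Delta> \<inter> f ` vertices \<Gamma> = {c}"
  shows "locally_rank_one ((`) f ` \<Delta> \<union> (`) f ` \<Gamma>)"
proof -
  have rank: "rank_one (f ` F) M"
    if "simplicial_complex A" "simplicial_complex B" "locally_rank_one A" "inj_on f (vertices A)"
      "f ` vertices A \<inter> f ` vertices B = {c}" "extremal ((`) f ` A \<union> (`) f ` B) M" "F \<in> A" for A B F M
  proof -
    have "agree ((`) f ` A) M (\<lambda>i j. 0) \<or> extremal ((`) f ` A) M"
      using that by (intro extremal_one_sum_restrict[of _ "(`) f ` B" M c])
        (auto simp: image_simplicial vertices_image)
    then show ?thesis
    proof
      assume z: "agree ((`) f ` A) M (\<lambda>i j. 0)"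
      have "f ` F \<in> (`) f ` A" using that(7) by blast
      then show ?thesis
        by (intro rank_one_zero agreeD[OF z] simplicial_complexD(10)[OF image_simplicial[OF that(1)]])
    next
      assume "extremal ((`) f ` A) M"
      then show ?thesis using that by (intro extremal_image_rank_one[of A]) auto
    qed
  qed
  show ?thesis
    unfolding locally_rank_one_def
  proof (intro allI impI ballI)
    fix M F assume ext: "extremal ((`) f ` \<Delta> \<union> (`) f ` \<Gamma>) M" and F: "F \<in> (`) f ` \<Delta> \<union> (`) f ` \<Gamma>"
    then consider G where "F = f ` G" "G \<in> \<Delta>" | G where "F = f ` G" "G \<in> \<Gamma>" by blast
    then show "rank_one F M"
    proof cases
      case 1
      then show ?thesis using rank[OF sc lr(1) inj(1) cap ext] by simp
    next
      case 2
      then show ?thesis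
        using rank[OF sc(2,1) lr(2) inj(2)] cap ext by (simp add: Int_commute Un_commute)
    qed
  qed
qed

section \<open>Cones\<close>

lemma cone_simplicial:
  assumes "simplicial_complex \<Delta>" shows "simplicial_complex (cone v \<Delta>)"
proof -
  note scD = simplicial_complexD[OF assms]
  have "vertices (cone v \<Delta>) \<subseteq> insert v (vertices \<Delta>)" unfolding vertices_def cone_def by auto
  then have "finite (vertices (cone v \<Delta>))" using scD(1) finite_subset by blast
  moreover have "G \<in> cone v \<Delta>" if "F \<in> cone v \<Delta>" "G \<subseteq> F" for F G
    using that scD(3)[of F G] scD(3)[of "F - {v}" "G - {v}"] unfolding cone_def by auto
  moreover have "{} \<in> cone v \<Delta>" using scD(2) unfolding cone_def by blast
  ultimately show ?thesis unfolding simplicial_complex_def by blast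
qed

lemma locally_rank_one_cone:
  assumes sc: "simplicial_complex \<Delta>" and lr: "locally_rank_one \<Delta>" and v: "v \<notin> vertices \<Delta>"
  shows "locally_rank_one (cone v \<Delta>)"
  unfolding locally_rank_one_def
proof (intro allI impI ballI)
  fix M F assume ext: "extremal (cone v \<Delta>) M" and F: "F \<in> cone v \<Delta>"
  let ?X = "cone v \<Delta>"
  note scD = simplicial_complexD[OF sc] and extD = extremalD[OF ext]
  note scX = cone_simplicial[OF sc, of v]
  note XD = simplicial_complexD[OF scX]
  have sub: "G \<in> ?X" if "G \<in> \<Delta>" for G using that scD(4)[OF that] unfolding cone_def by auto
  have ins: "insert v G \<in> ?X" if "G \<in> ?X" for G using that scD(3)[of G "G - {v}"] unfolding cone_def by auto
  have del: "G - {v} \<in> \<Delta>" if "G \<in> ?X" for G using that scD(3)[of G "G - {v}"] unfolding cone_def by auto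
  have vX: "{v} \<in> ?X" using ins[OF XD(2)] by simp
  have c0: "0 \<le> M v v" by (rule nonneg_mat_diag(1)[OF scX extD(1) vX])
  show "rank_one F M"
  proof (cases "M v v = 0")
    case False
    define Y where "Y i j = (1 / M v v) * (M v i * M v j)" for i j
    define Z where "Z i j = M i j - M v i * M v j / M v v" for i j
    have "psd G Y" for G unfolding Y_def using c0 by (intro psd_scale psd_outer) simp
    then have Y: "nonneg_mat ?X Y" unfolding nonneg_mat_def sym_mat_def by (auto simp: Y_def)
    have "psd G Z" if G: "G \<in> ?X" for G
    proof -
      \<comment> \<open>Deflation at v needs v in the index set, and in a cone every face can be
        enlarged by v.\<close>
      note G' = ins[OF G]
      have "psd (insert v G) Z" unfolding Z_def
        using psd_deflate_unit[OF extD(2) extD(3)[OF G'] XD(5)[OF G']] by blast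
      then show ?thesis using psd_mono[OF XD(5)[OF G']] by blast
    qed
    then have Z: "nonneg_mat ?X Z"
      using extD(2) unfolding nonneg_mat_def sym_mat_def by (auto simp: Z_def)
    have "agree ?X M (\<lambda>i j. Y i j + Z i j)" unfolding agree_def Y_def Z_def by simp
    then obtain t where t: "agree ?X Y (\<lambda>i j. t * M i j)" using extD(5)[OF Y Z] by blast
    have "Y v v = t * M v v" using agreeD[OF t, of v v] vX by simp
    then have "t = 1" using False unfolding Y_def by simp
    then have "M i j = (1 / M v v) * (M v i * M v j)" if "i \<in> F" "j \<in> F" for i j
      using agreeD[OF t, of i j] XD(10)[OF F that] unfolding Y_def by simp
    then show ?thesis using c0 by (intro rank_one_outer[of "1 / M v v" F M "M v"]) auto
  next
    case True
    \<comment> \<open>With zero weight at the apex, the minors kill its row on all edges, so M is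
      carried by the base and extremal there.\<close>
    have Mv: "M v i = 0" "M i v = 0" if "{v, i} \<in> ?X \<or> {i, v} \<in> ?X" for i
    proof -
      have "{v, i} \<in> ?X" using that by (auto simp: insert_commute)
      then show "M v i = 0" using nonneg_mat_diag(2)[OF scX extD(1), of v i] True by simp
      then show "M i v = 0" using extD(2) unfolding sym_mat_def by simp
    qed
    have pair: "{i, j} \<in> \<Delta>" if "{i, j} \<in> ?X" "i \<noteq> v" "j \<noteq> v" for i j
      using del[OF that(1)] that by (simp add: Diff_insert_absorb)
    have agr: "agree ?X N L"
      if "agree \<Delta> N L" "\<And>i. {v, i} \<in> ?X \<Longrightarrow> N v i = L v i \<and> N i v = L i v" for N L
      unfolding agree_def
    proof (intro allI impI)
      fix i j assume ij: "{i, j} \<in> ?X"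
      show "N i j = L i j"
      proof (cases "i = v \<or> j = v")
        case True
        then show ?thesis using that(2)[of j] that(2)[of i] ij by (auto simp: insert_commute)
      next
        case False
        then show ?thesis using pair[OF ij] agreeD[OF that(1)] by blast
      qed
    qed
    have pairv: "i \<noteq> v \<and> j \<noteq> v" if "{i, j} \<in> \<Delta>" for i j using scD(4)[OF that] v by auto
    have "extremal \<Delta> M"
      unfolding extremal_def
    proof (intro conjI allI impI notI)
      show "nonneg_mat \<Delta> M" using extD(2,3) sub unfolding nonneg_mat_def by blast
    next
      assume "agree \<Delta> M (\<lambda>i j. 0)"
      then have "agree ?X M (\<lambda>i j. 0)" using Mv by (intro agr) auto
      then show False using extD(4) by blast
    next
      fix Y Z assume Y: "nonneg_mat \<Delta> Y" and Z: "nonneg_mat \<Delta> Z" and sum: "agree \<Delta> M (\<lambda>i j. Y i j + Z i j)"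
      \<comment> \<open>Matrices on the base become matrices on the cone by a zero row and column at
        the apex.\<close>
      define e where "e N i j = (if i = v \<or> j = v then 0 else N i j :: real)" for N i j
      have e: "nonneg_mat ?X (e N)" if N: "nonneg_mat \<Delta> N" for N
        unfolding nonneg_mat_def
      proof (intro conjI ballI)
        show "sym_mat (e N)" using N unfolding nonneg_mat_def sym_mat_def e_def by auto
        fix G assume G: "G \<in> ?X"
        have "psd (G - {v}) N" using N del[OF G] unfolding nonneg_mat_def by blast
        then have 1: "psd (G - {v}) (e N)" using psd_cong[of "G - {v}" N "e N"] unfolding e_def by simp
        have "psd (insert v (G - {v})) (e N)"
          using 1 XD(5)[OF G] \<open>sym_mat (e N)\<close> by (subst psd_insert) (auto simp: e_def)
        then show "psd G (e N)" using psd_mono[of "insert v (G - {v})" "e N" G] XD(5)[OF G] by auto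
      qed
      have "agree ?X M (\<lambda>i j. e Y i j + e Z i j)"
      proof (rule agr)
        show "agree \<Delta> M (\<lambda>i j. e Y i j + e Z i j)"
          using sum pairv unfolding agree_def e_def by auto
      qed (use Mv in \<open>auto simp: e_def\<close>)
      then obtain t where t: "agree ?X (e Y) (\<lambda>i j. t * M i j)" using extD(5)[OF e[OF Y] e[OF Z]] by blast
      have "agree \<Delta> Y (\<lambda>i j. t * M i j)"
        unfolding agree_def
      proof (intro allI impI)
        fix i j assume ij: "{i, j} \<in> \<Delta>"
        show "Y i j = t * M i j" using agreeD[OF t sub[OF ij]] pairv[OF ij] unfolding e_def by simp
      qed
      then show "\<exists>t. agree \<Delta> Y (\<lambda>i j. t * M i j)" by blast
    qed
    then have "rank_one (F - {v}) M" using lr del[OF F] unfolding locally_rank_one_def by blast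
    then obtain w where w: "\<forall>i\<in>F - {v}. \<forall>j\<in>F - {v}. M i j = w i * w j" unfolding rank_one_def by blast
    have "M i j = (w(v := 0)) i * (w(v := 0)) j" if ij: "i \<in> F" "j \<in> F" for i j
    proof (cases "i = v \<or> j = v")
      case True
      then have "M i j = 0" using Mv[of i] Mv[of j] XD(10)[OF F ij] by auto
      then show ?thesis using True by auto
    next
      case False
      then show ?thesis using w ij by simp
    qed
    then show ?thesis unfolding rank_one_def by blast
  qed
qed

section \<open>Thickened graphs and 1-sums\<close>

lemma psd_subtract_square:
  assumes "sym_mat Q" "psd V Q" "finite V" "u \<in> V" "0 < Q u u"
  shows "psd V (\<lambda>i j. Q i j - (Q u i / sqrt (Q u u)) * (Q u j / sqrt (Q u u)))"
  using psd_deflate_unit[OF assms(1-4)] assms(5) by simp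

text \<open>
  In the main case the square is taken along the vector \<open>\<beta> e\<^sub>H + s \<alpha> e\<^sub>T\<close> with
  \<open>\<alpha> = \<surd>Q\<^sub>H\<^sub>H\<close>, \<open>\<beta> = \<surd>Q\<^sub>T\<^sub>T\<close> and a sign \<open>s\<close> making \<open>\<alpha>\<beta> + s Q\<^sub>H\<^sub>T\<close> positive. Since the two choices of \<open>s\<close> give
  \<open>Q\<close>-orthogonal vectors, both see \<open>e\<^sub>H\<close> and \<open>e\<^sub>T\<close> in the same proportion as \<open>Q\<close> does.
\<close>

lemma psd_balanced_square:
  assumes sym: "sym_mat Q" and psd: "psd V Q" and fin: "finite V" and HT: "H \<in> V" "T \<in> V" "H \<noteq> T"
    and u: "u \<in> V" "0 < Q u u"
  obtains w c where "0 \<le> c" "c \<le> 1" "psd V (\<lambda>i j. Q i j - w i * w j)" "\<exists>k\<in>V. w k \<noteq> 0"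
    "w H * w H = c * Q H H" "w T * w T = c * Q T T"
    "\<And>k. Q H H = Q T T \<Longrightarrow> Q H k = Q T k \<Longrightarrow> w H * w k = w T * w k"
proof -
  have sq: "Q i j = Q j i" for i j using sym unfolding sym_mat_def by blast
  have nn: "0 \<le> Q H H" "0 \<le> Q T T" using psd_diag[OF fin psd] HT by auto
  have bd: "(Q i j)\<^sup>2 \<le> Q i i * Q j j" if "i \<in> V" "j \<in> V" for i j
    by (rule psd_entry_bound[OF sym psd fin that])
  define w0 where "w0 k i = Q k i / sqrt (Q k k)" for k i
  have w0: "psd V (\<lambda>i j. Q i j - w0 k i * w0 k j)" "w0 k k \<noteq> 0" "w0 k k * w0 k k = Q k k"
    if "k \<in> V" "0 < Q k k" for k
    unfolding w0_def using psd_subtract_square[OF sym psd fin that] that by simp_all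
  consider "0 < Q H H" "0 < Q T T" | "0 < Q H H" "Q T T = 0" | "Q H H = 0" "0 < Q T T" | "Q H H = 0" "Q T T = 0"
    using nn by linarith
  then show ?thesis
  proof cases
    case 1
    define \<alpha> \<beta> where "\<alpha> = sqrt (Q H H)" and "\<beta> = sqrt (Q T T)"
    define \<gamma> where "\<gamma> = Q H T"
    have ab: "0 < \<alpha>" "0 < \<beta>" "Q H H = \<alpha>\<^sup>2" "Q T T = \<beta>\<^sup>2" unfolding \<alpha>_def \<beta>_def using 1 by auto
    have pos: "0 < \<alpha> * \<beta>" using ab by simp
    have "\<gamma>\<^sup>2 \<le> (\<alpha> * \<beta>)\<^sup>2" using bd[OF HT(1,2)] ab unfolding \<gamma>_def by (simp add: power_mult_distrib)
    then have g: "\<bar>\<gamma>\<bar> \<le> \<alpha> * \<beta>" using pos by (simp add: power2_le_iff_abs_le)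
    \<comment> \<open>Since |\<gamma>| \<le> \<alpha> \<beta>, the first choice fails only for
      \<gamma> = - \<alpha> \<beta>, and then s = -1 gives p = 2 \<alpha> \<beta>.\<close>
    define s :: real where "s = (if \<alpha> * \<beta> + \<gamma> > 0 then 1 else - 1)"
    have s: "s = 1 \<or> s = - 1" "s * s = 1" unfolding s_def by auto
    define p where "p = \<alpha> * \<beta> + s * \<gamma>"
    have p: "0 < p" "p \<le> 2 * (\<alpha> * \<beta>)" using g pos unfolding p_def s_def by (auto split: if_splits)
    define f where "f i = (if i = H then \<beta> else 0) + (if i = T then s * \<alpha> else 0)" for i
    have sumf: "(\<Sum>k\<in>V. g k * f k) = g H * \<beta> + g T * (s * \<alpha>)" for g
    proof -
      have "g k * f k = (if k = H then g H * \<beta> else 0) + (if k = T then g T * (s * \<alpha>) else 0)" for k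
        unfolding f_def by (simp add: distrib_left)
      then have "(\<Sum>k\<in>V. g k * f k) = (\<Sum>k\<in>V. if k = H then g H * \<beta> else 0)
          + (\<Sum>k\<in>V. if k = T then g T * (s * \<alpha>) else 0)"
        unfolding sum.distrib[symmetric] by (intro sum.cong refl)
      then show ?thesis using fin HT by (simp add: sum.delta)
    qed
    have Qf: "(\<Sum>k\<in>V. Q i k * f k) = \<beta> * Q i H + s * \<alpha> * Q i T" for i
      unfolding sumf by simp
    have QH: "\<beta> * Q H H + s * \<alpha> * Q H T = \<alpha> * p"
      unfolding ab(3) p_def \<gamma>_def by (simp add: algebra_simps power2_eq_square)
    have QT: "\<beta> * Q T H + s * \<alpha> * Q T T = s * \<beta> * p"
      using s(2) unfolding ab(4) p_def \<gamma>_def sq[of T H] by (simp add: algebra_simps power2_eq_square)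
    have "bform V Q f f = (\<Sum>i\<in>V. (\<beta> * Q i H + s * \<alpha> * Q i T) * f i)"
      unfolding bform_def Qf[symmetric] by (simp add: sum_distrib_right sum_distrib_left mult_ac)
    also have "\<dots> = (\<beta> * Q H H + s * \<alpha> * Q H T) * \<beta> + (\<beta> * Q T H + s * \<alpha> * Q T T) * (s * \<alpha>)"
      unfolding sumf by simp
    also have "\<dots> = 2 * (\<alpha> * \<beta>) * p"
      unfolding QH QT using s(2) by (simp add: algebra_simps)
    finally have d: "bform V Q f f = 2 * (\<alpha> * \<beta>) * p" .
    define d where "d = 2 * (\<alpha> * \<beta>) * p"
    have dp: "0 < d" unfolding d_def using pos p by simp
    define w where "w i = (\<beta> * Q i H + s * \<alpha> * Q i T) / sqrt d" for i
    \<comment> \<open>Q f has the entries \<alpha> p at H and s \<beta> p at T. After division by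
      the root of d = 2 \<alpha> \<beta> p their squares are \<open>Q H H\<close> and
      \<open>Q T T\<close> times the same number p / (2 \<alpha> \<beta>).\<close>
    define c where "c = p / (2 * (\<alpha> * \<beta>))"
    have ww: "w i * w j = (\<beta> * Q i H + s * \<alpha> * Q i T) * (\<beta> * Q j H + s * \<alpha> * Q j T) / d" for i j
      unfolding w_def using dp by simp
    have cd: "p * p / d = c" unfolding c_def d_def using p by simp
    have wH: "w H = \<alpha> * p / sqrt d" and wT: "w T = s * \<beta> * p / sqrt d"
      unfolding w_def QH QT by simp_all
    show ?thesis
    proof (rule that[of c w])
      show "0 \<le> c" "c \<le> 1" unfolding c_def using p pos by (simp_all add: divide_le_eq_1)
      show "psd V (\<lambda>i j. Q i j - w i * w j)"
        using psd_deflate[OF sym psd fin, of f] unfolding ww Qf d d_def .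
      have "w H \<noteq> 0" unfolding wH using ab p dp by simp
      then show "\<exists>k\<in>V. w k \<noteq> 0" using HT by blast
      have "w H * w H = (\<alpha> * p) * (\<alpha> * p) / d" unfolding wH using dp by simp
      also have "\<dots> = p * p / d * \<alpha>\<^sup>2" by (simp add: power2_eq_square)
      finally show "w H * w H = c * Q H H" unfolding cd ab(3) .
      have "w T * w T = (s * \<beta> * p) * (s * \<beta> * p) / d" unfolding wT using dp by simp
      also have "\<dots> = (s * s) * (p * p / d) * \<beta>\<^sup>2" by (simp add: power2_eq_square mult_ac)
      finally show "w T * w T = c * Q T T" unfolding cd ab(4) s(2) by simp
      fix k assume k: "Q H H = Q T T" "Q H k = Q T k"
      have "\<alpha> = \<beta>" unfolding \<alpha>_def \<beta>_def k(1) ..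
      show "w H * w k = w T * w k"
      \<comment> \<open>For \<alpha> = \<beta> and s = 1 the entries of w at H and T coincide. For s
        = -1 the entry \<open>w k\<close> is a multiple of \<open>Q k H - Q k T\<close>, which is
        zero.\<close>
      proof (cases "s = 1")
        case True
        then show ?thesis unfolding wH wT \<open>\<alpha> = \<beta>\<close> by simp
      next
        case False
        then have "w k = 0" using s(1) k(2) unfolding w_def \<open>\<alpha> = \<beta>\<close> sq[of k H] sq[of k T] by simp
        then show ?thesis by simp
      qed
    qed
  next
    case 2
    \<comment> \<open>The zero diagonal entry at T kills the whole row of T, so the square at H
      works with c = 1.\<close>
    have "w0 H T = 0" using bd[OF HT(1,2)] 2 unfolding w0_def by simp
    moreover have "\<exists>k\<in>V. w0 H k \<noteq> 0" using w0(2)[OF HT(1) 2(1)] HT(1) by blast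
    ultimately show ?thesis using 2 w0(1,3)[OF HT(1) 2(1)] by (intro that[of 1 "w0 H"]) simp_all
  next
    case 3
    have "w0 T H = 0" using bd[OF HT(2,1)] 3 unfolding w0_def by simp
    moreover have "\<exists>k\<in>V. w0 T k \<noteq> 0" using w0(2)[OF HT(2) 3(2)] HT(2) by blast
    ultimately show ?thesis using 3 w0(1,3)[OF HT(2) 3(2)] by (intro that[of 1 "w0 T"]) simp_all
  next
    case 4
    \<comment> \<open>With both diagonal entries zero no square reaches H or T; the vertex u then
      supplies a nonzero one, with c = 0.\<close>
    have "w0 u H = 0" "w0 u T = 0" using bd[OF u(1) HT(1)] bd[OF u(1) HT(2)] 4 unfolding w0_def by simp_all
    moreover have "\<exists>k\<in>V. w0 u k \<noteq> 0" using w0(2)[OF u] u(1) by blast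
    ultimately show ?thesis using 4 w0(1)[OF u] by (intro that[of 0 "w0 u"]) simp_all
  qed
qed

text \<open>The entry at (x, y) is read off from a chosen preimage pair in the complex, with 0 where
  there is none. The choices for (x, y) and (y, x) may be unrelated; consistency on faces still
  makes Y symmetric.\<close>

lemma matrix_pushforward:
  assumes sc: "simplicial_complex C" and sym: "\<And>u v. K u v = K v u"
    and cons: "\<And>u v u' v'. {u, v} \<in> C \<Longrightarrow> {u', v'} \<in> C \<Longrightarrow> f u = f u' \<Longrightarrow> f v = f v' \<Longrightarrow> K u v = K u' v'"
  obtains Y where "sym_mat Y" "\<And>u v. {u, v} \<in> C \<Longrightarrow> Y (f u) (f v) = K u v"
proof -
  define P where "P x y p \<longleftrightarrow> {fst p, snd p} \<in> C \<and> f (fst p) = x \<and> f (snd p) = y" for x y p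
  define Y where "Y x y = (if \<exists>p. P x y p then let p = SOME p. P x y p in K (fst p) (snd p) else 0)" for x y
  have Y: "Y (f u) (f v) = K u v" if uv: "{u, v} \<in> C" for u v
  proof -
    have ex: "P (f u) (f v) (u, v)" unfolding P_def using uv by simp
    define p where "p = (SOME p. P (f u) (f v) p)"
    have "P (f u) (f v) p" unfolding p_def using ex by (rule someI)
    then have "K (fst p) (snd p) = K u v" using cons[OF _ uv] unfolding P_def by blast
    moreover have "Y (f u) (f v) = K (fst p) (snd p)"
      unfolding Y_def Let_def p_def using ex by (subst if_P) blast+
    ultimately show ?thesis by simp
  qed
  have "Y x y = Y y x" for x y
  proof (cases "\<exists>p. P x y p")
    case True
    then obtain u v where uv: "{u, v} \<in> C" "f u = x" "f v = y" unfolding P_def by auto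
    then have "{v, u} \<in> C" by (simp add: insert_commute)
    then show ?thesis using Y[OF uv(1)] Y[of v u] uv sym[of u v] by simp
  next
    case False
    moreover have "P x y (snd p, fst p)" if "P y x p" for p
      using that unfolding P_def by (simp add: insert_commute)
    ultimately have "\<not> (\<exists>p. P y x p)" by blast
    then show ?thesis using False unfolding Y_def by simp
  qed
  then show ?thesis using that[of Y] Y unfolding sym_mat_def by blast
qed

text \<open>
  For a loop, \<open>f\<close> identifies \<open>H\<close> and \<open>T\<close>, and two edges \<open>{H, k}\<close> and \<open>{T, k}\<close> of \<open>C\<close> may be collapsed to one.
  The last property in \<open>psd_balanced_square\<close> ensures that the square still descends to the quotient.
\<close>

lemma extremal_handle_rank_one:
  assumes ch: "chordal_complex C" and HT: "H \<in> vertices C" "T \<in> vertices C" "{H, T} \<notin> C"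
    and fib: "\<And>u v. u \<in> vertices C \<Longrightarrow> v \<in> vertices C \<Longrightarrow> f u = f v \<Longrightarrow> u = v \<or> {u, v} = {H, T}"
    and sc2: "simplicial_complex X2"
    and cap: "\<And>x y. {x, y} \<in> (`) f ` C \<Longrightarrow> {x, y} \<in> X2 \<Longrightarrow> x = y \<and> x \<in> {f H, f T}"
    and ext: "extremal ((`) f ` C \<union> X2) M" and F: "F \<in> C"
  shows "rank_one (f ` F) M"
proof -
  note scC = chordal_complex_simplicial[OF ch]
  note CD = simplicial_complexD[OF scC] and extD = extremalD[OF ext]
  let ?V = "vertices C" and ?X1 = "(`) f ` C"
  have vert: "i \<in> ?V" "j \<in> ?V" if "{i, j} \<in> C" for i j using CD(4)[OF that] by auto
  have HneT: "H \<noteq> T" using HT CD(7)[of H] by auto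
  have Hf: "{H} \<in> C" "{T} \<in> C" using HT CD(7) by auto
  \<comment> \<open>The map f may identify H with T, but no face contains both, so it is injective
    on every face.\<close>
  have injF: "inj_on f G" if G: "G \<in> C" for G
  proof (rule inj_onI)
    fix u v assume uv: "u \<in> G" "v \<in> G" "f u = f v"
    then have "{u, v} \<in> C" using CD(10)[OF G] by blast
    then show "u = v" using fib[of u v] vert uv HT by metis
  qed
  define N where "N i j = M (f i) (f j)" for i j
  have N: "nonneg_mat C N"
    unfolding nonneg_mat_def
  proof (intro conjI ballI)
    show "sym_mat N" using extD(2) unfolding sym_mat_def N_def by blast
    fix G assume G: "G \<in> C"
    then have "psd (f ` G) M" by (intro extD(3)) blast
    then show "psd G N" using psd_reindex[OF injF[OF G]] unfolding N_def by blast
  qed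
  obtain Q where Q: "sym_mat Q" "psd ?V Q" "agree C N Q"
    using chordal_complex_completion[OF ch N] by blast
  show ?thesis
  proof (cases "agree C N (\<lambda>i j. 0)")
    case True
    show ?thesis
      by (intro rank_one_image[OF injF[OF F]] rank_one_zero)
        (use agreeD[OF True CD(10)[OF F]] N_def in auto)
  next
    case False
    obtain u where u: "{u} \<in> C" "0 < N u u" using nonneg_mat_pos_diag[OF scC N False] .
    have uV: "u \<in> ?V" using CD(4)[OF u(1)] by simp
    have Quu: "0 < Q u u" using agreeD[OF Q(3), of u u] u by simp
    obtain w c where c: "0 \<le> c" "c \<le> 1" and wpsd: "psd ?V (\<lambda>i j. Q i j - w i * w j)"
      and wk: "\<exists>k\<in>?V. w k \<noteq> 0" and wH: "w H * w H = c * Q H H" and wT: "w T * w T = c * Q T T"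
      and wl: "\<And>k. Q H H = Q T T \<Longrightarrow> Q H k = Q T k \<Longrightarrow> w H * w k = w T * w k"
      by (rule psd_balanced_square[OF Q(1,2) CD(1) HT(1,2) HneT uV Quu], rule that)
    have QH: "Q H H = M (f H) (f H)" and QT: "Q T T = M (f T) (f T)"
      using agreeD[OF Q(3), of H H] agreeD[OF Q(3), of T T] Hf unfolding N_def by simp_all
    have loop: "w H * w k = w T * w k" if "f H = f T" "{H, k} \<in> C" "{T, k} \<in> C" for k
    proof (rule wl)
      show "Q H H = Q T T" using QH QT that(1) by simp
      show "Q H k = Q T k"
        using agreeD[OF Q(3) that(2)] agreeD[OF Q(3) that(3)] that(1) unfolding N_def by simp
    qed
    have loop2: "w H * w H = w T * w T" if "f H = f T" using wH wT QH QT that by simp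
    have one: "w i * w k = w j * w k"
      if ij: "f i = f j" "{i, k} \<in> C" "{j, k} \<in> C" for i j k
    proof -
      have "i = j \<or> (i = H \<and> j = T) \<or> (i = T \<and> j = H)"
        using fib[of i j] vert[OF ij(2)] vert[OF ij(3)] ij(1) by (auto simp: doubleton_eq_iff)
      then show ?thesis using loop[of k] ij by auto
    qed
    have cons: "w i * w j = w i' * w j'"
      if ij: "{i, j} \<in> C" "{i', j'} \<in> C" "f i = f i'" "f j = f j'" for i j i' j'
    proof -
      have i: "i = i' \<or> (i = H \<and> i' = T) \<or> (i = T \<and> i' = H)"
        using fib[of i i'] vert[OF ij(1)] vert[OF ij(2)] ij(3) by (auto simp: doubleton_eq_iff)
      have j: "j = j' \<or> (j = H \<and> j' = T) \<or> (j = T \<and> j' = H)"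
        using fib[of j j'] vert[OF ij(1)] vert[OF ij(2)] ij(4) by (auto simp: doubleton_eq_iff)
      consider "i = i'" | "j = j'" | "i \<noteq> i'" "j \<noteq> j'" by blast
      then show ?thesis
      proof cases
        case 1
        then show ?thesis using one[of j j' i] ij by (simp add: insert_commute mult.commute)
      next
        case 2
        then show ?thesis using one[of i i' j] ij by simp
      next
        case 3
        \<comment> \<open>When both indices change, each pair consists of endpoints. A pair of
          distinct endpoints is not a face, so only diagonal entries are left to compare.\<close>
        have "{T, H} \<notin> C" using HT(3) by (simp add: insert_commute)
        then have "i = j" "i' = j'" using 3 i j ij(1,2) HT(3) by auto
        then show ?thesis using 3 i ij(3) loop2 by auto
      qed
    qed
    obtain Y where Y: "sym_mat Y" "\<And>i j. {i, j} \<in> C \<Longrightarrow> Y (f i) (f j) = w i * w j"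
      using matrix_pushforward[of C "\<lambda>i j. w i * w j" f, OF scC mult.commute cons] by blast
    define Z where "Z x y = M x y - Y x y" for x y
    have nY: "nonneg_mat ?X1 Y"
      unfolding nonneg_mat_def
    proof (intro conjI ballI Y(1))
      fix G' assume "G' \<in> ?X1"
      then obtain G where G: "G \<in> C" "G' = f ` G" by blast
      have "psd G (\<lambda>i j. Y (f i) (f j)) \<longleftrightarrow> psd G (\<lambda>i j. w i * w j)"
        using Y(2) CD(10)[OF G(1)] by (intro psd_cong) blast
      then show "psd G' Y" using psd_reindex[OF injF[OF G(1)]] psd_outer G(2) by blast
    qed
    have nZ: "nonneg_mat ?X1 Z"
      unfolding nonneg_mat_def
    proof (intro conjI ballI)
      show "sym_mat Z" using Y(1) extD(2) unfolding sym_mat_def Z_def by simp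
      fix G' assume "G' \<in> ?X1"
      then obtain G where G: "G \<in> C" "G' = f ` G" by blast
      have "psd G (\<lambda>i j. Z (f i) (f j)) \<longleftrightarrow> psd G (\<lambda>i j. Q i j - w i * w j)"
        using Y(2) agreeD[OF Q(3)] CD(10)[OF G(1)] unfolding Z_def N_def by (intro psd_cong) simp
      moreover have "psd G (\<lambda>i j. Q i j - w i * w j)" by (rule psd_mono[OF CD(1) wpsd CD(4)[OF G(1)]])
      ultimately show "psd G' Z" using psd_reindex[OF injF[OF G(1)]] G(2) by blast
    qed
    have "agree ?X1 M (\<lambda>i j. Y i j + Z i j)" unfolding agree_def Z_def by simp
    \<comment> \<open>Only the vertices f H and f T can be shared, and there the balanced square has
      c times the entry of M.\<close>
    moreover have "Y x y = c * M x y" if "{x, y} \<in> ?X1" "{x, y} \<in> X2" for x y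
      using cap[OF that] Y(2)[of H H] Y(2)[of T T] Hf wH wT QH QT by auto
    ultimately obtain t where t: "agree ?X1 Y (\<lambda>i j. t * M i j)"
      using extremal_glue[OF image_simplicial[OF scC] sc2 ext nY nZ _ c] by blast
    have tM: "w i * w j = t * M (f i) (f j)" if "{i, j} \<in> C" for i j
    proof -
      have "{f i, f j} \<in> ?X1" by (intro image_eqI[OF _ that]) simp
      then show ?thesis using agreeD[OF t] Y(2)[OF that] by simp
    qed
    \<comment> \<open>A nonzero entry of w rules out t = 0, which nothing else excludes when c = 0.
      After that, dividing by t exhibits M as a square on the handle.\<close>
    obtain k where k: "k \<in> ?V" "w k \<noteq> 0" using wk by blast
    have kC: "{k, k} \<in> C" using CD(7)[OF k(1)] by simp
    have "0 < w k * w k" using k(2) by (metis not_real_square_gt_zero)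
    moreover have "0 \<le> M (f k) (f k)" using nonneg_mat_diag(1)[OF scC N, of k] kC unfolding N_def by simp
    ultimately have t0: "0 < t" using tM[OF kC] by (simp add: zero_less_mult_iff)
    show ?thesis
    proof (rule rank_one_image[OF injF[OF F]], rule rank_one_outer[of "1 / t"])
      show "0 \<le> 1 / t" using t0 by simp
      fix i j assume "i \<in> F" "j \<in> F"
      then show "M (f i) (f j) = 1 / t * (w i * w j)" using tM[OF CD(10)[OF F]] t0 by simp
    qed
  qed
qed

text \<open>A normal form that is constant along the generators and reachable from each point has
  the equivalence classes as its fibres. Identifications in a quotient can then be decided by
  computing \<open>rep\<close>.\<close>

lemma generated_equiv_class_eq_iff:
  assumes S: "\<And>x y. (x, y) \<in> S \<Longrightarrow> rep x = rep y"
    and rep: "\<And>x. x \<in> V \<Longrightarrow> (x, rep x) \<in> (S \<union> S\<inverse>)\<^sup>*"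
    and xy: "x \<in> V" "y \<in> V"
  shows "generated_equiv V S `` {x} = generated_equiv V S `` {y} \<longleftrightarrow> rep x = rep y"
proof -
  have fwd: "rep u = rep v" if "(u, v) \<in> (S \<union> S\<inverse>)\<^sup>*" for u v
    using that by induction (use S in auto)
  have "sym (S \<union> S\<inverse>)" by (auto simp: sym_def)
  then have "sym ((S \<union> S\<inverse>)\<^sup>*)" by (rule sym_rtrancl)
  then have bwd: "(u, v) \<in> (S \<union> S\<inverse>)\<^sup>*" if "u \<in> V" "v \<in> V" "rep u = rep v" for u v
    using rep[OF that(1)] rep[OF that(2)] that(3) by (metis rtrancl_trans symD)
  have "generated_equiv V S `` {u} = {v \<in> V. rep u = rep v}" if "u \<in> V" for u
  proof (intro Set.set_eqI iffI)
    fix v assume "v \<in> generated_equiv V S `` {u}"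
    then show "v \<in> {v \<in> V. rep u = rep v}" using fwd[of u v] unfolding generated_equiv_def by simp
  next
    fix v assume "v \<in> {v \<in> V. rep u = rep v}"
    then show "v \<in> generated_equiv V S `` {u}" using bwd[of u v] that unfolding generated_equiv_def by simp
  qed
  then show ?thesis using xy by auto
qed

text \<open>The arc set is a parameter so that one arc can be separated from the others; the
  vertices of D all stay with the remaining arcs.\<close>

definition thickening_part ::
  "'e set \<Rightarrow> ('n, 'e) pre_digraph \<Rightarrow> ('e \<Rightarrow> 'v set set) \<Rightarrow> ('e \<times> 'v + 'n) set set" where
  "thickening_part A D C =
     (\<Union>e\<in>A. (\<lambda>F. (\<lambda>v. Inl (e, v)) ` F) ` C e) \<union> {{}} \<union> {{Inr n} | n. n \<in> verts D}"

lemma vertices_thickening_part: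
  fixes D :: "('n, 'e) pre_digraph" and C :: "'e \<Rightarrow> 'v set set"
  shows "vertices (thickening_part A D C) = (\<Union>e\<in>A. (\<lambda>v. Inl (e, v)) ` vertices (C e)) \<union> Inr ` verts D"
proof -
  have "vertices (\<Union>e\<in>A. (`) (\<lambda>v. Inl (e, v) :: 'e \<times> 'v + 'n) ` C e) = (\<Union>e\<in>A. vertices ((`) (\<lambda>v. Inl (e, v)) ` C e))"
    unfolding vertices_def by (rule Set.set_eqI) (simp only: Union_iff UN_iff, blast)
  moreover have "vertices {{Inr n} | n. n \<in> verts D} = (Inr ` verts D :: ('e \<times> 'v + 'n) set)"
    unfolding vertices_def by auto
  ultimately have "vertices (thickening_part A D C) = (\<Union>e\<in>A. vertices ((`) (\<lambda>v. Inl (e, v)) ` C e)) \<union> Inr ` verts D"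
    unfolding thickening_part_def vertices_def by (simp only: Union_Un_distrib Union_insert Union_empty Un_empty_right)
  then show ?thesis unfolding vertices_image .
qed

lemma thickening_part_simplicial:
  assumes "finite A" "finite (verts D)" "\<And>e. e \<in> A \<Longrightarrow> simplicial_complex (C e)"
  shows "simplicial_complex (thickening_part A D C)"
proof -
  let ?I = "\<lambda>e. (`) (\<lambda>v. Inl (e, v)) ` C e"
  have I: "simplicial_complex (?I e)" if "e \<in> A" for e using assms(3)[OF that] by (rule image_simplicial)
  have "finite (vertices (thickening_part A D C))"
    unfolding vertices_thickening_part using assms simplicial_complexD(1) by blast
  moreover have "G \<in> thickening_part A D C" if F: "F \<in> thickening_part A D C" and G: "G \<subseteq> F" for F G
  proof -
    from F consider e where "e \<in> A" "F \<in> ?I e" | "F = {}" | n where "n \<in> verts D" "F = {Inr n}"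
      unfolding thickening_part_def by blast
    then show ?thesis
    proof cases
      case 1
      then have "G \<in> ?I e" using simplicial_complexD(3)[OF I _ G] by blast
      then show ?thesis using 1(1) unfolding thickening_part_def by blast
    next
      case 2
      then show ?thesis using F G by simp
    next
      case 3
      then have "G = {} \<or> G = F" using G by blast
      then show ?thesis using F unfolding thickening_part_def by blast
    qed
  qed
  moreover have "{} \<in> thickening_part A D C" unfolding thickening_part_def by blast
  ultimately show ?thesis unfolding simplicial_complex_def by blast
qed

text \<open>A face coming from an arc e is treated by regarding the image of \<open>C e\<close> as a
  handle attached to the image of everything else.\<close>

theorem thickening_locally_rank_one:
  fixes D :: "('n, 'e) pre_digraph" and C :: "'e \<Rightarrow> 'v set set"
  assumes data: "thickening_data D C H T"
  shows "simplicial_complex (thickening D C H T)" "locally_rank_one (thickening D C H T)"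
proof -
  have fin: "finite (verts D)" "finite (arcs D)"
    using data unfolding thickening_data_def fin_digraph_def fin_digraph_axioms_def by blast+
  have ed: "chordal_complex (C e)" "H e \<in> vertices (C e)" "T e \<in> vertices (C e)" "{H e, T e} \<notin> C e"
    if "e \<in> arcs D" for e
    using data that unfolding thickening_data_def by blast+
  have scC: "simplicial_complex (C e)" if "e \<in> arcs D" for e
    using ed(1)[OF that] by (rule chordal_complex_simplicial)
  have HneT: "H e \<noteq> T e" if "e \<in> arcs D" for e
    using ed(2,4)[OF that] simplicial_complexD(7)[OF scC[OF that]] by force
  define U where "U A = thickening_part A D C" for A
  have U: "thickening_union D C = U (arcs D)" unfolding U_def thickening_part_def thickening_union_def ..
  have scU: "simplicial_complex (U A)" if "A \<subseteq> arcs D" for A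
    unfolding U_def using that fin scC finite_subset by (intro thickening_part_simplicial) blast+
  define V where "V = vertices (U (arcs D))"
  define S :: "(('e \<times> 'v + 'n) \<times> ('e \<times> 'v + 'n)) set" where "S = {(Inr (head D e), Inl (e, H e)) | e. e \<in> arcs D} \<union>
           {(Inr (tail D e), Inl (e, T e)) | e. e \<in> arcs D}"
  define cl where "cl x = generated_equiv V S `` {x}" for x
  define X where "X = thickening D C H T"
  have X: "X = (`) cl ` U (arcs D)"
    unfolding X_def thickening_def quotient_complex_def U cl_def V_def S_def ..
  show scX: "simplicial_complex (thickening D C H T)"
    unfolding X_def[symmetric] X by (rule image_simplicial[OF scU]) simp
  \<comment> \<open>Endpoints of arcs are represented by the vertices of D to which they are glued,
    and every other vertex represents itself.\<close>
  define rep :: "'e \<times> 'v + 'n \<Rightarrow> 'e \<times> 'v + 'n" where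
    "rep x = (case x of Inr n \<Rightarrow> Inr n | Inl (e, v) \<Rightarrow>
      if v = H e then Inr (head D e) else if v = T e then Inr (tail D e) else Inl (e, v))" for x
  have VInl: "Inl (e, v) \<in> V \<longleftrightarrow> e \<in> arcs D \<and> v \<in> vertices (C e)" for e v
    unfolding V_def U_def vertices_thickening_part by auto
  have Srep: "rep x = rep y" if "(x, y) \<in> S" for x y
  proof -
    from that consider e where "e \<in> arcs D" "x = Inr (head D e)" "y = Inl (e, H e)"
      | e where "e \<in> arcs D" "x = Inr (tail D e)" "y = Inl (e, T e)"
      unfolding S_def by blast
    then show ?thesis
    proof cases
      case 1
      then show ?thesis unfolding rep_def by simp
    next
      case 2
      then show ?thesis using HneT[of e] unfolding rep_def by simp
    qed
  qed
  have repS: "(x, rep x) \<in> (S \<union> S\<inverse>)\<^sup>*" if x: "x \<in> V" for x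
  proof (cases x)
    case (Inr n)
    then show ?thesis unfolding rep_def by simp
  next
    case (Inl p)
    obtain e v where p: "p = (e, v)" by (cases p)
    have e: "e \<in> arcs D" using x VInl unfolding Inl p by blast
    have "rep x = x \<or> (x, rep x) \<in> S\<inverse>" using e unfolding Inl p S_def rep_def by auto
    then show ?thesis by auto
  qed
  have cl_eq: "cl x = cl y \<longleftrightarrow> rep x = rep y" if "x \<in> V" "y \<in> V" for x y
    unfolding cl_def by (rule generated_equiv_class_eq_iff[OF Srep repS that])
  show "locally_rank_one (thickening D C H T)"
    unfolding X_def[symmetric] locally_rank_one_def
  proof (intro allI impI ballI)
    fix M F' assume ext: "extremal X M" and F': "F' \<in> X"
    from F' consider e F where "e \<in> arcs D" "F \<in> C e" "F' = cl ` ((\<lambda>v. Inl (e, v)) ` F)" | "F' = {}"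
      | n where "F' = {cl (Inr n)}"
      unfolding X U_def thickening_part_def by blast
    then show "rank_one F' M"
    proof cases
      case 2
      then show ?thesis by (intro rank_one_zero) simp
    next
      case 3
      \<comment> \<open>A single vertex carries a 1 by 1 matrix, which is a square as soon as it is
        nonnegative.\<close>
      have "0 \<le> M (cl (Inr n)) (cl (Inr n))"
        using nonneg_mat_diag(1)[OF scX[folded X_def] extremalD(1)[OF ext]] F' 3 by simp
      then show ?thesis using 3 by (intro rank_one_outer[of _ F' M "\<lambda>_. 1"]) auto
    next
      case 1
      define f where "f v = cl (Inl (e, v))" for v
      define X2 where "X2 = (`) cl ` U (arcs D - {e})"
      have "U (arcs D) = (`) (\<lambda>v. Inl (e, v)) ` C e \<union> U (arcs D - {e})"
        using 1(1) unfolding U_def thickening_part_def by auto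
      then have X12: "X = (`) f ` C e \<union> X2"
        unfolding X X2_def f_def by (simp add: image_Un image_image)
      have V2: "x \<in> V" "x \<noteq> Inl (e, v)" if "x \<in> vertices (U (arcs D - {e}))" for x v
        using that unfolding V_def U_def vertices_thickening_part by auto
      have sc2: "simplicial_complex (U (arcs D - {e}))" by (rule scU) blast
      have eV: "Inl (e, v) \<in> V" if "v \<in> vertices (C e)" for v using VInl 1(1) that by blast
      have "rank_one (f ` F) M"
      proof (rule extremal_handle_rank_one[OF ed[OF 1(1)]])
        show "simplicial_complex X2" unfolding X2_def using sc2 by (rule image_simplicial)
        show "extremal ((`) f ` C e \<union> X2) M" using ext unfolding X12 .
        show "F \<in> C e" by fact
        fix u v assume "u \<in> vertices (C e)" "v \<in> vertices (C e)" "f u = f v"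
        then have "rep (Inl (e, u)) = rep (Inl (e, v))" using cl_eq eV unfolding f_def by blast
        then show "u = v \<or> {u, v} = {H e, T e}" unfolding rep_def by (auto split: if_splits)
      next
        fix x y assume xy1: "{x, y} \<in> (`) f ` C e" and xy2: "{x, y} \<in> X2"
        obtain u v where uv: "x = f u" "y = f v" "{u, v} \<in> C e" using image_pairE[OF xy1 scC[OF 1(1)]] .
        obtain p q where pq: "x = cl p" "y = cl q" "{p, q} \<in> U (arcs D - {e})"
          using image_pairE[OF xy2[unfolded X2_def] sc2] .
        have pqV: "p \<in> vertices (U (arcs D - {e}))" "q \<in> vertices (U (arcs D - {e}))"
          using simplicial_complexD(4)[OF sc2 pq(3)] by auto
        have uvV: "u \<in> vertices (C e)" "v \<in> vertices (C e)"
          using simplicial_complexD(4)[OF scC[OF 1(1)] uv(3)] by auto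
        \<comment> \<open>A vertex of \<open>C e\<close> other than the endpoints is its own normal
          form, and no vertex outside of \<open>C e\<close> has this normal form.\<close>
        have mem: "k \<in> {H e, T e}"
          if k: "k \<in> vertices (C e)" "z \<in> vertices (U (arcs D - {e}))" "f k = cl z" for k z
        proof (rule ccontr)
          assume "k \<notin> {H e, T e}"
          then have "rep (Inl (e, k)) = Inl (e, k)" unfolding rep_def by auto
          moreover have "rep (Inl (e, k)) = rep z" using cl_eq[OF eV[OF k(1)] V2(1)[OF k(2)]] k(3) unfolding f_def by blast
          moreover have "rep z = z \<or> (\<exists>n. rep z = Inr n)" unfolding rep_def by (auto split: sum.split)
          ultimately show False using V2(2)[OF k(2), of k] by auto
        qed
        have "u \<in> {H e, T e}" "v \<in> {H e, T e}"
          using mem[OF uvV(1) pqV(1)] mem[OF uvV(2) pqV(2)] uv pq by auto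
        moreover have "{T e, H e} \<notin> C e" using ed(4)[OF 1(1)] by (simp add: insert_commute)
        \<comment> \<open>Two different endpoints do not form a face of \<open>C e\<close>, so u and
          v coincide.\<close>
        ultimately show "x = y \<and> x \<in> {f (H e), f (T e)}" using uv ed(4)[OF 1(1)] by auto
      qed
      moreover have "F' = f ` F" unfolding 1(3) f_def by (simp add: image_image)
      ultimately show ?thesis by simp
    qed
  qed
qed

theorem one_sum_locally_rank_one:
  assumes sc: "simplicial_complex \<Delta>" "simplicial_complex \<Gamma>"
    and lr: "locally_rank_one \<Delta>" "locally_rank_one \<Gamma>"
    and disj: "vertices \<Delta> \<inter> vertices \<Gamma> = {}" and ab: "a \<in> vertices \<Delta>" "b \<in> vertices \<Gamma>"
  shows "simplicial_complex (one_sum \<Delta> \<Gamma> a b)" "locally_rank_one (one_sum \<Delta> \<Gamma> a b)"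
proof -
  define V where "V = vertices (\<Delta> \<union> \<Gamma>)"
  have V: "V = vertices \<Delta> \<union> vertices \<Gamma>" unfolding V_def vertices_def by blast
  define cl where "cl x = generated_equiv V {(a, b)} `` {x}" for x
  \<comment> \<open>The point b is replaced by a. Since the vertex sets are disjoint, neither
    summand contains both points, and the class map is injective on each.\<close>
  define rep where "rep x = (if x = b then a else x)" for x
  have cl_eq: "cl x = cl y \<longleftrightarrow> rep x = rep y" if "x \<in> V" "y \<in> V" for x y
    unfolding cl_def
    by (rule generated_equiv_class_eq_iff[OF _ _ that]) (auto simp: rep_def)
  have eq: "one_sum \<Delta> \<Gamma> a b = (`) cl ` \<Delta> \<union> (`) cl ` \<Gamma>"
    unfolding one_sum_def quotient_complex_def cl_def V_def by (simp add: image_Un)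
  have "vertices ((`) cl ` \<Delta> \<union> (`) cl ` \<Gamma>) = vertices ((`) cl ` \<Delta>) \<union> vertices ((`) cl ` \<Gamma>)"
    unfolding vertices_def by blast
  then show "simplicial_complex (one_sum \<Delta> \<Gamma> a b)"
    using image_simplicial[OF sc(1), of cl] image_simplicial[OF sc(2), of cl]
    unfolding eq simplicial_complex_def by auto
  have inj: "inj_on cl (vertices \<Delta>)" "inj_on cl (vertices \<Gamma>)"
  proof -
    have "b \<notin> vertices \<Delta>" "a \<notin> vertices \<Gamma>" using disj ab by auto
    moreover have "rep x = rep y"
      if "cl x = cl y" "(x \<in> vertices \<Delta> \<and> y \<in> vertices \<Delta>) \<or> (x \<in> vertices \<Gamma> \<and> y \<in> vertices \<Gamma>)" for x y
      using that V cl_eq[of x y] by auto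
    ultimately have "x = y"
      if "cl x = cl y" "(x \<in> vertices \<Delta> \<and> y \<in> vertices \<Delta>) \<or> (x \<in> vertices \<Gamma> \<and> y \<in> vertices \<Gamma>)" for x y
      using that unfolding rep_def by (metis (no_types, lifting))
    then show "inj_on cl (vertices \<Delta>)" "inj_on cl (vertices \<Gamma>)" unfolding inj_on_def by blast+
  qed
  have "cl ` vertices \<Delta> \<inter> cl ` vertices \<Gamma> = {cl a}"
  proof
    have "cl a = cl b" using cl_eq[of a b] ab unfolding V rep_def by auto
    then show "{cl a} \<subseteq> cl ` vertices \<Delta> \<inter> cl ` vertices \<Gamma>" using ab by auto
    show "cl ` vertices \<Delta> \<inter> cl ` vertices \<Gamma> \<subseteq> {cl a}"
    proof
      fix z assume "z \<in> cl ` vertices \<Delta> \<inter> cl ` vertices \<Gamma>"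
      then obtain x y where xy: "x \<in> vertices \<Delta>" "y \<in> vertices \<Gamma>" "z = cl x" "cl x = cl y" by auto
      then have "rep x = rep y" using cl_eq[of x y] V by auto
      then have "x = a" using xy(1,2) disj ab unfolding rep_def by (auto split: if_splits)
      then show "z \<in> {cl a}" using xy(3) by simp
    qed
  qed
  then show "locally_rank_one (one_sum \<Delta> \<Gamma> a b)"
    unfolding eq by (rule locally_rank_one_one_sum[OF sc lr inj])
qed

section \<open>Quadratic forms in the Stanley-Reisner ring\<close>

lemma keys_add_nat:
  fixes a b :: "'v \<Rightarrow>\<^sub>0 nat"
  shows "Poly_Mapping.keys (a + b) = Poly_Mapping.keys a \<union> Poly_Mapping.keys b"
  by (auto simp: in_keys_iff lookup_add)

lemma mult_keysE:
  assumes "m \<in> Poly_Mapping.keys (p * q :: 'v rpoly)"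
  obtains a b where "m = a + b" "a \<in> Poly_Mapping.keys p" "b \<in> Poly_Mapping.keys q"
  using keys_mult[of p q] assms by blast

lemma poly_ring_simps:
  "p \<in> carrier (poly_ring V) \<longleftrightarrow> (\<forall>m\<in>Poly_Mapping.keys p. Poly_Mapping.keys m \<subseteq> V)"
  "mult (poly_ring V) = (*)" "add (poly_ring V) = (+)" "one (poly_ring V) = 1" "zero (poly_ring V) = 0"
  unfolding poly_ring_def by simp_all

lemma poly_ring_cring: "cring (poly_ring V)"
proof -
  have add: "p + q \<in> carrier (poly_ring V)" if "p \<in> carrier (poly_ring V)" "q \<in> carrier (poly_ring V)" for p q
    using that keys_add[of p q] unfolding poly_ring_simps by blast
  have mult: "p * q \<in> carrier (poly_ring V)" if "p \<in> carrier (poly_ring V)" "q \<in> carrier (poly_ring V)" for p q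
    unfolding poly_ring_simps
  proof
    fix m assume "m \<in> Poly_Mapping.keys (p * q)"
    then obtain a b where ab: "m = a + b" "a \<in> Poly_Mapping.keys p" "b \<in> Poly_Mapping.keys q"
      by (rule mult_keysE)
    then have "Poly_Mapping.keys a \<subseteq> V" "Poly_Mapping.keys b \<subseteq> V"
      using that unfolding poly_ring_simps by blast+
    then show "Poly_Mapping.keys m \<subseteq> V" unfolding ab(1) keys_add_nat by simp
  qed
  have neg: "\<exists>q\<in>carrier (poly_ring V). q + p = 0" if "p \<in> carrier (poly_ring V)" for p
    using that unfolding poly_ring_simps by (intro bexI[of _ "- p"]) (auto simp: poly_ring_simps)
  show ?thesis
  proof (rule cringI)
    show "abelian_group (poly_ring V)"
      by (rule abelian_groupI) (use add neg in \<open>auto simp: poly_ring_simps(2-) add_ac\<close>, simp add: poly_ring_simps)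
    show "comm_monoid (poly_ring V)"
      by (rule comm_monoidI) (use mult in \<open>auto simp: poly_ring_simps(2-) mult_ac\<close>, simp add: poly_ring_simps)
  qed (simp add: poly_ring_simps(2-) distrib_right)
qed

lemma poly_ring_a_inv: "p \<in> carrier (poly_ring V) \<Longrightarrow> \<ominus>\<^bsub>poly_ring V\<^esub> p = - p"
proof -
  interpret cring "poly_ring V" by (rule poly_ring_cring)
  assume p: "p \<in> carrier (poly_ring V)"
  moreover have "- p \<in> carrier (poly_ring V)" using p unfolding poly_ring_simps by simp
  ultimately show ?thesis using sum_zero_eq_neg[of "- p" p] by (simp add: poly_ring_simps(2-))
qed

text \<open>
  This ideal contains \<open>SR_ideal \<Delta>\<close>, and its elements vanish on \<open>realization \<Delta>\<close> monomial by monomial.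
\<close>

definition nonface_polys :: "'v set set \<Rightarrow> 'v rpoly set" where
  "nonface_polys \<Delta> = {p \<in> carrier (poly_ring (vertices \<Delta>)). \<forall>m\<in>Poly_Mapping.keys p. Poly_Mapping.keys m \<notin> \<Delta>}"

text \<open>Exponents are natural numbers, so the support of a product of monomials is the union of
  the supports, and nonfaces are closed under supersets.\<close>

lemma nonface_polys_ideal:
  assumes "simplicial_complex \<Delta>"
  shows "ideal (nonface_polys \<Delta>) (poly_ring (vertices \<Delta>))"
proof -
  interpret cring "poly_ring (vertices \<Delta>)" by (rule poly_ring_cring)
  have up: "Poly_Mapping.keys (a + b) \<notin> \<Delta>" if "Poly_Mapping.keys a \<notin> \<Delta>" for a b :: "'a \<Rightarrow>\<^sub>0 nat"
    using that simplicial_complexD(3)[OF assms, of "Poly_Mapping.keys (a + b)" "Poly_Mapping.keys a"]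
    by (auto simp: keys_add_nat)
  have l: "x * a \<in> nonface_polys \<Delta>" if "a \<in> nonface_polys \<Delta>" "x \<in> carrier (poly_ring (vertices \<Delta>))" for a x
  proof -
    have "x * a \<in> carrier (poly_ring (vertices \<Delta>))"
      using m_closed[of x a] that unfolding nonface_polys_def by (simp add: poly_ring_simps(2))
    moreover have "Poly_Mapping.keys m \<notin> \<Delta>" if "m \<in> Poly_Mapping.keys (x * a)" for m
      using that
    proof (rule mult_keysE)
      fix u v assume uv: "m = u + v" "v \<in> Poly_Mapping.keys a"
      then show ?thesis using up[of v u] \<open>a \<in> nonface_polys \<Delta>\<close> unfolding nonface_polys_def by (simp add: add.commute)
    qed
    ultimately show ?thesis unfolding nonface_polys_def by blast
  qed
  show ?thesis
  proof (rule idealI)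
    show "subgroup (nonface_polys \<Delta>) (add_monoid (poly_ring (vertices \<Delta>)))"
    proof (rule group.subgroupI[OF a_group])
      show "nonface_polys \<Delta> \<subseteq> carrier (add_monoid (poly_ring (vertices \<Delta>)))"
        unfolding nonface_polys_def by auto
      have "0 \<in> nonface_polys \<Delta>" unfolding nonface_polys_def poly_ring_simps by simp
      then show "nonface_polys \<Delta> \<noteq> {}" by blast
      show "inv\<^bsub>add_monoid (poly_ring (vertices \<Delta>))\<^esub> p \<in> nonface_polys \<Delta>" if p: "p \<in> nonface_polys \<Delta>" for p
      proof -
        have "\<ominus>\<^bsub>poly_ring (vertices \<Delta>)\<^esub> p = - p" using p by (intro poly_ring_a_inv) (simp add: nonface_polys_def)
        moreover have "- p \<in> nonface_polys \<Delta>" using p unfolding nonface_polys_def poly_ring_simps by simp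
        ultimately show ?thesis unfolding a_inv_def by simp
      qed
      show "p \<otimes>\<^bsub>add_monoid (poly_ring (vertices \<Delta>))\<^esub> q \<in> nonface_polys \<Delta>"
        if "p \<in> nonface_polys \<Delta>" "q \<in> nonface_polys \<Delta>" for p q
      proof -
        have "p + q \<in> nonface_polys \<Delta>"
          using that keys_add[of p q] unfolding nonface_polys_def poly_ring_simps by blast
        then show ?thesis by (simp add: poly_ring_simps(3))
      qed
    qed
    show "x \<otimes>\<^bsub>poly_ring (vertices \<Delta>)\<^esub> a \<in> nonface_polys \<Delta>"
      "a \<otimes>\<^bsub>poly_ring (vertices \<Delta>)\<^esub> x \<in> nonface_polys \<Delta>"
      if "a \<in> nonface_polys \<Delta>" "x \<in> carrier (poly_ring (vertices \<Delta>))" for a x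
      using l[OF that] by (simp_all add: poly_ring_simps(2) mult.commute)
  qed (rule ring_axioms)
qed

lemma prod_var_poly: "finite S \<Longrightarrow>
    (\<Prod>i\<in>S. var_poly i) = Poly_Mapping.single (\<Sum>i\<in>S. Poly_Mapping.single i 1) 1"
  by (induction S rule: finite_induct) (simp_all add: var_poly_def mult_single)

lemma keys_sum_single: "finite S \<Longrightarrow> Poly_Mapping.keys (\<Sum>i\<in>S. Poly_Mapping.single i (1::nat)) = S"
  by (induction S rule: finite_induct) (simp_all add: keys_add_nat)

lemma SR_generators_subset:
  assumes "simplicial_complex \<Delta>"
  shows "{(\<Prod>i\<in>S. var_poly i) | S. S \<subseteq> vertices \<Delta> \<and> S \<notin> \<Delta>} \<subseteq> nonface_polys \<Delta>"
proof -
  have "(\<Prod>i\<in>S. var_poly i) \<in> nonface_polys \<Delta>" if "S \<subseteq> vertices \<Delta>" "S \<notin> \<Delta>" for S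
  proof -
    have "finite S" using that(1) simplicial_complexD(1)[OF assms] finite_subset by blast
    then show ?thesis using that
      unfolding nonface_polys_def poly_ring_simps prod_var_poly[OF \<open>finite S\<close>]
      by (simp add: keys_sum_single del: One_nat_def)
  qed
  then show ?thesis by blast
qed

lemma SR_ideal_ideal:
  assumes "simplicial_complex \<Delta>"
  shows "ideal (SR_ideal \<Delta>) (poly_ring (vertices \<Delta>))"
proof -
  interpret cring "poly_ring (vertices \<Delta>)" by (rule poly_ring_cring)
  show ?thesis unfolding SR_ideal_def
    using SR_generators_subset[OF assms] unfolding nonface_polys_def by (intro genideal_ideal) blast
qed

lemma SR_ideal_nonface:
  assumes "simplicial_complex \<Delta>"
  shows "SR_ideal \<Delta> \<subseteq> nonface_polys \<Delta>"
proof -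
  interpret cring "poly_ring (vertices \<Delta>)" by (rule poly_ring_cring)
  show ?thesis unfolding SR_ideal_def
    by (rule genideal_minimal[OF nonface_polys_ideal[OF assms] SR_generators_subset[OF assms]])
qed

section \<open>Evaluation on the realization\<close>

lemma eval_poly_superset:
  assumes "finite A" "Poly_Mapping.keys p \<subseteq> A"
  shows "eval_poly p x = (\<Sum>m\<in>A. Poly_Mapping.lookup p m *
        (\<Prod>i\<in>Poly_Mapping.keys m. x i ^ Poly_Mapping.lookup m i))"
  unfolding eval_poly_def using assms
  by (intro sum.mono_neutral_left) (auto simp: in_keys_iff)

lemma eval_poly_add: "eval_poly (p + q) x = eval_poly p x + eval_poly q x"
proof -
  let ?A = "Poly_Mapping.keys p \<union> Poly_Mapping.keys q"
  have *: "finite ?A" "Poly_Mapping.keys p \<subseteq> ?A" "Poly_Mapping.keys q \<subseteq> ?A" "Poly_Mapping.keys (p + q) \<subseteq> ?A"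
    using keys_add[of p q] by auto
  show ?thesis
    unfolding eval_poly_superset[OF *(1,2)] eval_poly_superset[OF *(1,3)] eval_poly_superset[OF *(1,4)]
    by (simp add: lookup_add distrib_right sum.distrib)
qed

lemma eval_poly_zero: "eval_poly 0 x = 0"
  unfolding eval_poly_def by simp

lemma eval_poly_sum: "eval_poly (\<Sum>i\<in>A. f i) x = (\<Sum>i\<in>A. eval_poly (f i) x)"
  by (induction A rule: infinite_finite_induct) (simp_all add: eval_poly_add eval_poly_zero)

lemma eval_poly_single:
  "eval_poly (Poly_Mapping.single m c) x = c * (\<Prod>i\<in>Poly_Mapping.keys m. x i ^ Poly_Mapping.lookup m i)"
  by (subst eval_poly_superset[of "{m}"]) auto

lemma eval_poly_nonface:
  assumes "simplicial_complex \<Delta>" "p \<in> nonface_polys \<Delta>" "x \<in> realization \<Delta>"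
  shows "eval_poly p x = 0"
  unfolding eval_poly_def
proof (rule sum.neutral, rule ballI)
  fix m assume m: "m \<in> Poly_Mapping.keys p"
  obtain F where F: "F \<in> \<Delta>" "\<And>i. i \<notin> F \<Longrightarrow> x i = 0"
    using assms(3) unfolding realization_def coord_subspace_def by auto
  have "Poly_Mapping.keys m \<notin> \<Delta>" using assms(2) m unfolding nonface_polys_def by blast
  then obtain i where i: "i \<in> Poly_Mapping.keys m" "i \<notin> F"
    using simplicial_complexD(3)[OF assms(1) F(1)] by blast
  then have "x i ^ Poly_Mapping.lookup m i = 0" using F(2) by (simp add: in_keys_iff)
  then have "(\<Prod>i\<in>Poly_Mapping.keys m. x i ^ Poly_Mapping.lookup m i) = 0"
    using i(1) by (intro prod_zero) auto
  then show "Poly_Mapping.lookup p m * (\<Prod>i\<in>Poly_Mapping.keys m. x i ^ Poly_Mapping.lookup m i) = 0" by simp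
qed

text \<open>Elements of the ideal vanish on the realization, so the set of values of a class is a
  singleton and \<open>the_elem\<close> is meaningful.\<close>

lemma SR_eval_class:
  assumes "simplicial_complex \<Delta>" "x \<in> realization \<Delta>"
  shows "SR_eval (SR_class \<Delta> p) x = eval_poly p x"
proof -
  interpret I: ideal "SR_ideal \<Delta>" "poly_ring (vertices \<Delta>)" by (rule SR_ideal_ideal[OF assms(1)])
  have "SR_class \<Delta> p = {h + p | h. h \<in> SR_ideal \<Delta>}"
    unfolding SR_class_def a_r_coset_def' by (auto simp: poly_ring_simps(3))
  moreover have "0 \<in> SR_ideal \<Delta>" using additive_subgroup.zero_closed[OF I.is_additive_subgroup]
    by (simp add: poly_ring_simps(5))
  moreover have "eval_poly (h + p) x = eval_poly p x" if "h \<in> SR_ideal \<Delta>" for h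
    using that SR_ideal_nonface[OF assms(1)] eval_poly_nonface[OF assms(1) _ assms(2)]
    by (auto simp: eval_poly_add)
  ultimately have "(\<lambda>p. eval_poly p x) ` SR_class \<Delta> p = {eval_poly p x}" by auto
  then show ?thesis unfolding SR_eval_def by simp
qed

section \<open>Linear and quadratic forms as vectors and matrices\<close>

abbreviation mon2 :: "'v \<Rightarrow> 'v \<Rightarrow> 'v \<Rightarrow>\<^sub>0 nat" where
  "mon2 i j \<equiv> Poly_Mapping.single i 1 + Poly_Mapping.single j 1"

text \<open>The sum runs over ordered pairs, so for distinct i and j the coefficient of x_i x_j is
  \<open>M i j + M j i\<close>, and a symmetric M is the usual matrix of the form.\<close>

definition quad_poly :: "'v set \<Rightarrow> ('v \<Rightarrow> 'v \<Rightarrow> real) \<Rightarrow> 'v rpoly" where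
  "quad_poly V M = (\<Sum>i\<in>V. \<Sum>j\<in>V. Poly_Mapping.single (mon2 i j) (M i j))"

definition lin_poly :: "'v set \<Rightarrow> ('v \<Rightarrow> real) \<Rightarrow> 'v rpoly" where
  "lin_poly V a = (\<Sum>i\<in>V. Poly_Mapping.single (Poly_Mapping.single i 1) (a i))"

definition quad_class :: "'v set set \<Rightarrow> ('v \<Rightarrow> 'v \<Rightarrow> real) \<Rightarrow> 'v rpoly set" where
  "quad_class \<Delta> M = SR_class \<Delta> (quad_poly (vertices \<Delta>) M)"

lemma eval_quad_poly: "eval_poly (quad_poly V M) x = bform V M x x"
proof -
  have "(\<Prod>k\<in>Poly_Mapping.keys (mon2 i j). x k ^ Poly_Mapping.lookup (mon2 i j) k) = x i * x j" for i j
    by (cases "i = j") (simp_all add: keys_add_nat lookup_add lookup_single power2_eq_square)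
  then show ?thesis unfolding quad_poly_def bform_def
    by (simp add: eval_poly_sum eval_poly_single mult.assoc)
qed

lemma eval_lin_poly: "eval_poly (lin_poly V a) x = (\<Sum>i\<in>V. a i * x i)"
  unfolding lin_poly_def by (simp add: eval_poly_sum eval_poly_single)

lemma quad_poly_add: "quad_poly V (\<lambda>i j. M i j + N i j) = quad_poly V M + quad_poly V N"
  unfolding quad_poly_def by (simp add: single_add sum.distrib)

lemma quad_poly_scale: "quad_poly V (\<lambda>i j. c * M i j) = const_poly c * quad_poly V M"
  unfolding quad_poly_def const_poly_def by (simp add: sum_distrib_left mult_single)

lemma quad_poly_zero: "quad_poly V (\<lambda>i j. 0) = 0"
  unfolding quad_poly_def by simp

lemma lin_poly_square: "lin_poly V a * lin_poly V a = quad_poly V (\<lambda>i j. a i * a j)"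
  unfolding lin_poly_def quad_poly_def sum_product by (simp add: mult_single)

lemma keys_sum_subset: "(\<And>i. i \<in> A \<Longrightarrow> Poly_Mapping.keys (f i) \<subseteq> K) \<Longrightarrow> Poly_Mapping.keys (\<Sum>i\<in>A. f i) \<subseteq> K"
  by (rule subset_trans[OF Poly_Mapping.keys_sum]) blast

lemma keys_quad_poly: "Poly_Mapping.keys (quad_poly V M) \<subseteq> {mon2 i j | i j. i \<in> V \<and> j \<in> V}"
  unfolding quad_poly_def by (intro keys_sum_subset) (auto split: if_splits)

lemma keys_lin_poly: "Poly_Mapping.keys (lin_poly V a) \<subseteq> {Poly_Mapping.single i 1 | i. i \<in> V}"
  unfolding lin_poly_def by (intro keys_sum_subset) (auto split: if_splits)

definition mdeg :: "('v \<Rightarrow>\<^sub>0 nat) \<Rightarrow> nat" where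
  "mdeg m = (\<Sum>i\<in>Poly_Mapping.keys m. Poly_Mapping.lookup m i)"

lemma homogeneous_mdeg: "homogeneous d p \<longleftrightarrow> (\<forall>m\<in>Poly_Mapping.keys p. mdeg m = d)"
  unfolding homogeneous_def mdeg_def ..

lemma mdeg_single: "mdeg (Poly_Mapping.single i n) = n"
  unfolding mdeg_def by simp

lemma mdeg_add: "mdeg (a + b) = mdeg a + mdeg b"
proof -
  let ?A = "Poly_Mapping.keys a \<union> Poly_Mapping.keys b"
  have *: "mdeg c = (\<Sum>i\<in>?A. Poly_Mapping.lookup c i)" if "Poly_Mapping.keys c \<subseteq> ?A" for c
    unfolding mdeg_def using that by (intro sum.mono_neutral_left) (auto simp: in_keys_iff)
  show ?thesis using *[of a] *[of b] *[of "a + b"] by (simp add: keys_add_nat lookup_add sum.distrib)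
qed

lemma quad_poly_carrier: "quad_poly V M \<in> carrier (poly_ring V)" "homogeneous 2 (quad_poly V M)"
proof -
  have *: "Poly_Mapping.keys m \<subseteq> V \<and> mdeg m = 2" if "m \<in> Poly_Mapping.keys (quad_poly V M)" for m
    using that keys_quad_poly[of V M] by (auto simp: keys_add_nat mdeg_add mdeg_single)
  show "quad_poly V M \<in> carrier (poly_ring V)" unfolding poly_ring_simps using * by blast
  show "homogeneous 2 (quad_poly V M)" unfolding homogeneous_mdeg using * by blast
qed

lemma lin_poly_carrier: "lin_poly V a \<in> carrier (poly_ring V)" "homogeneous 1 (lin_poly V a)"
proof -
  have *: "Poly_Mapping.keys m \<subseteq> V \<and> mdeg m = 1" if "m \<in> Poly_Mapping.keys (lin_poly V a)" for m
    using that keys_lin_poly[of V a] by (auto simp: mdeg_single)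
  show "lin_poly V a \<in> carrier (poly_ring V)" unfolding poly_ring_simps using * by blast
  show "homogeneous 1 (lin_poly V a)" unfolding homogeneous_mdeg using * by blast
qed

lemma mdeg_Suc_split:
  assumes "mdeg m = Suc d"
  obtains i m' where "m = Poly_Mapping.single i 1 + m'" "mdeg m' = d"
proof -
  have "\<exists>i\<in>Poly_Mapping.keys m. Poly_Mapping.lookup m i \<noteq> 0"
    using assms unfolding mdeg_def by (metis sum.neutral nat.distinct(1))
  then obtain i where i: "Poly_Mapping.lookup m i \<noteq> 0" by blast
  have m: "m = Poly_Mapping.single i 1 + (m - Poly_Mapping.single i 1)"
    using i by (intro poly_mapping_eqI) (auto simp: lookup_add lookup_minus lookup_single when_def)
  moreover have "mdeg m = 1 + mdeg (m - Poly_Mapping.single i 1)"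
    by (subst m) (simp add: mdeg_add mdeg_single)
  ultimately show ?thesis using that assms by simp
qed

lemma mdeg_eq_0: "mdeg m = 0 \<Longrightarrow> m = 0"
  unfolding mdeg_def by (intro poly_mapping_eqI) (auto simp: in_keys_iff)

lemma rpoly_sum_monomials: "(\<Sum>m\<in>Poly_Mapping.keys p. Poly_Mapping.single m (Poly_Mapping.lookup p m)) = (p :: 'v rpoly)"
  by (intro poly_mapping_eqI)
    (auto simp: lookup_sum lookup_single when_def in_keys_iff)

lemma homogeneous1_lin_poly:
  assumes "finite V" "p \<in> carrier (poly_ring V)" "homogeneous 1 p"
  shows "\<exists>a. p = lin_poly V a"
proof -
  have monom: "\<exists>a. Poly_Mapping.single m c = lin_poly V a" if m: "m \<in> Poly_Mapping.keys p" for m c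
  proof -
    have "mdeg m = Suc 0" "Poly_Mapping.keys m \<subseteq> V"
      using m assms unfolding homogeneous_mdeg poly_ring_simps by auto
    then obtain i where i: "m = Poly_Mapping.single i 1" "i \<in> V"
      using mdeg_Suc_split[of m 0] mdeg_eq_0 by (metis add.right_neutral keys_single insert_subset one_neq_zero)
    have "lin_poly V (\<lambda>k. if k = i then c else 0) = (\<Sum>k\<in>V. if k = i then Poly_Mapping.single m c else 0)"
      unfolding lin_poly_def i(1) by (intro sum.cong) auto
    then have "Poly_Mapping.single m c = lin_poly V (\<lambda>k. if k = i then c else 0)" using i(2) assms(1) by simp
    then show ?thesis by blast
  qed
  have "\<exists>a. (\<Sum>m\<in>K. Poly_Mapping.single m (Poly_Mapping.lookup p m)) = lin_poly V a"
    if "finite K" "K \<subseteq> Poly_Mapping.keys p" for K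
    using that
  proof (induction K rule: finite_induct)
    case empty
    show ?case by (intro exI[of _ "\<lambda>_. 0"]) (simp add: lin_poly_def)
  next
    case (insert m K)
    then obtain a b where "(\<Sum>m\<in>K. Poly_Mapping.single m (Poly_Mapping.lookup p m)) = lin_poly V a"
      "Poly_Mapping.single m (Poly_Mapping.lookup p m) = lin_poly V b" using monom by blast
    then have "(\<Sum>m\<in>insert m K. Poly_Mapping.single m (Poly_Mapping.lookup p m)) = lin_poly V (\<lambda>i. b i + a i)"
      using insert.hyps unfolding lin_poly_def by (simp add: single_add sum.distrib)
    then show ?case by blast
  qed
  from this[of "Poly_Mapping.keys p"] show ?thesis by (simp add: rpoly_sum_monomials)
qed

lemma homogeneous2_quad_poly:
  assumes "finite V" "p \<in> carrier (poly_ring V)" "homogeneous 2 p"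
  shows "\<exists>M. sym_mat M \<and> p = quad_poly V M"
proof -
  have monom: "\<exists>M. Poly_Mapping.single m c = quad_poly V M" if m: "m \<in> Poly_Mapping.keys p" for m c
  proof -
    have m2: "mdeg m = Suc (Suc 0)" "Poly_Mapping.keys m \<subseteq> V"
      using m assms unfolding homogeneous_mdeg poly_ring_simps by auto
    obtain i m' where i: "m = Poly_Mapping.single i 1 + m'" "mdeg m' = Suc 0" using mdeg_Suc_split[OF m2(1)] .
    obtain j m'' where j: "m' = Poly_Mapping.single j 1 + m''" "mdeg m'' = 0" using mdeg_Suc_split[OF i(2)] .
    have mij: "m = mon2 i j" using i j mdeg_eq_0 by simp
    have V: "i \<in> V" "j \<in> V" using m2(2) unfolding mij by (auto simp: keys_add_nat)
    have "quad_poly V (\<lambda>k l. if k = i then if l = j then c else 0 else 0)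
        = (\<Sum>k\<in>V. if k = i then \<Sum>l\<in>V. if l = j then Poly_Mapping.single m c else 0 else 0)"
      unfolding quad_poly_def mij by (intro sum.cong refl) (auto intro!: sum.cong)
    then have "Poly_Mapping.single m c = quad_poly V (\<lambda>k l. if k = i then if l = j then c else 0 else 0)"
      using V assms(1) by simp
    then show ?thesis by blast
  qed
  have "\<exists>M. (\<Sum>m\<in>K. Poly_Mapping.single m (Poly_Mapping.lookup p m)) = quad_poly V M"
    if "finite K" "K \<subseteq> Poly_Mapping.keys p" for K
    using that
  proof (induction K rule: finite_induct)
    case empty
    show ?case by (intro exI[of _ "\<lambda>_ _. 0"]) (simp add: quad_poly_zero)
  next
    case (insert m K)
    then obtain a b where "(\<Sum>m\<in>K. Poly_Mapping.single m (Poly_Mapping.lookup p m)) = quad_poly V a"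
      "Poly_Mapping.single m (Poly_Mapping.lookup p m) = quad_poly V b" using monom by blast
    then have "(\<Sum>m\<in>insert m K. Poly_Mapping.single m (Poly_Mapping.lookup p m)) = quad_poly V (\<lambda>i j. b i j + a i j)"
      using insert.hyps by (simp add: quad_poly_add)
    then show ?case by blast
  qed
  from this[of "Poly_Mapping.keys p"] obtain M where M: "p = quad_poly V M" by (auto simp: rpoly_sum_monomials)
  \<comment> \<open>The monomials do not distinguish M from its transpose, so averaging the two
    gives a symmetric matrix of the same polynomial.\<close>
  have tr: "quad_poly V (\<lambda>i j. (1 / 2) * M j i) = quad_poly V (\<lambda>i j. (1 / 2) * M i j)"
    unfolding quad_poly_def by (subst sum.swap) (simp add: add.commute)
  have "p = quad_poly V (\<lambda>i j. (1 / 2) * M i j + (1 / 2) * M i j)" using M by simp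
  also have "\<dots> = quad_poly V (\<lambda>i j. (1 / 2) * M i j + (1 / 2) * M j i)" unfolding quad_poly_add tr ..
  finally show ?thesis
    by (intro exI[of _ "\<lambda>i j. (1 / 2) * M i j + (1 / 2) * M j i"]) (auto simp: sym_mat_def)
qed

text \<open>Evaluation at e_i, e_j and e_i + e_j recovers the entry. Test vectors supported in F
  suffice, and on these a residue class can be evaluated.\<close>

lemma bform_polarization:
  assumes "finite F" "sym_mat M" "sym_mat N" "i \<in> F" "j \<in> F"
    and eq: "\<And>x. x \<in> coord_subspace F \<Longrightarrow> bform F M x x = bform F N x x"
  shows "M i j = N i j"
proof -
  have u: "unit_vec k \<in> coord_subspace F" if "k \<in> F" for k
    using that unfolding unit_vec_def coord_subspace_def by auto
  have s: "(\<lambda>k. unit_vec i k + unit_vec j k) \<in> coord_subspace F"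
    using assms(4,5) unfolding unit_vec_def coord_subspace_def by auto
  have "bform F L (\<lambda>k. unit_vec i k + unit_vec j k) (\<lambda>k. unit_vec i k + unit_vec j k)
      = bform F L (unit_vec i) (unit_vec i) + 2 * L i j + bform F L (unit_vec j) (unit_vec j)"
    if "sym_mat L" for L
    using that assms(1,4,5) by (simp add: bform_lin bform_unit_unit sym_mat_def)
  from this[OF assms(2)] this[OF assms(3)] show ?thesis
    using eq[OF s] eq[OF u[OF assms(4)]] eq[OF u[OF assms(5)]] by simp
qed

lemma coord_subspace_realization: "F \<in> \<Delta> \<Longrightarrow> x \<in> coord_subspace F \<Longrightarrow> x \<in> realization \<Delta>"
  unfolding realization_def by blast

lemma bform_coord_subspace:
  assumes "simplicial_complex \<Delta>" "F \<in> \<Delta>" "x \<in> coord_subspace F"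
  shows "bform (vertices \<Delta>) M x x = bform F M x x"
  using assms simplicial_complexD(1,4)[OF assms(1)]
  by (intro bform_restrict) (auto simp: coord_subspace_def)

lemma SR_eval_quad_class:
  assumes "simplicial_complex \<Delta>" "F \<in> \<Delta>" "x \<in> coord_subspace F"
  shows "SR_eval (quad_class \<Delta> M) x = bform F M x x"
  unfolding quad_class_def using assms
  by (simp add: SR_eval_class coord_subspace_realization eval_quad_poly bform_coord_subspace)

section \<open>Residue classes of quadratic forms\<close>

lemma SR_class_add:
  assumes "simplicial_complex \<Delta>" "p \<in> carrier (poly_ring (vertices \<Delta>))" "q \<in> carrier (poly_ring (vertices \<Delta>))"
  shows "SR_class \<Delta> p \<oplus>\<^bsub>SR_ring \<Delta>\<^esub> SR_class \<Delta> q = SR_class \<Delta> (p + q)"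
proof -
  interpret I: ideal "SR_ideal \<Delta>" "poly_ring (vertices \<Delta>)" by (rule SR_ideal_ideal[OF assms(1)])
  show ?thesis using I.a_rcos_sum[OF assms(2,3)]
    unfolding SR_class_def SR_ring_def FactRing_def by (simp add: poly_ring_simps(3))
qed

lemma SR_class_mult:
  assumes "simplicial_complex \<Delta>" "p \<in> carrier (poly_ring (vertices \<Delta>))" "q \<in> carrier (poly_ring (vertices \<Delta>))"
  shows "SR_class \<Delta> p \<otimes>\<^bsub>SR_ring \<Delta>\<^esub> SR_class \<Delta> q = SR_class \<Delta> (p * q)"
proof -
  interpret I: ideal "SR_ideal \<Delta>" "poly_ring (vertices \<Delta>)" by (rule SR_ideal_ideal[OF assms(1)])
  show ?thesis using I.rcoset_mult_add[OF assms(2,3)]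
    unfolding SR_class_def SR_ring_def FactRing_def by (simp add: poly_ring_simps(2))
qed

lemma SR_class_eqI:
  assumes "simplicial_complex \<Delta>" "p \<in> carrier (poly_ring (vertices \<Delta>))" "q \<in> carrier (poly_ring (vertices \<Delta>))"
    and "p - q \<in> SR_ideal \<Delta>"
  shows "SR_class \<Delta> p = SR_class \<Delta> q"
proof -
  interpret R: cring "poly_ring (vertices \<Delta>)" by (rule poly_ring_cring)
  have "p \<ominus>\<^bsub>poly_ring (vertices \<Delta>)\<^esub> q = p - q"
    unfolding a_minus_def poly_ring_a_inv[OF assms(3)] by (simp add: poly_ring_simps(3))
  then show ?thesis
    using R.quotient_eq_iff_same_a_r_cos[OF SR_ideal_ideal[OF assms(1)] assms(2,3)] assms(4)
    unfolding SR_class_def by simp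
qed

lemma SR_ring_zero: "simplicial_complex \<Delta> \<Longrightarrow> \<zero>\<^bsub>SR_ring \<Delta>\<^esub> = SR_class \<Delta> 0"
proof -
  assume "simplicial_complex \<Delta>"
  then interpret I: ideal "SR_ideal \<Delta>" "poly_ring (vertices \<Delta>)" by (rule SR_ideal_ideal)
  have "0 \<in> SR_ideal \<Delta>"
    using additive_subgroup.zero_closed[OF I.is_additive_subgroup] by (simp add: poly_ring_simps(5))
  then show ?thesis using I.a_rcos_const unfolding SR_class_def SR_ring_def FactRing_def by simp
qed

lemma const_poly_carrier: "const_poly c \<in> carrier (poly_ring V)"
  unfolding const_poly_def poly_ring_simps by simp

text \<open>Every surviving term belongs to a nonface {i, j}. Here i and j differ, because
  singletons of vertices are faces, so the term is a constant times the generator x_i x_j. In degree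
  2 this is the converse to the inclusion of the ideal in \<open>nonface_polys\<close>.\<close>

lemma quad_poly_nonface_in_SR_ideal:
  assumes sc: "simplicial_complex \<Delta>" and D: "agree \<Delta> D (\<lambda>i j. 0)"
  shows "quad_poly (vertices \<Delta>) D \<in> SR_ideal \<Delta>"
proof -
  let ?V = "vertices \<Delta>"
  interpret R: cring "poly_ring ?V" by (rule poly_ring_cring)
  interpret I: ideal "SR_ideal \<Delta>" "poly_ring ?V" by (rule SR_ideal_ideal[OF sc])
  have zero: "0 \<in> SR_ideal \<Delta>"
    using additive_subgroup.zero_closed[OF I.is_additive_subgroup] by (simp add: poly_ring_simps(5))
  have add: "p + q \<in> SR_ideal \<Delta>" if "p \<in> SR_ideal \<Delta>" "q \<in> SR_ideal \<Delta>" for p q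
    using additive_subgroup.a_closed[OF I.is_additive_subgroup that] by (simp add: poly_ring_simps(3))
  have sum: "(\<Sum>i\<in>A. f i) \<in> SR_ideal \<Delta>" if "\<And>i. i \<in> A \<Longrightarrow> f i \<in> SR_ideal \<Delta>" for A and f :: "'a \<Rightarrow> 'a rpoly"
    using that by (induction A rule: infinite_finite_induct) (simp_all add: zero add)
  have "Poly_Mapping.single (mon2 i j) (D i j) \<in> SR_ideal \<Delta>" if ij: "i \<in> ?V" "j \<in> ?V" for i j
  proof (cases "{i, j} \<in> \<Delta>")
    case True
    then show ?thesis using agreeD[OF D True] zero by simp
  next
    case False
    then have ne: "i \<noteq> j" using simplicial_complexD(7)[OF sc ij(1)] by auto
    have gen: "{(\<Prod>i\<in>S. var_poly i) | S. S \<subseteq> ?V \<and> S \<notin> \<Delta>} \<subseteq> SR_ideal \<Delta>"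
      unfolding SR_ideal_def
      using SR_generators_subset[OF sc] unfolding nonface_polys_def by (intro R.genideal_self) blast
    have "(\<Prod>k\<in>{i, j}. var_poly k) \<in> SR_ideal \<Delta>"
      using ij False by (intro subsetD[OF gen] CollectI exI[of _ "{i, j}"]) simp
    then have "const_poly (D i j) * (\<Prod>k\<in>{i, j}. var_poly k) \<in> SR_ideal \<Delta>"
      using I.I_l_closed[OF _ const_poly_carrier] by (simp add: poly_ring_simps(2))
    then show ?thesis using ne by (simp add: const_poly_def var_poly_def mult_single)
  qed
  then show ?thesis unfolding quad_poly_def by (intro sum) blast
qed

text \<open>Entries on faces are recovered from a class by polarization, and the entries elsewhere
  contribute elements of the ideal. So R_2 is the space of symmetric matrices modulo their entries
  off the faces.\<close>

lemma quad_class_eq_iff: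
  assumes sc: "simplicial_complex \<Delta>" and sym: "sym_mat M" "sym_mat N"
  shows "quad_class \<Delta> M = quad_class \<Delta> N \<longleftrightarrow> agree \<Delta> M N"
proof
  assume eq: "quad_class \<Delta> M = quad_class \<Delta> N"
  show "agree \<Delta> M N"
    unfolding agree_def
  proof (intro allI impI)
    fix i j assume ij: "{i, j} \<in> \<Delta>"
    show "M i j = N i j"
    proof (rule bform_polarization[OF _ sym])
      fix x assume "x \<in> coord_subspace {i, j}"
      then show "bform {i, j} M x x = bform {i, j} N x x"
        using SR_eval_quad_class[OF sc ij] eq by metis
    qed simp_all
  qed
next
  assume "agree \<Delta> M N"
  then have "agree \<Delta> (\<lambda>i j. M i j + (- 1) * N i j) (\<lambda>i j. 0)" unfolding agree_def by simp
  from quad_poly_nonface_in_SR_ideal[OF sc this]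
  have "quad_poly (vertices \<Delta>) M - quad_poly (vertices \<Delta>) N \<in> SR_ideal \<Delta>"
    unfolding quad_poly_add quad_poly_scale by (simp add: const_poly_def single_uminus)
  then show "quad_class \<Delta> M = quad_class \<Delta> N"
    unfolding quad_class_def by (intro SR_class_eqI[OF sc] quad_poly_carrier)
qed

lemma quad_class_add:
  "simplicial_complex \<Delta> \<Longrightarrow> quad_class \<Delta> M \<oplus>\<^bsub>SR_ring \<Delta>\<^esub> quad_class \<Delta> N = quad_class \<Delta> (\<lambda>i j. M i j + N i j)"
  unfolding quad_class_def by (simp add: SR_class_add quad_poly_carrier quad_poly_add)

lemma quad_class_scale:
  "simplicial_complex \<Delta> \<Longrightarrow> SR_class \<Delta> (const_poly c) \<otimes>\<^bsub>SR_ring \<Delta>\<^esub> quad_class \<Delta> M = quad_class \<Delta> (\<lambda>i j. c * M i j)"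
  unfolding quad_class_def by (simp add: SR_class_mult quad_poly_carrier const_poly_carrier quad_poly_scale)

lemma quad_class_zero: "simplicial_complex \<Delta> \<Longrightarrow> \<zero>\<^bsub>SR_ring \<Delta>\<^esub> = quad_class \<Delta> (\<lambda>i j. 0)"
  unfolding quad_class_def by (simp add: SR_ring_zero quad_poly_zero)

lemma SR_degree_2:
  assumes "simplicial_complex \<Delta>"
  shows "SR_degree \<Delta> 2 = {quad_class \<Delta> M | M. sym_mat M}"
proof
  show "SR_degree \<Delta> 2 \<subseteq> {quad_class \<Delta> M | M. sym_mat M}"
    unfolding SR_degree_def quad_class_def
    using homogeneous2_quad_poly[OF simplicial_complexD(1)[OF assms]] by blast
  show "{quad_class \<Delta> M | M. sym_mat M} \<subseteq> SR_degree \<Delta> 2"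
    unfolding SR_degree_def quad_class_def using quad_poly_carrier by blast
qed

lemma quad_class_nonneg_iff:
  assumes sc: "simplicial_complex \<Delta>" and sym: "sym_mat M"
  shows "quad_class \<Delta> M \<in> nonneg_forms \<Delta> \<longleftrightarrow> nonneg_mat \<Delta> M"
proof -
  have "(\<forall>x\<in>coord_subspace F. 0 \<le> bform F M x x) \<longleftrightarrow> psd F M" for F
  proof
    assume L: "\<forall>x\<in>coord_subspace F. 0 \<le> bform F M x x"
    show "psd F M" unfolding psd_def
    proof
      fix x :: "'a \<Rightarrow> real"
      have "bform F M x x = bform F M (\<lambda>i. if i \<in> F then x i else 0) (\<lambda>i. if i \<in> F then x i else 0)"
        by (rule bform_cong) auto
      also have "\<dots> \<ge> 0" using L by (simp add: coord_subspace_def)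
      finally show "0 \<le> bform F M x x" .
    qed
  qed (simp add: psd_def)
  moreover have "quad_class \<Delta> M \<in> SR_degree \<Delta> 2" using sym unfolding SR_degree_2[OF sc] by blast
  moreover have "(\<forall>x\<in>realization \<Delta>. 0 \<le> SR_eval (quad_class \<Delta> M) x)
      \<longleftrightarrow> (\<forall>F\<in>\<Delta>. \<forall>x\<in>coord_subspace F. 0 \<le> bform F M x x)"
    using SR_eval_quad_class[OF sc] unfolding realization_def by auto
  ultimately show ?thesis using sym unfolding nonneg_forms_def nonneg_mat_def by blast
qed

lemma nonneg_formsE:
  assumes "simplicial_complex \<Delta>" "q \<in> nonneg_forms \<Delta>"
  obtains M where "q = quad_class \<Delta> M" "nonneg_mat \<Delta> M" "sym_mat M"
proof -
  obtain M where M: "q = quad_class \<Delta> M" "sym_mat M"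
    using assms(2) unfolding nonneg_forms_def SR_degree_2[OF assms(1)] by blast
  then show ?thesis using that assms(2) quad_class_nonneg_iff[OF assms(1)] by blast
qed

lemma sym_mat_lin: "sym_mat M \<Longrightarrow> sym_mat N \<Longrightarrow> sym_mat (\<lambda>i j. a * M i j + b * N i j)"
  unfolding sym_mat_def by simp

lemma lin_indep2_quad_class:
  assumes sc: "simplicial_complex \<Delta>" and sym: "sym_mat Y" "sym_mat Z"
  shows "lin_indep2 \<Delta> (quad_class \<Delta> Y) (quad_class \<Delta> Z) \<longleftrightarrow>
    (\<forall>a b. agree \<Delta> (\<lambda>i j. a * Y i j + b * Z i j) (\<lambda>i j. 0) \<longrightarrow> a = 0 \<and> b = 0)"
proof -
  have sym0: "sym_mat (\<lambda>i j. 0)" unfolding sym_mat_def by simp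
  show ?thesis
    unfolding lin_indep2_def quad_class_scale[OF sc] quad_class_add[OF sc] quad_class_zero[OF sc]
      quad_class_eq_iff[OF sc sym_mat_lin[OF sym] sym0] ..
qed

text \<open>A relation a Y + b Z = 0 together with M = Y + Z gives (a - b) Y = - b M, and conversely
  Y = t M gives the relation with coefficients 1 - t and - t.\<close>

lemma spans_extreme_ray_quad_class:
  assumes sc: "simplicial_complex \<Delta>" and sym: "sym_mat M"
  shows "spans_extreme_ray \<Delta> (nonneg_forms \<Delta>) (quad_class \<Delta> M) \<longleftrightarrow> extremal \<Delta> M"
proof -
  have sym0: "sym_mat (\<lambda>i j. 0)" unfolding sym_mat_def by simp
  have nz: "quad_class \<Delta> M \<noteq> \<zero>\<^bsub>SR_ring \<Delta>\<^esub> \<longleftrightarrow> \<not> agree \<Delta> M (\<lambda>i j. 0)"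
    unfolding quad_class_zero[OF sc] quad_class_eq_iff[OF sc sym sym0] ..
  show ?thesis
  proof
    assume L: "spans_extreme_ray \<Delta> (nonneg_forms \<Delta>) (quad_class \<Delta> M)"
    show "extremal \<Delta> M"
      unfolding extremal_def
    proof (intro conjI allI impI)
      show "nonneg_mat \<Delta> M" "\<not> agree \<Delta> M (\<lambda>i j. 0)"
        using L nz quad_class_nonneg_iff[OF sc sym] unfolding spans_extreme_ray_def by blast+
      fix Y Z assume Y: "nonneg_mat \<Delta> Y" and Z: "nonneg_mat \<Delta> Z"
        and sum: "agree \<Delta> M (\<lambda>i j. Y i j + Z i j)"
      have symY: "sym_mat Y" and symZ: "sym_mat Z" using Y Z unfolding nonneg_mat_def by blast+
      have "sym_mat (\<lambda>i j. Y i j + Z i j)" using sym_mat_lin[OF symY symZ, of 1 1] by simp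
      then have "quad_class \<Delta> M = quad_class \<Delta> Y \<oplus>\<^bsub>SR_ring \<Delta>\<^esub> quad_class \<Delta> Z"
        unfolding quad_class_add[OF sc] using quad_class_eq_iff[OF sc sym] sum by blast
      moreover have "quad_class \<Delta> Y \<in> nonneg_forms \<Delta>" "quad_class \<Delta> Z \<in> nonneg_forms \<Delta>"
        using Y Z symY symZ quad_class_nonneg_iff[OF sc] by blast+
      ultimately have "\<not> lin_indep2 \<Delta> (quad_class \<Delta> Y) (quad_class \<Delta> Z)"
        using L unfolding spans_extreme_ray_def by blast
      then obtain a b where ab: "agree \<Delta> (\<lambda>i j. a * Y i j + b * Z i j) (\<lambda>i j. 0)" "a \<noteq> 0 \<or> b \<noteq> 0"
        unfolding lin_indep2_quad_class[OF sc symY symZ] by blast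
      \<comment> \<open>Equal coefficients, not both zero, would make Y + Z and hence M zero on
        faces.\<close>
      have "a \<noteq> b"
      proof
        assume "a = b"
        then have "agree \<Delta> M (\<lambda>i j. 0)"
          using ab sum unfolding agree_def by (auto simp: distrib_left[symmetric])
        then show False using L nz unfolding spans_extreme_ray_def by blast
      qed
      moreover have "(a - b) * Y i j = - b * M i j" if "{i, j} \<in> \<Delta>" for i j
        using agreeD[OF ab(1) that] agreeD[OF sum that] by (simp add: algebra_simps)
      ultimately have "agree \<Delta> Y (\<lambda>i j. (- b / (a - b)) * M i j)"
        unfolding agree_def by (auto simp: field_simps)
      then show "\<exists>t. agree \<Delta> Y (\<lambda>i j. t * M i j)" by blast
    qed
  next
    assume ext: "extremal \<Delta> M"
    note extD = extremalD[OF ext]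
    show "spans_extreme_ray \<Delta> (nonneg_forms \<Delta>) (quad_class \<Delta> M)"
      unfolding spans_extreme_ray_def
    proof (intro conjI notI)
      show "quad_class \<Delta> M \<in> nonneg_forms \<Delta>" using extD(1) quad_class_nonneg_iff[OF sc sym] by blast
      show "False" if "quad_class \<Delta> M = \<zero>\<^bsub>SR_ring \<Delta>\<^esub>" using that nz extD(4) by blast
    next
      assume "\<exists>y\<in>nonneg_forms \<Delta>. \<exists>z\<in>nonneg_forms \<Delta>.
        lin_indep2 \<Delta> y z \<and> quad_class \<Delta> M = y \<oplus>\<^bsub>SR_ring \<Delta>\<^esub> z"
      then obtain y z where yz: "y \<in> nonneg_forms \<Delta>" "z \<in> nonneg_forms \<Delta>" "lin_indep2 \<Delta> y z"
        "quad_class \<Delta> M = y \<oplus>\<^bsub>SR_ring \<Delta>\<^esub> z" by blast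
      obtain Y where Y: "y = quad_class \<Delta> Y" "nonneg_mat \<Delta> Y" "sym_mat Y" using nonneg_formsE[OF sc yz(1)] .
      obtain Z where Z: "z = quad_class \<Delta> Z" "nonneg_mat \<Delta> Z" "sym_mat Z" using nonneg_formsE[OF sc yz(2)] .
      have "sym_mat (\<lambda>i j. Y i j + Z i j)" using sym_mat_lin[OF Y(3) Z(3), of 1 1] by simp
      then have sum: "agree \<Delta> M (\<lambda>i j. Y i j + Z i j)"
        using yz(4) quad_class_eq_iff[OF sc sym] unfolding Y(1) Z(1) quad_class_add[OF sc] by blast
      obtain t where t: "agree \<Delta> Y (\<lambda>i j. t * M i j)" using extD(5)[OF Y(2) Z(2) sum] by blast
      have "(1 - t) * Y i j + (- t) * Z i j = 0" if "{i, j} \<in> \<Delta>" for i j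
        using agreeD[OF t that] agreeD[OF sum that] by (simp add: algebra_simps)
      then have "agree \<Delta> (\<lambda>i j. (1 - t) * Y i j + (- t) * Z i j) (\<lambda>i j. 0)" unfolding agree_def by blast
      then have "1 - t = 0 \<and> - t = 0"
        using yz(3) unfolding Y(1) Z(1) lin_indep2_quad_class[OF sc Y(3) Z(3)] by blast
      then show False by auto
    qed
  qed
qed

text \<open>A sum of squares of linear forms has a matrix that is positive semidefinite on all
  vertices. This serves to treat extreme forms in \<Sigma>, which \<open>elocr\<close>
  ignores.\<close>

lemma sos_forms_completion:
  assumes sc: "simplicial_complex \<Delta>" and q: "q \<in> sos_forms \<Delta>"
  shows "\<exists>Q. sym_mat Q \<and> psd (vertices \<Delta>) Q \<and> q = quad_class \<Delta> Q"
proof -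
  let ?V = "vertices \<Delta>" and ?R = "SR_ring \<Delta>"
  interpret I: ideal "SR_ideal \<Delta>" "poly_ring ?V" by (rule SR_ideal_ideal[OF sc])
  interpret S: ring ?R unfolding SR_ring_def by (rule I.quotient_is_ring)
  have carr: "quad_class \<Delta> M \<in> carrier ?R" for M
    unfolding quad_class_def SR_class_def SR_ring_def FactRing_def A_RCOSETS_def'
    using quad_poly_carrier(1) by auto
  obtain k l where l: "q = (\<Oplus>\<^bsub>?R\<^esub> j\<in>{..<k}. l j \<otimes>\<^bsub>?R\<^esub> l j)" "\<forall>j<k::nat. l j \<in> SR_degree \<Delta> 1"
    using q unfolding sos_forms_def by blast
  have sq: "\<exists>a. l j \<otimes>\<^bsub>?R\<^esub> l j = quad_class \<Delta> (\<lambda>u v. a u * a v)" if j: "j < k" for j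
  proof -
    have "l j \<in> SR_degree \<Delta> 1" using l(2) j by blast
    then obtain a where a: "l j = SR_class \<Delta> (lin_poly ?V a)"
      using homogeneous1_lin_poly[OF simplicial_complexD(1)[OF sc]] unfolding SR_degree_def by blast
    have "l j \<otimes>\<^bsub>?R\<^esub> l j = quad_class \<Delta> (\<lambda>u v. a u * a v)"
      unfolding a quad_class_def SR_class_mult[OF sc lin_poly_carrier(1) lin_poly_carrier(1)] lin_poly_square ..
    then show ?thesis by blast
  qed
  have "\<exists>Q. sym_mat Q \<and> psd ?V Q \<and> (\<Oplus>\<^bsub>?R\<^esub> j\<in>{..<n}. l j \<otimes>\<^bsub>?R\<^esub> l j) = quad_class \<Delta> Q"
    if "n \<le> k" for n
    using that
  proof (induction n)
    case 0
    have "(\<Oplus>\<^bsub>?R\<^esub> j\<in>{..<0::nat}. l j \<otimes>\<^bsub>?R\<^esub> l j) = quad_class \<Delta> (\<lambda>i j. 0)"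
      using quad_class_zero[OF sc] by simp
    moreover have "sym_mat (\<lambda>i j. 0)" "psd ?V (\<lambda>i j. 0)"
      unfolding sym_mat_def psd_def bform_def by simp_all
    ultimately show ?case by blast
  next
    case (Suc n)
    then obtain Q where Q: "sym_mat Q" "psd ?V Q"
      "(\<Oplus>\<^bsub>?R\<^esub> j\<in>{..<n}. l j \<otimes>\<^bsub>?R\<^esub> l j) = quad_class \<Delta> Q" by auto
    obtain a where a: "l n \<otimes>\<^bsub>?R\<^esub> l n = quad_class \<Delta> (\<lambda>u v. a u * a v)" using sq[of n] Suc.prems by auto
    have "l j \<otimes>\<^bsub>?R\<^esub> l j \<in> carrier ?R" if "j \<le> n" for j
    proof -
      have "j < k" using that Suc.prems by simp
      then show ?thesis using sq[of j] carr by auto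
    qed
    then have "(\<Oplus>\<^bsub>?R\<^esub> j\<in>{..<Suc n}. l j \<otimes>\<^bsub>?R\<^esub> l j)
        = l n \<otimes>\<^bsub>?R\<^esub> l n \<oplus>\<^bsub>?R\<^esub> (\<Oplus>\<^bsub>?R\<^esub> j\<in>{..<n}. l j \<otimes>\<^bsub>?R\<^esub> l j)"
      unfolding lessThan_Suc by (intro S.finsum_insert) auto
    also have "\<dots> = quad_class \<Delta> (\<lambda>u v. a u * a v + Q u v)" unfolding a Q(3) quad_class_add[OF sc] ..
    finally have "(\<Oplus>\<^bsub>?R\<^esub> j\<in>{..<Suc n}. l j \<otimes>\<^bsub>?R\<^esub> l j) = quad_class \<Delta> (\<lambda>u v. a u * a v + Q u v)" .
    moreover have "sym_mat (\<lambda>u v. a u * a v + Q u v)" using Q(1) unfolding sym_mat_def by (simp add: mult.commute)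
    moreover have "psd ?V (\<lambda>u v. a u * a v + Q u v)" by (rule psd_add[OF psd_outer Q(2)])
    ultimately show ?case by blast
  qed
  then show ?thesis using l(1) by blast
qed

text \<open>For every k the conditions under the two minima are equivalent: linear forms on the face
  are coefficient vectors, and polarization turns the identity of functions into one of
  entries.\<close>

lemma form_rank_quad_class:
  assumes sc: "simplicial_complex \<Delta>" and sym: "sym_mat M" and F: "F \<in> \<Delta>"
  shows "form_rank F (SR_eval (quad_class \<Delta> M)) =
    (LEAST k. \<exists>w :: nat \<Rightarrow> 'v \<Rightarrow> real. \<forall>i\<in>F. \<forall>j\<in>F. M i j = (\<Sum>n<k. w n i * w n j))"
proof -
  have fin: "finite F" using simplicial_complexD(5)[OF sc F] .
  have bsum: "bform F (\<lambda>i j. \<Sum>n<k. w n i * w n j) x x = (\<Sum>n<k. (\<Sum>i\<in>F. w n i * x i)\<^sup>2)" for k :: nat and w x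
  proof (induction k)
    case (Suc k)
    then show ?case by (simp add: bform_mat_add bform_outer)
  qed (simp add: bform_def)
  have "(\<exists>l :: nat \<Rightarrow> 'v rpoly.
        (\<forall>j<k. l j \<in> carrier (poly_ring F) \<and> homogeneous 1 (l j)) \<and>
        (\<forall>x\<in>coord_subspace F. SR_eval (quad_class \<Delta> M) x = (\<Sum>j<k. (eval_poly (l j) x)\<^sup>2)))
    \<longleftrightarrow> (\<exists>w :: nat \<Rightarrow> 'v \<Rightarrow> real. \<forall>i\<in>F. \<forall>j\<in>F. M i j = (\<Sum>n<k. w n i * w n j))" (is "?L \<longleftrightarrow> ?R") for k
  proof
    assume ?L
    then obtain l :: "nat \<Rightarrow> 'v rpoly" where
      l: "\<And>j. j < k \<Longrightarrow> l j \<in> carrier (poly_ring F) \<and> homogeneous 1 (l j)"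
        "\<And>x. x \<in> coord_subspace F \<Longrightarrow> SR_eval (quad_class \<Delta> M) x = (\<Sum>j<k. (eval_poly (l j) x)\<^sup>2)"
      by blast
    have "\<exists>a. l j = lin_poly F a" if "j < k" for j
      using homogeneous1_lin_poly[OF fin] l(1)[OF that] by blast
    then obtain w where w: "\<And>j. j < k \<Longrightarrow> l j = lin_poly F (w j)" by metis
    have "M i j = (\<Sum>n<k. w n i * w n j)" if ij: "i \<in> F" "j \<in> F" for i j
    proof (rule bform_polarization[OF fin sym _ ij, where N = "\<lambda>i j. \<Sum>n<k. w n i * w n j"])
      show "sym_mat (\<lambda>i j. \<Sum>n<k. w n i * w n j)" unfolding sym_mat_def by (simp add: mult.commute)
      fix x assume x: "x \<in> coord_subspace F"
      show "bform F M x x = bform F (\<lambda>i j. \<Sum>n<k. w n i * w n j) x x"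
        using l(2)[OF x] w unfolding SR_eval_quad_class[OF sc F x] bsum by (simp add: eval_lin_poly)
    qed
    then show ?R by blast
  next
    assume ?R
    then obtain w :: "nat \<Rightarrow> 'v \<Rightarrow> real" where w: "\<forall>i\<in>F. \<forall>j\<in>F. M i j = (\<Sum>n<k. w n i * w n j)" by blast
    have ev: "SR_eval (quad_class \<Delta> M) x = (\<Sum>j<k. (eval_poly (lin_poly F (w j)) x)\<^sup>2)" if x: "x \<in> coord_subspace F" for x
    proof -
      have "bform F M x x = bform F (\<lambda>i j. \<Sum>n<k. w n i * w n j) x x" using w by (intro bform_cong) auto
      then show ?thesis unfolding SR_eval_quad_class[OF sc F x] bsum eval_lin_poly .
    qed
    show ?L
      by (intro exI[of _ "\<lambda>j. lin_poly F (w j)"] conjI allI impI ballI lin_poly_carrier ev)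
  qed
  then show ?thesis unfolding form_rank_def by simp
qed

text \<open>The decomposition by \<open>psd_sum_of_outer\<close> shows that the minimum is attained.
  Rank at most one includes the empty sum, which matches the zero matrix in
  \<open>rank_one\<close>.\<close>

lemma form_rank_bounds:
  fixes \<Delta> :: "'v set set"
  assumes sc: "simplicial_complex \<Delta>" and M: "nonneg_mat \<Delta> M" and F: "F \<in> \<Delta>"
  shows "form_rank F (SR_eval (quad_class \<Delta> M)) \<le> card F"
    "form_rank F (SR_eval (quad_class \<Delta> M)) \<le> 1 \<longleftrightarrow> rank_one F M"
proof -
  let ?P = "\<lambda>k. \<exists>w :: nat \<Rightarrow> 'v \<Rightarrow> real. \<forall>i\<in>F. \<forall>j\<in>F. M i j = (\<Sum>n<k. w n i * w n j)"
  have sym: "sym_mat M" and psd: "psd F M" using M F unfolding nonneg_mat_def by auto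
  note eq = form_rank_quad_class[OF sc sym F]
  have card: "?P (card F)" using psd_sum_of_outer[OF simplicial_complexD(5)[OF sc F] sym psd] .
  then show "form_rank F (SR_eval (quad_class \<Delta> M)) \<le> card F" unfolding eq by (rule Least_le)
  show "form_rank F (SR_eval (quad_class \<Delta> M)) \<le> 1 \<longleftrightarrow> rank_one F M"
  proof
    assume "form_rank F (SR_eval (quad_class \<Delta> M)) \<le> 1"
    then have "?P 0 \<or> ?P 1" using LeastI[of ?P, OF card] unfolding eq by (auto simp: le_Suc_eq)
    then show "rank_one F M"
    proof
      assume "?P 0"
      then show ?thesis by (intro rank_one_zero) simp
    next
      assume "?P 1"
      then obtain w :: "nat \<Rightarrow> 'v \<Rightarrow> real" where "\<forall>i\<in>F. \<forall>j\<in>F. M i j = w 0 i * w 0 j" by auto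
      then show ?thesis unfolding rank_one_def by blast
    qed
  next
    assume "rank_one F M"
    then obtain w where "\<forall>i\<in>F. \<forall>j\<in>F. M i j = w i * w j" unfolding rank_one_def by blast
    then have "?P 1" by (intro exI[of _ "\<lambda>_. w"]) simp
    then show "form_rank F (SR_eval (quad_class \<Delta> M)) \<le> 1" unfolding eq by (rule Least_le)
  qed
qed

text \<open>The forms over which \<open>elocr\<close> is taken are a subset of the extreme ones, and
  those left out have local rank at most one anyway: either \<Delta> is chordal, or the form is a
  sum of squares and the completion argument applies.\<close>

theorem elocr_le_1_iff:
  assumes sc: "simplicial_complex \<Delta>"
  shows "elocr \<Delta> \<le> 1 \<longleftrightarrow> locally_rank_one \<Delta>"
proof (cases "chordal_complex \<Delta>")
  case True
  then show ?thesis using chordal_complex_locally_rank_one unfolding elocr_def by simp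
next
  case False
  define A where "A = {locr \<Delta> q | q. q \<in> nonneg_forms \<Delta> - sos_forms \<Delta> \<and> spans_extreme_ray \<Delta> (nonneg_forms \<Delta>) q}"
  have elocr: "elocr \<Delta> = Sup A" using False unfolding elocr_def A_def by simp
  note scD = simplicial_complexD[OF sc]
  have ne: "\<Delta> \<noteq> {}" using scD(2) by blast
  have locr: "locr \<Delta> q \<le> n \<longleftrightarrow> (\<forall>F\<in>\<Delta>. form_rank F (SR_eval q) \<le> n)" for q n
    unfolding locr_def using scD(6) ne by simp
  \<comment> \<open>An upper bound is needed for each local rank to lie below the supremum.\<close>
  have bdd: "bdd_above A"
  proof (rule bdd_aboveI)
    fix r assume "r \<in> A"
    then obtain q where q: "r = locr \<Delta> q" "q \<in> nonneg_forms \<Delta>" unfolding A_def by blast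
    obtain M where M: "q = quad_class \<Delta> M" "nonneg_mat \<Delta> M" using nonneg_formsE[OF sc q(2)] .
    show "r \<le> card (vertices \<Delta>)"
      unfolding q(1) locr
    proof
      fix F assume F: "F \<in> \<Delta>"
      have "form_rank F (SR_eval q) \<le> card F" unfolding M(1) by (rule form_rank_bounds(1)[OF sc M(2) F])
      also have "\<dots> \<le> card (vertices \<Delta>)" by (rule card_mono[OF scD(1) scD(4)[OF F]])
      finally show "form_rank F (SR_eval q) \<le> card (vertices \<Delta>)" .
    qed
  qed
  show ?thesis
  proof
    assume le: "elocr \<Delta> \<le> 1"
    show "locally_rank_one \<Delta>"
      unfolding locally_rank_one_def
    proof (intro allI impI ballI)
      fix M F assume ext: "extremal \<Delta> M" and F: "F \<in> \<Delta>"
      note extD = extremalD[OF ext]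
      show "rank_one F M"
      proof (cases "quad_class \<Delta> M \<in> sos_forms \<Delta>")
        case True
        then obtain Q where Q: "sym_mat Q" "psd (vertices \<Delta>) Q" "quad_class \<Delta> M = quad_class \<Delta> Q"
          using sos_forms_completion[OF sc] by blast
        have "agree \<Delta> M Q" using Q(3) quad_class_eq_iff[OF sc extD(2) Q(1)] by blast
        then show ?thesis by (rule extremal_completion_rank_one[OF sc ext Q(1,2) _ F])
      next
        case False
        have "quad_class \<Delta> M \<in> nonneg_forms \<Delta>" using quad_class_nonneg_iff[OF sc extD(2)] extD(1) by blast
        moreover have "spans_extreme_ray \<Delta> (nonneg_forms \<Delta>) (quad_class \<Delta> M)"
          using spans_extreme_ray_quad_class[OF sc extD(2)] ext by blast
        ultimately have "locr \<Delta> (quad_class \<Delta> M) \<in> A" using False unfolding A_def by blast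
        then have "locr \<Delta> (quad_class \<Delta> M) \<le> 1" using cSup_upper[OF _ bdd] le unfolding elocr by force
        then show ?thesis using F form_rank_bounds(2)[OF sc extD(1) F] unfolding locr by blast
      qed
    qed
  next
    assume lr: "locally_rank_one \<Delta>"
    have "r \<le> 1" if r: "r \<in> A" for r
    proof -
      obtain q where q: "r = locr \<Delta> q" "q \<in> nonneg_forms \<Delta>" "spans_extreme_ray \<Delta> (nonneg_forms \<Delta>) q"
        using r unfolding A_def by blast
      obtain M where M: "q = quad_class \<Delta> M" "nonneg_mat \<Delta> M" "sym_mat M" using nonneg_formsE[OF sc q(2)] .
      have "extremal \<Delta> M" using q(3) spans_extreme_ray_quad_class[OF sc M(3)] unfolding M(1) by blast
      then have "\<forall>F\<in>\<Delta>. rank_one F M" using lr unfolding locally_rank_one_def by blast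
      then show "r \<le> 1" unfolding q(1) locr M(1) using form_rank_bounds(2)[OF sc M(2)] by blast
    qed
    \<comment> \<open>If no extreme form lies outside \<Sigma>, the supremum of the empty set of
      naturals is 0.\<close>
    then show "elocr \<Delta> \<le> 1"
      unfolding elocr by (cases "A = {}") (auto simp: Sup_nat_empty intro: cSup_least)
  qed
qed

lemma E1_iff: "\<Delta> \<in> E1 \<longleftrightarrow> simplicial_complex \<Delta> \<and> locally_rank_one \<Delta>"
  unfolding E1_def using elocr_le_1_iff by blast

theorem theorem3p6:
  shows "(thickened_graphs :: ('e \<times> 'v + 'n) set set set set) \<subseteq> E1 \<and>
    (\<forall>(\<Delta> :: 'a set set) \<Gamma> a b.
       \<Delta> \<in> E1 \<and> \<Gamma> \<in> E1 \<and> vertices \<Delta> \<inter> vertices \<Gamma> = {} \<and>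
       a \<in> vertices \<Delta> \<and> b \<in> vertices \<Gamma> \<longrightarrow> one_sum \<Delta> \<Gamma> a b \<in> E1) \<and>
    (\<forall>(\<Delta> :: 'b set set) v. \<Delta> \<in> E1 \<and> v \<notin> vertices \<Delta> \<longrightarrow> cone v \<Delta> \<in> E1)"
proof (intro conjI allI impI)
  show "(thickened_graphs :: ('e \<times> 'v + 'n) set set set set) \<subseteq> E1"
    unfolding thickened_graphs_def using thickening_locally_rank_one by (auto simp: E1_iff)
next
  fix \<Delta> \<Gamma> :: "'a set set" and a b
  assume "\<Delta> \<in> E1 \<and> \<Gamma> \<in> E1 \<and> vertices \<Delta> \<inter> vertices \<Gamma> = {} \<and> a \<in> vertices \<Delta> \<and> b \<in> vertices \<Gamma>"
  then show "one_sum \<Delta> \<Gamma> a b \<in> E1"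
    using one_sum_locally_rank_one[of \<Delta> \<Gamma> a b] unfolding E1_iff by blast
next
  fix \<Delta> :: "'b set set" and v
  assume "\<Delta> \<in> E1 \<and> v \<notin> vertices \<Delta>"
  then show "cone v \<Delta> \<in> E1"
    using cone_simplicial[of \<Delta> v] locally_rank_one_cone[of \<Delta> v] unfolding E1_iff by blast
qed

end
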